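(* Let $M$ be a $k$-dimensional compact Riemannian submanifold of $\mathbb{R}^m$, and let $P:M\to\mathbb{R}$ be a smooth probability density function on $M$ with $\inf_{x\in M}P(x)>0$. If data points $x_1,\dots,x_n$ are independent and identically distributed samples drawn from the distribution $P$ and $f:M\to\mathbb{R}$ is a smooth function, then for $x\in M$ and $t_n=n^{-\frac{1}{k+2+\alpha}}$, where $\alpha>0$, we have $$\frac{1}{n t_n}\,\mathbf{L}_n^{t_n}f(x)\ \overset{p}{\longrightarrow}\ \Delta_M f(x)$$ (convergence in probability) as $n$ goes to infinity, where $\mathbf{L}_n^t f(x)=\sum_{j=1}^n w_t(x,x_j)\,(f(x)-f(x_j))$ is the density-weighted operator built from $x_1,\dots,x_n$, $P$, $t$ and a scale parameter $\epsilon>0$, with the weights $w_t$ given in the context.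
   Context: Fix a scale parameter $\epsilon>0$. For $t>0$ and $x,y\in M$, let $g_t(x,y)=\frac{1}{(4\pi t)^{k/2}}e^{-\frac{\|x-y\|^2}{4t}}$ if $\|x-y\|<\epsilon$ and $g_t(x,y)=0$ if $\|x-y\|\ge\epsilon$, where $\|\cdot\|$ is the Euclidean norm of the ambient space $\mathbb{R}^m$. Let $w_t(x,y)=\frac{1}{P(y)}g_t(x,y)$. Given points $x_1,\dots,x_n\in M$, the operator $\mathbf{L}_n^t$ acts on functions $f:M\to\mathbb{R}$ by $\mathbf{L}_n^t f(x)=\sum_{j=1}^n w_t(x,x_j)(f(x)-f(x_j))$. The volume form $dV$ on $M$ is induced from the ambient Euclidean space, and $\int_M P\,dV=1$. $\Delta_M$ denotes the Laplace-Beltrami operator of $M$, with the sign convention $\Delta_M f=-\operatorname{div}(\operatorname{grad} f)$. *)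

theory Defs
  imports "HOL-Probability.Probability"
begin

text \<open>On an open set \<open>U\<close> this is membership in the class \<open>C\<^sup>n\<close>: all iterated directional
  derivatives up to order \<open>n\<close> exist and are continuous.\<close>

primrec Ck_on :: "nat \<Rightarrow> ('a::real_normed_vector \<Rightarrow> 'b::real_normed_vector) \<Rightarrow> 'a set \<Rightarrow> bool" where
  "Ck_on 0 f U \<longleftrightarrow> continuous_on U f"
| "Ck_on (Suc n) f U \<longleftrightarrow>
     (\<forall>x\<in>U. f differentiable (at x)) \<and> (\<forall>v. Ck_on n (\<lambda>x. frechet_derivative f (at x) v) U)"

definition smooth_on :: "'a::real_normed_vector set \<Rightarrow> ('a \<Rightarrow> 'b::real_normed_vector) \<Rightarrow> bool" where
  "smooth_on U f \<longleftrightarrow> (\<forall>n. Ck_on n f U)"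

text \<open>\<open>\<phi>\<close> is a smooth embedding of the open set \<open>U \<subseteq> \<real>\<^sup>k\<close>, \<open>k = CARD('k)\<close>, onto a relatively open
  part of \<open>M\<close>.\<close>

definition local_parametrization ::
    "'a::euclidean_space set \<Rightarrow> (real^'k) set \<Rightarrow> (real^'k \<Rightarrow> 'a) \<Rightarrow> bool" where
  "local_parametrization M U \<phi> \<longleftrightarrow>
     open U \<and> smooth_on U \<phi> \<and>
     \<phi> ` U \<subseteq> M \<and> openin (top_of_set M) (\<phi> ` U) \<and>
     (\<exists>\<psi>. homeomorphism U (\<phi> ` U) \<phi> \<psi>) \<and>
     (\<forall>u\<in>U. inj (frechet_derivative \<phi> (at u)))"

text \<open>The type argument only carries the dimension \<open>k = CARD('k)\<close>.\<close>

definition smooth_submanifold :: "'k::finite itself \<Rightarrow> 'a::euclidean_space set \<Rightarrow> bool" where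
  "smooth_submanifold _ M \<longleftrightarrow>
     (\<forall>p\<in>M. \<exists>U (\<phi> :: real^'k \<Rightarrow> 'a). local_parametrization M U \<phi> \<and> p \<in> \<phi> ` U)"

text \<open>Smoothness on a subset of Euclidean space: local extendability to smooth maps on open sets.
  Functions on \<open>M\<close> are total functions of which only the values on \<open>M\<close> matter.\<close>

definition smooth_on_submanifold ::
    "'a::euclidean_space set \<Rightarrow> ('a \<Rightarrow> 'b::real_normed_vector) \<Rightarrow> bool" where
  "smooth_on_submanifold M f \<longleftrightarrow>
     (\<forall>p\<in>M. \<exists>W F. open W \<and> p \<in> W \<and> smooth_on W F \<and> (\<forall>q\<in>W \<inter> M. F q = f q))"

text \<open>\<open>sqrt (det g)\<close>, where \<open>g\<close> is the matrix of the induced metric in the coordinates given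
  by \<open>\<phi>\<close>.\<close>

definition volume_density :: "(real^'k \<Rightarrow> 'a::euclidean_space) \<Rightarrow> real^'k \<Rightarrow> real" where
  "volume_density \<phi> u =
     sqrt (det (\<chi> i j. frechet_derivative \<phi> (at u) (axis i 1) \<bullet> frechet_derivative \<phi> (at u) (axis j 1)))"

text \<open>The measure \<open>dV\<close> is \<open>sqrt (det g) du\<close> in every local parametrization. As \<open>M\<close> is covered by
  countably many parametrized pieces, this determines the measure uniquely.\<close>

definition riemannian_volume ::
    "'k::finite itself \<Rightarrow> 'a::euclidean_space set \<Rightarrow> 'a measure \<Rightarrow> bool" where
  "riemannian_volume _ M V \<longleftrightarrow>
     sets V = sets (restrict_space borel M) \<and>
     (\<forall>U (\<phi> :: real^'k \<Rightarrow> 'a). local_parametrization M U \<phi> \<longrightarrow>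
        (\<forall>A\<in>sets V. A \<subseteq> \<phi> ` U \<longrightarrow>
           emeasure V A = (\<integral>\<^sup>+u\<in>U \<inter> \<phi> -` A. ennreal (volume_density \<phi> u) \<partial>lborel)))"

definition tangent_space :: "'a::euclidean_space set \<Rightarrow> 'a \<Rightarrow> 'a set" where
  "tangent_space M x =
     {v. \<exists>\<gamma> e. e > 0 \<and> smooth_on {-e<..<e} \<gamma> \<and> \<gamma> ` {-e<..<e} \<subseteq> M \<and> \<gamma> 0 = x \<and>
               (\<gamma> has_vector_derivative v) (at (0::real))}"

text \<open>The derivative of \<open>f\<close> relative to \<open>M\<close> is only unique on tangent vectors, and it is applied
  only to such.\<close>

definition grad :: "'a::euclidean_space set \<Rightarrow> ('a \<Rightarrow> real) \<Rightarrow> 'a \<Rightarrow> 'a" where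
  "grad M f x = (THE v. v \<in> tangent_space M x \<and>
     (\<forall>w\<in>tangent_space M x. v \<bullet> w = frechet_derivative f (at x within M) w))"

text \<open>The Levi-Civita connection of the induced metric is the orthogonal projection to the tangent
  space of the ambient derivative.\<close>

definition covariant_derivative ::
    "'a::euclidean_space set \<Rightarrow> ('a \<Rightarrow> 'a) \<Rightarrow> 'a \<Rightarrow> 'a \<Rightarrow> 'a" where
  "covariant_derivative M Y x v =
     closest_point (tangent_space M x) (frechet_derivative Y (at x within M) v)"

definition orthonormal_basis :: "'a::euclidean_space set \<Rightarrow> 'a set \<Rightarrow> bool" where
  "orthonormal_basis S B \<longleftrightarrow> pairwise orthogonal B \<and> (\<forall>b\<in>B. norm b = 1) \<and> span B = S"

text \<open>The divergence of a tangent field \<open>Y\<close> is the trace of \<open>v \<mapsto> \<nabla>\<^sub>v Y\<close> on the tangent space; the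
  value does not depend on the chosen orthonormal basis.\<close>

definition divergence :: "'a::euclidean_space set \<Rightarrow> ('a \<Rightarrow> 'a) \<Rightarrow> 'a \<Rightarrow> real" where
  "divergence M Y x =
     (\<Sum>b\<in>(SOME B. orthonormal_basis (tangent_space M x) B). covariant_derivative M Y x b \<bullet> b)"

definition laplace_beltrami :: "'a::euclidean_space set \<Rightarrow> ('a \<Rightarrow> real) \<Rightarrow> 'a \<Rightarrow> real" where
  "laplace_beltrami M f x = - divergence M (grad M f) x"

definition gauss_kernel :: "nat \<Rightarrow> real \<Rightarrow> real \<Rightarrow> 'a::euclidean_space \<Rightarrow> 'a \<Rightarrow> real" where
  "gauss_kernel k \<epsilon> t x y =
     (if norm (x - y) < \<epsilon>
      then 1 / (4 * pi * t) powr (real k / 2) * exp (- ((norm (x - y))\<^sup>2 / (4 * t))) else 0)"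

definition weight ::
    "nat \<Rightarrow> real \<Rightarrow> ('a::euclidean_space \<Rightarrow> real) \<Rightarrow> real \<Rightarrow> 'a \<Rightarrow> 'a \<Rightarrow> real" where
  "weight k \<epsilon> P t x y = 1 / P y * gauss_kernel k \<epsilon> t x y"

definition graph_laplacian ::
    "nat \<Rightarrow> real \<Rightarrow> ('a::euclidean_space \<Rightarrow> real) \<Rightarrow> (nat \<Rightarrow> 'a) \<Rightarrow> nat \<Rightarrow> real \<Rightarrow> ('a \<Rightarrow> real) \<Rightarrow> 'a \<Rightarrow> real"
  where
  "graph_laplacian k \<epsilon> P xs n t f x = (\<Sum>j=1..n. weight k \<epsilon> P t x (xs j) * (f x - f (xs j)))"

definition converges_in_probability ::
    "'w measure \<Rightarrow> (nat \<Rightarrow> 'w \<Rightarrow> real) \<Rightarrow> real \<Rightarrow> bool" where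
  "converges_in_probability \<Omega> Z c \<longleftrightarrow>
     (\<forall>n. Z n \<in> borel_measurable \<Omega>) \<and>
     (\<forall>\<delta>>0. (\<lambda>n. measure \<Omega> {\<omega> \<in> space \<Omega>. \<bar>Z n \<omega> - c\<bar> > \<delta>}) \<longlonglongrightarrow> 0)"

end

theory Submission
  imports Defs "HOL-Probability.Hoeffding" "HOL-Real_Asymp.Real_Asymp"
begin

text \<open>Since the weights divide by \<open>P\<close>, the expectation of the normalized operator is the integral
  of \<open>g\<^sub>t(x, y) (f x - f y) / t\<close> over \<open>M\<close>, and the part away from \<open>x\<close> is exponentially small. Near \<open>x\<close>
  there is a parametrization \<open>\<phi>\<close> with \<open>\<phi> 0 = x\<close> whose derivative at \<open>0\<close> is isometric and whose second
  derivatives at \<open>0\<close> are normal to \<open>M\<close>. In it the volume density is \<open>1 + o(\<bar>u\<bar>)\<close> and the squared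
  distance to \<open>x\<close> is \<open>\<bar>u\<bar>\<^sup>2 + o(\<bar>u\<bar>\<^sup>3)\<close>, so that the integral becomes a second moment of a
  Gaussian and tends to minus the trace of the second derivative of \<open>f \<circ> \<phi>\<close> at \<open>0\<close>. That trace is the
  divergence of the gradient, because the normal second derivatives of \<open>\<phi>\<close> do not contribute.
  Hoeffding's inequality controls the fluctuations, as the summands are bounded by a multiple of
  \<open>1 / (n * t powr (k / 2 + 1))\<close>.\<close>

section \<open>Calculus of continuously differentiable functions\<close>

text \<open>The scale forces normality of the second derivatives. The integral has to be known to
  order \<open>t\<close>, and a typical \<open>h\<close> has size \<open>sqrt t\<close>. The linear
  part of \<open>f o \<phi>\<close> is of order \<open>sqrt t\<close>, so a linear term in the
  volume density, or a cubic term in the squared distance (which is divided by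
  \<open>4 * t\<close>), would pair with it to a spurious contribution of order \<open>t\<close>.
  Both terms are built from inner products of first with second derivatives of
  \<open>\<phi>\<close>; a quadratic change of coordinates, in the role of the exponential map,
  removes them.

  The expansions stop at second order, so errors are \<open>o(t)\<close> without a rate. Hence the
  order of choices: a tolerance \<open>e\<close>, a radius \<open>d\<close> depending on it, and
  only after that \<open>t\<close>. Errors inside the ball may cost \<open>e * t\<close> with a
  factor independent of \<open>d\<close>; errors outside may depend on \<open>d\<close> but must be
  of smaller order in \<open>t\<close>.

  The factor 1/2 of Taylor's formula cancels against the variance \<open>2 * t\<close> of each
  Gaussian coordinate.\<close>

lemma frechet_derivative_eqI:
  "(f has_derivative f') (at x) \<Longrightarrow> frechet_derivative f (at x) = f'"
  by (metis frechet_derivative_at)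

lemma frechet_derivative_cong_open:
  assumes "open U" "x \<in> U" "\<And>y. y \<in> U \<Longrightarrow> f y = g y"
  shows "frechet_derivative f (at x) = frechet_derivative g (at x)"
proof -
  have "(f has_derivative D) (at x) \<longleftrightarrow> (g has_derivative D) (at x)" for D
    using assms by (auto intro: has_derivative_transform_within_open[of _ _ x UNIV U])
  then show ?thesis
    unfolding frechet_derivative_def by simp
qed

lemma Ck_on_cong:
  assumes "open U"
  shows "Ck_on n f U \<Longrightarrow> (\<And>y. y \<in> U \<Longrightarrow> f y = g y) \<Longrightarrow> Ck_on n g U"
proof (induction n arbitrary: f g)
  case 0
  then show ?case by (simp cong: continuous_on_cong)
next
  case (Suc n)
  have "g differentiable (at x)" if "x \<in> U" for x
  proof -
    have "f differentiable (at x)"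
      using Suc.prems that by simp
    then obtain D where "(f has_derivative D) (at x)"
      unfolding differentiable_def by blast
    then have "(g has_derivative D) (at x)"
      using Suc.prems that assms by (auto intro: has_derivative_transform_within_open[of f _ x UNIV U])
    then show ?thesis
      unfolding differentiable_def by blast
  qed
  moreover have "Ck_on n (\<lambda>x. frechet_derivative g (at x) v) U" for v
  proof (rule Suc.IH)
    show "Ck_on n (\<lambda>x. frechet_derivative f (at x) v) U"
      using Suc.prems by simp
    show "frechet_derivative f (at y) v = frechet_derivative g (at y) v" if "y \<in> U" for y
      by (rule fun_cong[OF frechet_derivative_cong_open[OF assms that Suc.prems(2)]])
  qed
  ultimately show ?case by simp
qed

lemma Ck_on_subset: "Ck_on n f U \<Longrightarrow> U' \<subseteq> U \<Longrightarrow> Ck_on n f U'"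
  by (induction n arbitrary: f) (auto intro: continuous_on_subset)

lemma Ck_on_imp_continuous_on: "Ck_on n f U \<Longrightarrow> continuous_on U f"
proof (cases n)
  case (Suc m)
  then show "Ck_on n f U \<Longrightarrow> continuous_on U f"
    by (simp add: differentiable_imp_continuous_on differentiable_on_def differentiable_at_withinI)
qed simp

lemma Ck_on_SucD: "Ck_on (Suc n) f U \<Longrightarrow> Ck_on n f U"
proof (induction n arbitrary: f)
  case 0
  then show ?case using Ck_on_imp_continuous_on[of "Suc 0"] by simp
qed auto

text \<open>An explicit derivative formula suffices here, so the closure properties below can quote
  the sum, product and chain rules directly instead of handling the choice inside
  \<open>frechet_derivative\<close>.\<close>

lemma Ck_on_SucI:
  assumes "open U" "\<And>x. x \<in> U \<Longrightarrow> (f has_derivative f' x) (at x)"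
    and "\<And>v. Ck_on n (\<lambda>x. f' x v) U"
  shows "Ck_on (Suc n) f U"
proof -
  have "Ck_on n (\<lambda>x. frechet_derivative f (at x) v) U" for v
    by (rule Ck_on_cong[OF assms(1) assms(3)[of v]]) (simp add: frechet_derivative_eqI[OF assms(2)])
  then show ?thesis
    using assms(2) by (auto simp: differentiable_def)
qed

lemma Ck_on_has_derivative:
  "Ck_on (Suc n) f U \<Longrightarrow> x \<in> U \<Longrightarrow> (f has_derivative frechet_derivative f (at x)) (at x)"
  by (simp add: frechet_derivative_works)

lemma Ck_on_const: "open U \<Longrightarrow> Ck_on n (\<lambda>_. c) U"
proof (induction n arbitrary: c)
  case (Suc n)
  then show ?case by (intro Ck_on_SucI[where f' = "\<lambda>_ _. 0"]) simp_all
qed simp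

lemma Ck_on_add:
  "open U \<Longrightarrow> Ck_on n f U \<Longrightarrow> Ck_on n g U \<Longrightarrow> Ck_on n (\<lambda>x. f x + g x) U"
proof (induction n arbitrary: f g)
  case (Suc n)
  have "((\<lambda>x. f x + g x) has_derivative
      (\<lambda>v. frechet_derivative f (at x) v + frechet_derivative g (at x) v)) (at x)" if "x \<in> U" for x
    using Suc.prems that by (intro has_derivative_add Ck_on_has_derivative)
  moreover have "Ck_on n (\<lambda>x. frechet_derivative f (at x) v + frechet_derivative g (at x) v) U" for v
    using Suc.prems by (intro Suc.IH) simp_all
  ultimately show ?case
    using Suc.prems(1) by (intro Ck_on_SucI) blast+
qed (simp add: continuous_on_add)

lemma Ck_on_sum:
  "open U \<Longrightarrow> (\<And>i. i \<in> I \<Longrightarrow> Ck_on n (f i) U) \<Longrightarrow> Ck_on n (\<lambda>x. \<Sum>i\<in>I. f i x) U"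
  by (induction I rule: infinite_finite_induct) (auto intro: Ck_on_const Ck_on_add)

lemma Ck_on_linear_image:
  assumes "bounded_linear L"
  shows "open U \<Longrightarrow> Ck_on n f U \<Longrightarrow> Ck_on n (\<lambda>x. L (f x)) U"
proof (induction n arbitrary: f)
  case 0
  then show ?case using assms by (simp add: bounded_linear.continuous_on)
next
  case (Suc n)
  have "((\<lambda>x. L (f x)) has_derivative (\<lambda>v. L (frechet_derivative f (at x) v))) (at x)"
    if "x \<in> U" for x
    using Suc.prems that by (intro bounded_linear.has_derivative[OF assms] Ck_on_has_derivative)
  moreover have "Ck_on n (\<lambda>x. L (frechet_derivative f (at x) v)) U" for v
    using Suc.prems by (intro Suc.IH) simp_all
  ultimately show ?case
    using Suc.prems(1) by (intro Ck_on_SucI) blast+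
qed

lemma Ck_on_scaleR:
  fixes a :: "'a::real_normed_vector \<Rightarrow> real"
  shows "open U \<Longrightarrow> Ck_on n a U \<Longrightarrow> Ck_on n f U \<Longrightarrow> Ck_on n (\<lambda>x. a x *\<^sub>R f x) U"
proof (induction n arbitrary: a f)
  case (Suc n)
  have "((\<lambda>x. a x *\<^sub>R f x) has_derivative
      (\<lambda>v. a x *\<^sub>R frechet_derivative f (at x) v + frechet_derivative a (at x) v *\<^sub>R f x)) (at x)"
    if "x \<in> U" for x
    using Suc.prems that by (intro has_derivative_scaleR Ck_on_has_derivative)
  moreover have "Ck_on n (\<lambda>x. a x *\<^sub>R frechet_derivative f (at x) v + frechet_derivative a (at x) v *\<^sub>R f x) U"
    for v
    using Suc.prems Ck_on_SucD[of n a U] Ck_on_SucD[of n f U] by (intro Ck_on_add Suc.IH) simp_all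
  ultimately show ?case
    using Suc.prems(1) by (intro Ck_on_SucI) blast+
qed (simp add: continuous_on_scaleR)

text \<open>\<open>Ck_on\<close> controls derivatives only along fixed directions, whereas the chain
  rule differentiates \<open>f\<close> along the moving vector
  \<open>frechet_derivative \<theta> (at x) v\<close>. Expanding that vector in \<open>Basis\<close>
  turns the derivative into a finite sum of products to which the induction hypothesis
  applies.\<close>

lemma Ck_on_compose:
  fixes \<theta> :: "'a::real_normed_vector \<Rightarrow> 'b::euclidean_space"
  assumes "open U" "open V" "\<theta> ` U \<subseteq> V"
  shows "Ck_on n f V \<Longrightarrow> Ck_on n \<theta> U \<Longrightarrow> Ck_on n (\<lambda>x. f (\<theta> x)) U"
proof (induction n arbitrary: f)
  case 0
  then show ?case using assms by (simp add: continuous_on_compose2)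
next
  case (Suc n)
  have "((\<lambda>x. f (\<theta> x)) has_derivative
      (\<lambda>v. \<Sum>b\<in>Basis. (frechet_derivative \<theta> (at x) v \<bullet> b) *\<^sub>R frechet_derivative f (at (\<theta> x)) b)) (at x)"
    if "x \<in> U" for x
  proof -
    have f: "(f has_derivative frechet_derivative f (at (\<theta> x))) (at (\<theta> x))"
      using Suc.prems that assms by (intro Ck_on_has_derivative) auto
    interpret linear "frechet_derivative f (at (\<theta> x))"
      by (rule has_derivative_linear[OF f])
    have "((\<lambda>x. f (\<theta> x)) has_derivative
      (\<lambda>v. frechet_derivative f (at (\<theta> x)) (frechet_derivative \<theta> (at x) v))) (at x)"
      by (rule has_derivative_compose[OF Ck_on_has_derivative[OF Suc.prems(2) that] f])
    also have "(\<lambda>v. frechet_derivative f (at (\<theta> x)) (frechet_derivative \<theta> (at x) v)) =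
      (\<lambda>v. \<Sum>b\<in>Basis. (frechet_derivative \<theta> (at x) v \<bullet> b) *\<^sub>R frechet_derivative f (at (\<theta> x)) b)"
      by (subst (2) euclidean_representation[symmetric]) (simp add: sum scaleR)
    finally show ?thesis .
  qed
  moreover have "Ck_on n (\<lambda>x. \<Sum>b\<in>Basis. (frechet_derivative \<theta> (at x) v \<bullet> b) *\<^sub>R frechet_derivative f (at (\<theta> x)) b) U"
    for v
    using Suc.prems assms Ck_on_SucD[of n \<theta> U]
      Suc.IH[where f = "\<lambda>y. frechet_derivative f (at y) b" for b]
    by (intro Ck_on_sum Ck_on_scaleR Ck_on_linear_image[OF bounded_linear_inner_left]) simp_all
  ultimately show ?case
    using assms(1) by (intro Ck_on_SucI) blast+
qed

lemma Ck_on_bounded_linear: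
  assumes "bounded_linear L" "open U"
  shows "Ck_on n L U"
proof (cases n)
  case 0
  then show ?thesis using assms by (simp add: linear_continuous_on)
next
  case (Suc m)
  then show ?thesis
    using assms bounded_linear_imp_has_derivative[OF assms(1)]
    by (simp only:) (intro Ck_on_SucI[where f' = "\<lambda>_. L"] Ck_on_const; simp)
qed

lemma smooth_on_subset: "smooth_on U f \<Longrightarrow> U' \<subseteq> U \<Longrightarrow> smooth_on U' f"
  unfolding smooth_on_def by (blast intro: Ck_on_subset)

lemma smooth_on_compose:
  fixes \<theta> :: "'a::real_normed_vector \<Rightarrow> 'b::euclidean_space"
  assumes "open U" "open V" "\<theta> ` U \<subseteq> V" "smooth_on V f" "smooth_on U \<theta>"
  shows "smooth_on U (\<lambda>x. f (\<theta> x))"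
  using assms unfolding smooth_on_def by (blast intro: Ck_on_compose)

lemma smooth_on_has_derivative:
  "smooth_on U f \<Longrightarrow> x \<in> U \<Longrightarrow> (f has_derivative frechet_derivative f (at x)) (at x)"
  unfolding smooth_on_def by (blast intro: Ck_on_has_derivative)

lemma smooth_on_imp_continuous_on: "smooth_on U f \<Longrightarrow> continuous_on U f"
  unfolding smooth_on_def by (blast intro: Ck_on_imp_continuous_on)

lemma smooth_on_derivative:
  "smooth_on U f \<Longrightarrow> smooth_on U (\<lambda>x. frechet_derivative f (at x) v)"
  unfolding smooth_on_def by (metis Ck_on.simps(2))

section \<open>Second derivatives\<close>

text \<open>The inner derivative is along the fixed vector \<open>w\<close>, the outer one along
  \<open>h\<close>. This keeps to directional derivatives, as \<open>Ck_on\<close> does; bilinearity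
  and symmetry become lemmas.\<close>

definition deriv2 :: "('a::real_normed_vector \<Rightarrow> 'b::real_normed_vector) \<Rightarrow> 'a \<Rightarrow> 'a \<Rightarrow> 'a \<Rightarrow> 'b" where
  "deriv2 f a h w = frechet_derivative (\<lambda>u. frechet_derivative f (at u) w) (at a) h"

context
  fixes f :: "'a::euclidean_space \<Rightarrow> 'b::real_normed_vector" and U a
  assumes f: "open U" "a \<in> U" "Ck_on 2 f U"
begin

lemma deriv2_has_derivative:
  "((\<lambda>u. frechet_derivative f (at u) w) has_derivative (\<lambda>h. deriv2 f a h w)) (at a)"
  unfolding deriv2_def
  using f(2,3) by (auto simp: numeral_2_eq_2 frechet_derivative_works[symmetric])

lemma Ck2_linear_derivative: "u \<in> U \<Longrightarrow> linear (frechet_derivative f (at u))"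
  using f(3) by (auto simp: numeral_2_eq_2 linear_frechet_derivative)

lemma Ck2_has_derivative: "u \<in> U \<Longrightarrow> (f has_derivative frechet_derivative f (at u)) (at u)"
  using f(3) Ck_on_has_derivative[of 1 f U u] by (simp add: numeral_2_eq_2)

lemma bilinear_deriv2: "bilinear (deriv2 f a)"
  unfolding bilinear_def
proof (intro conjI allI)
  show "linear (\<lambda>h. deriv2 f a h w)" for w
    by (rule has_derivative_linear[OF deriv2_has_derivative])
  \<comment> \<open>Linearity in the inner direction holds for the first derivative throughout
    \<open>U\<close>; differentiating that identity at \<open>a\<close> and uniqueness of
    derivatives pass it on.\<close>
  show "linear (deriv2 f a h)" for h
  proof
    show "deriv2 f a h (v + w) = deriv2 f a h v + deriv2 f a h w" for v w
    proof -
      have "((\<lambda>u. frechet_derivative f (at u) v + frechet_derivative f (at u) w) has_derivative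
          (\<lambda>h. deriv2 f a h v + deriv2 f a h w)) (at a)"
        by (intro has_derivative_add deriv2_has_derivative)
      then have "((\<lambda>u. frechet_derivative f (at u) (v + w)) has_derivative
          (\<lambda>h. deriv2 f a h v + deriv2 f a h w)) (at a)"
        by (rule has_derivative_transform_within_open[OF _ f(1,2)]) (simp add: linear_add[OF Ck2_linear_derivative])
      from has_derivative_unique[OF deriv2_has_derivative this] show ?thesis
        by (rule fun_cong)
    qed
    show "deriv2 f a h (r *\<^sub>R w) = r *\<^sub>R deriv2 f a h w" for r w
    proof -
      have "((\<lambda>u. r *\<^sub>R frechet_derivative f (at u) w) has_derivative
          (\<lambda>h. r *\<^sub>R deriv2 f a h w)) (at a)"
        by (intro has_derivative_scaleR_right deriv2_has_derivative)
      then have "((\<lambda>u. frechet_derivative f (at u) (r *\<^sub>R w)) has_derivative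
          (\<lambda>h. r *\<^sub>R deriv2 f a h w)) (at a)"
        by (rule has_derivative_transform_within_open[OF _ f(1,2)]) (simp add: linear_scale[OF Ck2_linear_derivative])
      from has_derivative_unique[OF deriv2_has_derivative this] show ?thesis
        by (rule fun_cong)
    qed
  qed
qed

text \<open>The expansion is known separately for each basis vector. The remainder is linear in
  \<open>w\<close>, so finitely many radii suffice and the estimate becomes uniform in
  \<open>w\<close>.\<close>

lemma deriv2_expansion:
  assumes "0 < e"
  shows "\<exists>d>0. ball a d \<subseteq> U \<and> (\<forall>h w. norm h < d \<longrightarrow>
    norm (frechet_derivative f (at (a + h)) w - frechet_derivative f (at a) w - deriv2 f a h w)
      \<le> e * norm h * norm w)"
proof -
  let ?D = "\<lambda>u. frechet_derivative f (at u)"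
  let ?R = "\<lambda>h w. ?D (a + h) w - ?D a w - deriv2 f a h w"
  let ?e = "e / DIM('a)"
  have e: "0 < ?e" using assms by simp
  have "\<exists>d>0. \<forall>y. norm (y - a) < d \<longrightarrow>
      norm (?D y b - ?D a b - deriv2 f a (y - a) b) \<le> ?e * norm (y - a)" for b
    using deriv2_has_derivative[of b] e unfolding has_derivative_at_alt by blast
  then obtain \<delta> where \<delta>: "\<And>b. 0 < \<delta> b"
    "\<And>b y. norm (y - a) < \<delta> b \<Longrightarrow> norm (?D y b - ?D a b - deriv2 f a (y - a) b) \<le> ?e * norm (y - a)"
    by metis
  obtain d0 where d0: "0 < d0" "ball a d0 \<subseteq> U"
    using f(1,2) open_contains_ball by blast
  define d where "d = Min (insert d0 (\<delta> ` Basis))"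
  have d: "0 < d" "d \<le> d0"
    unfolding d_def using d0 \<delta> by (auto simp: Min_gr_iff)
  have d3: "d \<le> \<delta> b" if "b \<in> Basis" for b
    unfolding d_def using that by (intro Min_le) auto
  have "norm (?R h w) \<le> e * norm h * norm w" if h: "norm h < d" for h w
  proof -
    have "a + h \<in> U"
      using h d d0 by (auto simp: dist_norm subset_iff)
    then have lin: "linear (?R h)"
      using bilinear_deriv2 f unfolding bilinear_def
      by (intro linear_compose_sub Ck2_linear_derivative) auto
    have "?R h w = (\<Sum>b\<in>Basis. (w \<bullet> b) *\<^sub>R ?R h b)"
    proof -
      have "?R h w = ?R h (\<Sum>b\<in>Basis. (w \<bullet> b) *\<^sub>R b)"
        by (simp only: euclidean_representation)
      also have "\<dots> = (\<Sum>b\<in>Basis. (w \<bullet> b) *\<^sub>R ?R h b)"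
        by (simp only: linear_sum[OF lin] linear_scale[OF lin])
      finally show ?thesis .
    qed
    also have "norm \<dots> \<le> (\<Sum>b\<in>(Basis::'a set). norm w * (?e * norm h))"
    proof (rule sum_norm_le)
      fix b :: 'a assume b: "b \<in> Basis"
      have "norm (?R h b) \<le> ?e * norm h"
        using \<delta>(2)[of "a + h" b] h d3[OF b] by simp
      then show "norm ((w \<bullet> b) *\<^sub>R ?R h b) \<le> norm w * (?e * norm h)"
        unfolding norm_scaleR using Basis_le_norm[OF b, of w] by (intro mult_mono) simp_all
    qed
    finally show ?thesis by (simp add: mult_ac)
  qed
  then show ?thesis
    using d d0 by (intro exI[of _ d]) auto
qed

text \<open>Starting from the displaced point \<open>a + h\<close> serves two purposes:
  \<open>h = 0\<close> is Taylor's formula, and a general \<open>h\<close> allows two routes to the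
  same point to be compared, which yields symmetry.\<close>

lemma segment_expansion:
  assumes "0 \<le> e"
    and d: "ball a d \<subseteq> U" "\<And>h w. norm h < d \<Longrightarrow>
      norm (frechet_derivative f (at (a + h)) w - frechet_derivative f (at a) w - deriv2 f a h w)
      \<le> e * norm h * norm w"
    and hk: "norm h + norm k < d"
  shows "norm (f (a + h + k) - f (a + h) - frechet_derivative f (at a) k - deriv2 f a h k
    - (1/2) *\<^sub>R deriv2 f a k k) \<le> e * (norm h + norm k) * norm k"
proof -
  let ?D = "\<lambda>u. frechet_derivative f (at u)"
  \<comment> \<open>The expression to be bounded is \<open>p 1 - p 0\<close>, and \<open>p'\<close>
    is the derivative of \<open>p\<close>: a remainder in the expansion of the first derivative,
    small by assumption. The mean value inequality connects the two.\<close>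
  define p where "p s = f (a + h + s *\<^sub>R k) - s *\<^sub>R ?D a k - s *\<^sub>R deriv2 f a h k
    - (s\<^sup>2 / 2) *\<^sub>R deriv2 f a k k" for s :: real
  define p' where "p' s = ?D (a + (h + s *\<^sub>R k)) k - ?D a k - deriv2 f a (h + s *\<^sub>R k) k" for s
  have nrm: "norm (h + s *\<^sub>R k) \<le> norm h + norm k" if "s \<in> {0..1}" for s
    using that norm_triangle_ineq[of h "s *\<^sub>R k"] mult_right_mono[of s 1 "norm k"] by simp
  have B: "deriv2 f a (h + s *\<^sub>R k) k = deriv2 f a h k + s *\<^sub>R deriv2 f a k k" for s
    using bilinear_ladd[OF bilinear_deriv2] bilinear_lmul[OF bilinear_deriv2] by metis
  have "(p has_derivative (\<lambda>x. x *\<^sub>R p' s)) (at s within {0..1})" if s: "s \<in> {0..1}" for s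
  proof -
    have "dist a (a + v) = norm v" for v
      by (simp add: dist_norm)
    then have "a + (h + s *\<^sub>R k) \<in> U"
      using nrm[OF s] hk by (intro subsetD[OF d(1)]) simp
    then have "(f has_derivative ?D (a + (h + s *\<^sub>R k))) (at ((\<lambda>s. a + (h + s *\<^sub>R k)) s))"
      by (simp add: Ck2_has_derivative)
    then have "((\<lambda>s. f (a + (h + s *\<^sub>R k))) has_derivative (\<lambda>x. ?D (a + (h + s *\<^sub>R k)) (x *\<^sub>R k))) (at s within {0..1})"
      by (rule has_derivative_compose[rotated]) (auto intro!: derivative_eq_intros)
    moreover have "?D (a + (h + s *\<^sub>R k)) (x *\<^sub>R k) = x *\<^sub>R ?D (a + (h + s *\<^sub>R k)) k" for x
      by (rule linear_scale[OF Ck2_linear_derivative]) fact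
    ultimately show ?thesis
      unfolding p_def p'_def B by (auto intro!: derivative_eq_intros simp: algebra_simps)
  qed
  moreover have "onorm (\<lambda>x. x *\<^sub>R p' s) \<le> e * (norm h + norm k) * norm k" if "s \<in> {0..1}" for s
  proof -
    have "norm (p' s) \<le> e * norm (h + s *\<^sub>R k) * norm k"
      unfolding p'_def using nrm[OF that] hk by (intro d(2)) simp
    also have "\<dots> \<le> e * (norm h + norm k) * norm k"
      using nrm[OF that] assms(1) by (intro mult_right_mono mult_left_mono) auto
    finally show ?thesis
      by (simp add: onorm_scaleR_left onorm_id)
  qed
  ultimately have "norm (p 1 - p 0) \<le> e * (norm h + norm k) * norm k * norm (1 - 0 :: real)"
    by (intro differentiable_bound[where f' = "\<lambda>s x. x *\<^sub>R p' s" and S = "{0..1}"]) auto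
  then show ?thesis
    by (simp add: p_def algebra_simps)
qed

lemma second_order_Taylor:
  assumes "0 < e"
  shows "\<exists>d>0. ball a d \<subseteq> U \<and> (\<forall>h. norm h < d \<longrightarrow>
    norm (f (a + h) - f a - frechet_derivative f (at a) h - (1/2) *\<^sub>R deriv2 f a h h) \<le> e * (norm h)\<^sup>2)"
proof -
  obtain d where d: "0 < d" "ball a d \<subseteq> U" "\<And>h w. norm h < d \<Longrightarrow>
      norm (frechet_derivative f (at (a + h)) w - frechet_derivative f (at a) w - deriv2 f a h w)
      \<le> e * norm h * norm w"
    using deriv2_expansion[OF assms] by blast
  then show ?thesis
    using segment_expansion[of e d 0] assms bilinear_lzero[OF bilinear_deriv2]
    by (intro exI[of _ d]) (auto simp: power2_eq_square mult_ac)
qed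

text \<open>The point \<open>a + h + k\<close> is reached directly and via \<open>a + h\<close>. The
  two expansions differ by half of \<open>deriv2 f a h k - deriv2 f a k h\<close>. Scaling both
  vectors by \<open>s\<close> multiplies this by \<open>s\<^sup>2\<close>, while the remainders are
  at most \<open>e\<close> times a multiple of \<open>s\<^sup>2\<close>.\<close>

lemma deriv2_commute: "deriv2 f a h k = deriv2 f a k h"
proof -
  \<comment> \<open>Three remainders, each at most \<open>e * ?n * ?n\<close>, and a factor 2 from
    the halved difference.\<close>
  define C where "C = 6 * (norm h + norm k)\<^sup>2"
  have "norm (deriv2 f a h k - deriv2 f a k h) \<le> e * C" if e: "0 < e" for e
  proof -
    obtain d where d: "0 < d" "ball a d \<subseteq> U" "\<And>h w. norm h < d \<Longrightarrow>
      norm (frechet_derivative f (at (a + h)) w - frechet_derivative f (at a) w - deriv2 f a h w)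
      \<le> e * norm h * norm w"
      using deriv2_expansion[OF e] by blast
    have ex: "\<exists>s>0. s * (norm h + norm k) < d"
      using d(1) by (intro exI[of _ "d / (2 * (norm h + norm k + 1))"]) (auto simp: field_simps add_pos_nonneg add_nonneg_pos)
    then obtain s where s: "0 < s" "s * (norm h + norm k) < d" by blast
    let ?h = "s *\<^sub>R h" and ?k = "s *\<^sub>R k"
    let ?T = "\<lambda>h. f (a + h) - f a - frechet_derivative f (at a) h - (1/2) *\<^sub>R deriv2 f a h h"
    let ?S = "f (a + ?h + ?k) - f (a + ?h) - frechet_derivative f (at a) ?k - deriv2 f a ?h ?k
      - (1/2) *\<^sub>R deriv2 f a ?k ?k"
    have N1: "norm ?h + norm ?k < d"
      using s by (simp add: distrib_left)
    then have N: "norm (?h + ?k) < d" "norm ?h < d"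
      using norm_triangle_ineq[of ?h ?k] norm_ge_zero[of ?k] by linarith+
    have T: "norm (?T v) \<le> e * norm v * norm v" if "norm v < d" for v
      using segment_expansion[OF _ d(2,3), of 0 v] that e bilinear_lzero[OF bilinear_deriv2] by simp
    let ?n = "s * (norm h + norm k)"
    have nn: "norm (?h + ?k) \<le> ?n" "norm ?h \<le> ?n" "norm ?k \<le> ?n"
      using s norm_triangle_ineq[of ?h ?k] by (auto simp: distrib_left)
    have sq: "e * norm v * norm v \<le> e * ?n * ?n" if "norm v \<le> ?n" for v :: 'a
      using that e order_trans[OF norm_ge_zero that] by (intro mult_mono mult_left_mono mult_nonneg_nonneg) (auto simp: less_imp_le[OF s(1)])
    have T12: "norm (?T (?h + ?k)) \<le> e * ?n * ?n" "norm (?T ?h) \<le> e * ?n * ?n"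
      using T[OF N(1)] T[OF N(2)] sq[OF nn(1)] sq[OF nn(2)] by linarith+
    have "norm ?S \<le> e * (norm ?h + norm ?k) * norm ?k"
      using segment_expansion[OF _ d(2,3) N1] e by simp
    also have "\<dots> \<le> e * ?n * ?n"
      using nn e s by (intro mult_mono) (auto simp: distrib_left)
    finally have S: "norm ?S \<le> e * ?n * ?n" .
    have eq: "(s\<^sup>2 / 2) *\<^sub>R (deriv2 f a h k - deriv2 f a k h) = ?T (?h + ?k) - ?T ?h - ?S"
    proof -
      have l: "frechet_derivative f (at a) (?h + ?k) = frechet_derivative f (at a) ?h + frechet_derivative f (at a) ?k"
        by (rule linear_add[OF Ck2_linear_derivative[OF f(2)]])
      have b: "deriv2 f a (?h + ?k) (?h + ?k) = deriv2 f a ?h ?h + deriv2 f a ?h ?k + (deriv2 f a ?k ?h + deriv2 f a ?k ?k)"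
        by (simp add: bilinear_ladd[OF bilinear_deriv2] bilinear_radd[OF bilinear_deriv2] del: scaleR_right_distrib)
      have b2: "deriv2 f a ?h ?k = s\<^sup>2 *\<^sub>R deriv2 f a h k" "deriv2 f a ?k ?h = s\<^sup>2 *\<^sub>R deriv2 f a k h"
        by (simp_all add: bilinear_lmul[OF bilinear_deriv2] bilinear_rmul[OF bilinear_deriv2] power2_eq_square)
      have half: "X = (1/2) *\<^sub>R X + (1/2) *\<^sub>R X" for X :: 'b
        by (simp flip: scaleR_left_distrib)
      have "?T (?h + ?k) - ?T ?h - ?S = deriv2 f a ?h ?k - (1/2) *\<^sub>R (deriv2 f a ?h ?k + deriv2 f a ?k ?h)"
        unfolding l b by (simp add: algebra_simps)
      also have "\<dots> = (1/2) *\<^sub>R (deriv2 f a ?h ?k - deriv2 f a ?k ?h)"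
        by (subst half) (simp add: algebra_simps)
      also have "\<dots> = (s\<^sup>2 / 2) *\<^sub>R (deriv2 f a h k - deriv2 f a k h)"
        unfolding b2 by (simp add: algebra_simps)
      finally show ?thesis ..
    qed
    have tri: "norm (A - B - C) \<le> 3 * x" if "norm A \<le> x" "norm B \<le> x" "norm C \<le> x" for A B C :: 'b and x
      using norm_triangle_ineq4[of "A - B" C] norm_triangle_ineq4[of A B] that by linarith
    have "norm ((s\<^sup>2 / 2) *\<^sub>R (deriv2 f a h k - deriv2 f a k h)) \<le> 3 * (e * ?n * ?n)"
      unfolding eq by (rule tri[OF T12 S])
    then have "s\<^sup>2 / 2 * norm (deriv2 f a h k - deriv2 f a k h) \<le> s\<^sup>2 / 2 * (e * C)"
      unfolding norm_scaleR by (simp add: C_def power2_eq_square mult_ac)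
    then show ?thesis
      using s(1) by simp
  qed
  then have "norm (deriv2 f a h k - deriv2 f a k h) \<le> 0 + e" if "0 < e" for e
  proof -
    have C: "0 \<le> C" by (simp add: C_def)
    then have "e / (C + 1) * C \<le> e"
      using that by (simp add: field_simps)
    moreover have "0 < e / (C + 1)"
      using that C by simp
    ultimately show ?thesis
      using \<open>\<And>e. 0 < e \<Longrightarrow> _ \<le> e * C\<close>[of "e / (C + 1)"] by linarith
  qed
  then have "norm (deriv2 f a h k - deriv2 f a k h) \<le> 0"
    by (rule field_le_epsilon)
  then show ?thesis by simp
qed

end

section \<open>Local parametrizations and tangent spaces\<close>

text \<open>Continuity of \<open>\<psi>\<close> brings \<open>w = \<psi> y\<close> close to
  \<open>u\<close>, where the expansion of \<open>\<phi>\<close> bounds \<open>w - u\<close> by a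
  multiple of \<open>y - \<phi> u\<close>, and this bound makes the error small. \<open>B\<close> is
  determined only on the range of \<open>A\<close>; every extension is a derivative, since the limit
  runs within \<open>M\<close>.\<close>

lemma has_derivative_left_inverse_within:
  fixes \<phi> :: "'c::real_normed_vector \<Rightarrow> 'a::real_normed_vector"
  assumes \<phi>: "(\<phi> has_derivative A) (at u)" "u \<in> U" and h: "homeomorphism U N \<phi> \<psi>"
    and N: "openin (top_of_set M) N" and B: "bounded_linear B" "\<And>v. B (A v) = v"
  shows "(\<psi> has_derivative B) (at (\<phi> u) within M)"
proof -
  have psi: "\<psi> (\<phi> u) = u" "\<phi> u \<in> N"
    using h \<phi>(2) by (auto simp: homeomorphism_def)
  have "(\<psi> has_derivative B) (at (\<phi> u) within N)"
    unfolding has_derivative_within_alt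
  proof (intro conjI allI impI)
    fix e :: real assume e: "0 < e"
    obtain K where K: "0 < K" "\<And>v. norm (B v) \<le> norm v * K"
      using bounded_linear.pos_bounded[OF B(1)] by blast
    \<comment> \<open>The first entry lets half of \<open>norm (w - u)\<close> be absorbed on the
      left; the second keeps the resulting factor \<open>2 * K\<^sup>2 * e'\<close> at most
      \<open>e\<close>.\<close>
    define e' where "e' = min (1 / (2 * K)) (e / (2 * K\<^sup>2))"
    have e': "0 < e'" "K * e' \<le> 1/2" "2 * K\<^sup>2 * e' \<le> e"
      using e K(1) unfolding e'_def min_def by (auto simp: field_simps)
    obtain d1 where d1: "0 < d1"
      "\<And>y. norm (y - u) < d1 \<Longrightarrow> norm (\<phi> y - \<phi> u - A (y - u)) \<le> e' * norm (y - u)"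
      using \<phi>(1) e'(1) unfolding has_derivative_at_alt by blast
    have "continuous_on N \<psi>"
      using h by (simp add: homeomorphism_def)
    then obtain d where d: "0 < d" "\<And>y. y \<in> N \<Longrightarrow> dist y (\<phi> u) < d \<Longrightarrow> dist (\<psi> y) (\<psi> (\<phi> u)) < d1"
      using psi(2) d1(1) unfolding continuous_on_iff by blast
    show "\<exists>d>0. \<forall>y\<in>N. norm (y - \<phi> u) < d \<longrightarrow> norm (\<psi> y - \<psi> (\<phi> u) - B (y - \<phi> u)) \<le> e * norm (y - \<phi> u)"
    proof (intro exI[of _ d] conjI ballI impI d(1))
      fix y assume y: "y \<in> N" "norm (y - \<phi> u) < d"
      define w where "w = \<psi> y"
      have w: "\<phi> w = y" "norm (w - u) < d1"
        using h y d(2)[of y] psi by (auto simp: w_def homeomorphism_def dist_norm)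
      have "w - u - B (y - \<phi> u) = - B (\<phi> w - \<phi> u - A (w - u))"
        by (simp add: w linear_diff[OF bounded_linear.linear[OF B(1)]] B(2))
      then have "norm (w - u - B (y - \<phi> u)) \<le> norm (\<phi> w - \<phi> u - A (w - u)) * K"
        using K(2) by simp
      also have "\<dots> \<le> e' * norm (w - u) * K"
        using d1(2)[OF w(2)] K(1) by (intro mult_right_mono) auto
      finally have 1: "norm (w - u - B (y - \<phi> u)) \<le> (K * e') * norm (w - u)"
        by (simp add: mult_ac)
      have "norm (w - u) \<le> norm (B (y - \<phi> u)) + norm (w - u - B (y - \<phi> u))"
        by norm
      also have "\<dots> \<le> norm (y - \<phi> u) * K + 1/2 * norm (w - u)"
        using 1 K(2) mult_right_mono[OF e'(2), of "norm (w - u)"] by (intro add_mono) auto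
      finally have "norm (w - u) \<le> 2 * K * norm (y - \<phi> u)"
        by (simp add: algebra_simps)
      then have "norm (w - u - B (y - \<phi> u)) \<le> (K * e') * (2 * K * norm (y - \<phi> u))"
        using K(1) e'(1) by (intro order_trans[OF 1] mult_left_mono) simp_all
      also have "\<dots> = 2 * K\<^sup>2 * e' * norm (y - \<phi> u)"
        by (simp add: power2_eq_square)
      also have "\<dots> \<le> e * norm (y - \<phi> u)"
        using e'(3) by (intro mult_right_mono) auto
      finally show "norm (\<psi> y - \<psi> (\<phi> u) - B (y - \<phi> u)) \<le> e * norm (y - \<phi> u)"
        by (simp add: w_def psi)
    qed
  qed (rule B(1))
  moreover obtain T where "open T" "N = M \<inter> T"
    using N by (auto simp: openin_open)
  then have "at (\<phi> u) within N = at (\<phi> u) within M"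
    using psi(2) by (intro at_within_nhd[of _ T]) auto
  ultimately show ?thesis by simp
qed

lemma local_parametrization_has_derivative:
  "local_parametrization M U \<phi> \<Longrightarrow> u \<in> U \<Longrightarrow> (\<phi> has_derivative frechet_derivative \<phi> (at u)) (at u)"
  unfolding local_parametrization_def by (blast intro: smooth_on_has_derivative)

lemma local_parametrization_left_inverse:
  fixes \<phi> :: "real^'k \<Rightarrow> 'a::euclidean_space"
  assumes "local_parametrization M U \<phi>" "u \<in> U"
  obtains B where "linear B" "\<And>v. B (frechet_derivative \<phi> (at u) v) = v"
proof -
  have "linear (frechet_derivative \<phi> (at u))"
    using local_parametrization_has_derivative[OF assms] by (rule has_derivative_linear)
  moreover have "inj (frechet_derivative \<phi> (at u))"
    using assms by (simp add: local_parametrization_def)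
  ultimately obtain B where "linear B" "B \<circ> frechet_derivative \<phi> (at u) = id"
    using linear_injective_left_inverse by blast
  then show ?thesis
    using that[of B] by (metis comp_apply id_apply)
qed

lemma smooth_on_affine: "open U \<Longrightarrow> smooth_on U (\<lambda>s::real. a + s *\<^sub>R b)"
  unfolding smooth_on_def
  by (intro allI Ck_on_add Ck_on_const Ck_on_bounded_linear bounded_linear_scaleR_left)

text \<open>Near time 0 a curve in \<open>M\<close> stays in the chart, and differentiating
  \<open>\<gamma> = \<phi> o \<psi> o \<gamma>\<close> gives \<open>v = ?A (B v)\<close>.
  Conversely, images of lines through \<open>u\<close> realize every velocity in the range. In
  particular the tangent space is a linear subspace.\<close>

lemma tangent_space_eq_range:
  fixes \<phi> :: "real^'k \<Rightarrow> 'a::euclidean_space"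
  assumes lp: "local_parametrization M U \<phi>" and u: "u \<in> U"
  shows "tangent_space M (\<phi> u) = range (frechet_derivative \<phi> (at u))" (is "_ = range ?A")
proof -
  note \<phi> = local_parametrization_has_derivative[OF lp u]
  have U: "open U" "smooth_on U \<phi>" "openin (top_of_set M) (\<phi> ` U)" "\<phi> ` U \<subseteq> M"
    using lp by (auto simp: local_parametrization_def)
  obtain \<psi> where h: "homeomorphism U (\<phi> ` U) \<phi> \<psi>"
    using lp by (auto simp: local_parametrization_def)
  obtain B where B: "linear B" "\<And>v. B (?A v) = v"
    using local_parametrization_left_inverse[OF lp u] by blast
  obtain T where T: "open T" "\<phi> ` U = M \<inter> T"
    using U(3) by (auto simp: openin_open)
  show ?thesis
  proof (intro equalityI subsetI)
    fix v assume "v \<in> tangent_space M (\<phi> u)"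
    then obtain \<gamma> e where e: "0 < e" "smooth_on {-e<..<e} \<gamma>" "\<gamma> ` {-e<..<e} \<subseteq> M" "\<gamma> 0 = \<phi> u"
      "(\<gamma> has_vector_derivative v) (at (0::real))"
      unfolding tangent_space_def by blast
    define S where "S = {-e<..<e} \<inter> \<gamma> -` T"
    have S: "open S" "0 \<in> S"
      unfolding S_def using e T u smooth_on_imp_continuous_on[OF e(2)]
      by (auto intro: continuous_open_preimage)
    have \<gamma>S: "\<gamma> s \<in> \<phi> ` U" if "s \<in> S" for s
      using that e(3) T(2) by (auto simp: S_def)
    have \<gamma>: "(\<gamma> has_derivative (\<lambda>s. s *\<^sub>R v)) (at 0 within S)"
      using e(5) by (auto simp: has_vector_derivative_def intro: has_derivative_at_withinI)
    have "(\<psi> has_derivative B) (at (\<gamma> 0) within M)"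
      using has_derivative_left_inverse_within[OF \<phi> u h U(3)] B
      by (simp add: e(4) linear_conv_bounded_linear)
    then have "(\<psi> has_derivative B) (at (\<gamma> 0) within \<gamma> ` S)"
      by (rule has_derivative_subset) (use \<gamma>S U(4) in blast)
    from has_derivative_in_compose[OF \<gamma> this]
    have 1: "((\<lambda>s. \<psi> (\<gamma> s)) has_derivative (\<lambda>s. B (s *\<^sub>R v))) (at 0 within S)" .
    have "\<psi> (\<gamma> 0) = u"
      using h u e(4) by (simp add: homeomorphism_def)
    then have "(\<phi> has_derivative ?A) (at (\<psi> (\<gamma> 0)))"
      using \<phi> by simp
    from has_derivative_compose[OF 1 this]
    have "((\<lambda>s. \<phi> (\<psi> (\<gamma> s))) has_derivative (\<lambda>s. ?A (B (s *\<^sub>R v)))) (at 0)"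
      using at_within_open[OF S(2,1)] by simp
    moreover have "\<phi> (\<psi> (\<gamma> s)) = \<gamma> s" if "s \<in> S" for s
      using \<gamma>S[OF that] h by (auto simp: homeomorphism_def)
    ultimately have "(\<gamma> has_derivative (\<lambda>s. ?A (B (s *\<^sub>R v)))) (at 0)"
      using S by (blast intro: has_derivative_transform_within_open)
    moreover have "(\<gamma> has_derivative (\<lambda>s. s *\<^sub>R v)) (at 0)"
      using e(5) by (simp add: has_vector_derivative_def)
    ultimately have "(\<lambda>s. ?A (B (s *\<^sub>R v))) = (\<lambda>s. s *\<^sub>R v)"
      by (rule has_derivative_unique)
    then have "?A (B v) = v"
      by (metis scaleR_one)
    then show "v \<in> range ?A"
      by (metis rangeI)
  next
    fix v assume "v \<in> range ?A"
    then obtain w where w: "v = ?A w" by blast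
    define l where "l s = u + s *\<^sub>R w" for s :: real
    have l: "(l has_derivative (\<lambda>s. s *\<^sub>R w)) (at s)" for s
      unfolding l_def by (auto intro!: derivative_eq_intros)
    then have "continuous_on UNIV l"
      by (meson has_derivative_continuous continuous_at_imp_continuous_on)
    then have "open (l -` U)"
      using U(1) by (simp add: continuous_on_open_vimage)
    moreover have "0 \<in> l -` U"
      using u by (simp add: l_def)
    ultimately obtain e where e: "0 < e" "ball 0 e \<subseteq> l -` U"
      using open_contains_ball by blast
    have I: "{-e<..<e} = ball 0 e"
      by (auto simp: dist_norm)
    have "smooth_on {-e<..<e} (\<lambda>s. \<phi> (l s))"
      unfolding l_def
      by (rule smooth_on_compose[OF _ U(1) _ U(2) smooth_on_affine]) (use e in \<open>auto simp: I l_def\<close>)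
    moreover have "(\<lambda>s. \<phi> (l s)) ` {-e<..<e} \<subseteq> M"
      using e U(4) by (auto simp: I)
    moreover have "\<phi> (l 0) = \<phi> u"
      by (simp add: l_def)
    moreover have "((\<lambda>s. \<phi> (l s)) has_vector_derivative v) (at 0)"
    proof -
      have "(\<phi> has_derivative ?A) (at (l 0))"
        using \<phi> by (simp add: l_def)
      from has_derivative_compose[OF l this] show ?thesis
        unfolding has_vector_derivative_def w
        by (simp add: linear_scale[OF has_derivative_linear[OF \<phi>]])
    qed
    ultimately show "v \<in> tangent_space M (\<phi> u)"
      unfolding tangent_space_def using e(1) by blast
  qed
qed

section \<open>Change of parametrization and normal coordinates\<close>

lemma local_parametrization_restrict:
  assumes lp: "local_parametrization M U \<phi>" and U': "open U'" "U' \<subseteq> U"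
  shows "local_parametrization M U' \<phi>"
proof -
  obtain \<psi> where h: "homeomorphism U (\<phi> ` U) \<phi> \<psi>"
    using lp by (auto simp: local_parametrization_def)
  have "openin (top_of_set U) U'"
    using U' by (auto intro: open_openin_trans simp: openin_open)
  then have "openin (top_of_set (\<phi> ` U)) (\<phi> ` U')"
    by (rule homeomorphism_imp_open_map[OF h])
  then have "openin (top_of_set M) (\<phi> ` U')"
    using lp unfolding local_parametrization_def by (blast intro: openin_trans)
  moreover have "homeomorphism U' (\<phi> ` U') \<phi> \<psi>"
    using h U' by (auto intro: homeomorphism_of_subsets)
  ultimately show ?thesis
    using lp U' unfolding local_parametrization_def by (auto intro: smooth_on_subset)
qed

text \<open>Invariance of domain gives both the openness of the image of \<open>W\<close> and the
  continuity of the inverse, so it remains to check injectivity of \<open>\<theta>\<close> and of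
  its derivatives.\<close>

lemma local_parametrization_compose:
  fixes \<phi> :: "real^'k \<Rightarrow> 'a::euclidean_space" and \<theta> :: "real^'k \<Rightarrow> real^'k"
  assumes lp: "local_parametrization M U \<phi>"
    and W: "open W" "smooth_on W \<theta>" "\<theta> ` W \<subseteq> U" "inj_on \<theta> W"
    and inj: "\<And>w. w \<in> W \<Longrightarrow> inj (frechet_derivative \<theta> (at w))"
  shows "local_parametrization M W (\<lambda>w. \<phi> (\<theta> w))"
    and "\<And>w. w \<in> W \<Longrightarrow> frechet_derivative (\<lambda>w. \<phi> (\<theta> w)) (at w) =
      (\<lambda>v. frechet_derivative \<phi> (at (\<theta> w)) (frechet_derivative \<theta> (at w) v))"
proof -
  have \<theta>: "continuous_on W \<theta>"
    using W(2) by (rule smooth_on_imp_continuous_on)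
  show D: "frechet_derivative (\<lambda>w. \<phi> (\<theta> w)) (at w) =
      (\<lambda>v. frechet_derivative \<phi> (at (\<theta> w)) (frechet_derivative \<theta> (at w) v))" if "w \<in> W" for w
    using W that
    by (intro frechet_derivative_eqI has_derivative_compose[OF smooth_on_has_derivative[OF W(2) that]]
        local_parametrization_has_derivative[OF lp]) auto
  have "open (\<theta> ` W)"
    using W \<theta> by (intro invariance_of_domain)
  then have lp': "local_parametrization M (\<theta> ` W) \<phi>"
    using W(3) by (rule local_parametrization_restrict[OF lp])
  obtain \<psi> where \<psi>: "homeomorphism (\<theta> ` W) (\<phi> ` \<theta> ` W) \<phi> \<psi>"
    using lp' by (auto simp: local_parametrization_def)
  obtain \<eta> where \<eta>: "homeomorphism W (\<theta> ` W) \<theta> \<eta>"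
    by (rule invariance_of_domain_homeomorphism[OF W(1) \<theta> _ W(4)]) auto
  have "homeomorphism W (\<phi> ` \<theta> ` W) (\<lambda>w. \<phi> (\<theta> w)) (\<eta> \<circ> \<psi>)"
    using homeomorphism_compose[OF \<eta> \<psi>] by (simp add: o_def)
  moreover have "smooth_on W (\<lambda>w. \<phi> (\<theta> w))"
    using lp W unfolding local_parametrization_def
    by (intro smooth_on_compose[OF W(1) _ W(3) _ W(2)]) blast+
  moreover have "inj (frechet_derivative (\<lambda>w. \<phi> (\<theta> w)) (at w))" if "w \<in> W" for w
    using that inj[OF that] lp W(3) unfolding D[OF that] local_parametrization_def
    by (auto simp: inj_def)
  moreover have "(\<lambda>w. \<phi> (\<theta> w)) ` W = \<phi> ` \<theta> ` W"
    by auto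
  ultimately show "local_parametrization M W (\<lambda>w. \<phi> (\<theta> w))"
    using W(1) lp' unfolding local_parametrization_def by auto
qed

lemma Ck_on_bilinear_diagonal:
  assumes "bounded_bilinear b" "open U"
  shows "Ck_on n (\<lambda>x. b x x) U"
\<comment> \<open>Aiming one order higher makes the derivative rule apply for every
  \<open>n\<close>; the derivative is linear in \<open>x\<close>, so it lies in every class.\<close>
proof (rule Ck_on_SucD, rule Ck_on_SucI[OF assms(2)])
  interpret bounded_bilinear b by fact
  show "((\<lambda>x. b x x) has_derivative (\<lambda>v. b x v + b v x)) (at x)" for x
    by (rule FDERIV) (rule has_derivative_ident)+
  show "Ck_on n (\<lambda>x. b x v + b v x) U" for v
    by (intro Ck_on_add Ck_on_bounded_linear assms bounded_linear_left bounded_linear_right)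
qed

text \<open>The quadratic term of the reparametrization cancels the tangential part of the second
  derivative, so that in the new coordinates the metric is Euclidean up to second order.\<close>

lemma normal_parametrization:
  fixes M :: "'a::euclidean_space set"
  assumes M: "smooth_submanifold TYPE('k::finite) M" and x: "x \<in> M"
  obtains W and \<phi> :: "real^'k \<Rightarrow> 'a" where "local_parametrization M W \<phi>" "0 \<in> W" "\<phi> 0 = x"
    "\<And>v w. frechet_derivative \<phi> (at 0) v \<bullet> frechet_derivative \<phi> (at 0) w = v \<bullet> w"
    "\<And>z v w. frechet_derivative \<phi> (at 0) z \<bullet> deriv2 \<phi> 0 v w = 0"
proof -
  obtain U and \<phi> :: "real^'k \<Rightarrow> 'a" where lp: "local_parametrization M U \<phi>" and "x \<in> \<phi> ` U"
    using M[unfolded smooth_submanifold_def, rule_format, OF x] by blast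
  then obtain u0 where u0: "u0 \<in> U" "\<phi> u0 = x"
    by blast
  have U: "open U" and sm: "smooth_on U \<phi>" and inj: "inj (frechet_derivative \<phi> (at u0))"
    using lp u0 by (auto simp: local_parametrization_def)
  have C2: "Ck_on 2 \<phi> U"
    using sm by (simp add: smooth_on_def)
  define A where "A = frechet_derivative \<phi> (at u0)"
  have A: "linear A"
    unfolding A_def by (rule has_derivative_linear[OF local_parametrization_has_derivative[OF lp u0(1)]])
  obtain B where B: "linear B" "\<And>v. B (A v) = v"
    using local_parametrization_left_inverse[OF lp u0(1)] unfolding A_def by blast
  have dim: "dim (UNIV :: (real^'k) set) = dim (range A)"
    using dim_image_eq[OF A, of UNIV] inj by (simp add: A_def)
  \<comment> \<open>\<open>f\<close> identifies \<open>real^'k\<close> isometrically with the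
    tangent space. The change of variables \<open>L\<close> below is chosen so that \<open>A\<close>
    after \<open>L\<close> is \<open>f\<close>.\<close>
  obtain f :: "real^'k \<Rightarrow> 'a" where f: "linear f" "range f = range A" "\<And>v. norm (f v) = norm v"
    by (rule isometries_subspaces[OF subspace_UNIV linear_subspace_image[OF A subspace_UNIV] dim]) simp
  have ff: "f v \<bullet> f w = v \<bullet> w" for v w
    using f(3) by (simp add: dot_norm linear_add[OF f(1), symmetric])
  define L where "L v = B (f v)" for v
  have L: "linear L"
    unfolding L_def using linear_compose[OF f(1) B(1)] by (simp add: o_def)
  have AL: "A (L v) = f v" for v
  proof -
    have "f v \<in> range A" using f(2) by blast
    then show ?thesis using B(2) by (auto simp: L_def)
  qed
  note bd = bilinear_deriv2[OF U u0(1) C2]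
  \<comment> \<open>Substituting \<open>L (h + g h h)\<close> adds
    \<open>2 *\<^sub>R f (g h v)\<close> to the second derivative. As \<open>f\<close> is an
    isometry onto the tangent space, \<open>f\<close> after \<open>adjoint f\<close> is the
    orthogonal projection to it, so the factor \<open>- 1 / 2\<close> cancels exactly the tangential
    part.\<close>
  define g where "g h v = (- 1 / 2) *\<^sub>R adjoint f (deriv2 \<phi> u0 (L h) (L v))" for h v
  have "bilinear g"
    unfolding bilinear_def
  proof (intro conjI allI)
    have *: "linear (\<lambda>v. (- 1 / 2) *\<^sub>R adjoint f (h v))" if "linear h" for h :: "real^'k \<Rightarrow> 'a"
      using linear_compose_scale_right[OF linear_compose[OF that adjoint_linear[OF f(1)]], of "- 1 / 2"]
      by (simp add: o_def)
    show "linear (g h)" for h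
      unfolding g_def using linear_compose[OF L, of "deriv2 \<phi> u0 (L h)"] bd
      by (intro *) (auto simp: o_def bilinear_def)
    show "linear (\<lambda>h. g h v)" for v
      unfolding g_def using linear_compose[OF L, of "\<lambda>h. deriv2 \<phi> u0 h (L v)"] bd
      by (intro *) (auto simp: o_def bilinear_def)
  qed
  then have g: "bounded_bilinear g"
    by (simp add: bilinear_conv_bounded_bilinear)
  interpret g: bounded_bilinear g by (rule g)
  have gsym: "g h v = g v h" for h v
    by (simp add: g_def deriv2_commute[OF U u0(1) C2, of "L h"])
  obtain K where K: "0 < K" "\<And>h v. norm (g h v) \<le> norm h * norm v * K"
    using g.pos_bounded by blast
  define \<theta> where "\<theta> h = u0 + L (h + g h h)" for h
  \<comment> \<open>On this ball \<open>g (h + k)\<close> and twice \<open>g h\<close> shrink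
    vectors at least by the factor 1/2, which makes \<open>\<theta>\<close> and its derivatives
    injective.\<close>
  define W where "W = ball 0 (1 / (4 * K)) \<inter> \<theta> -` U"
  have L': "bounded_linear L"
    using L by (simp add: linear_conv_bounded_linear)
  have Ck\<theta>: "Ck_on n \<theta> V" if "open V" for n V
    unfolding \<theta>_def using that
    by (intro Ck_on_add Ck_on_const Ck_on_linear_image[OF L'] Ck_on_bilinear_diagonal g
        Ck_on_bounded_linear bounded_linear_ident)
  then have "continuous_on UNIV \<theta>"
    by (rule Ck_on_imp_continuous_on) simp
  then have W: "open W"
    unfolding W_def using U by (intro open_Int open_ball) (simp add: continuous_on_open_vimage)
  have \<theta>0: "\<theta> 0 = u0"
    by (simp add: \<theta>_def g.zero_left linear_0[OF L])
  then have W0: "0 \<in> W"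
    using u0 K(1) by (simp add: W_def)
  have D\<theta>: "(\<theta> has_derivative (\<lambda>v. L (v + 2 *\<^sub>R g h v))) (at h)" for h
  proof -
    have "((\<lambda>h. h + g h h) has_derivative (\<lambda>v. v + (g h v + g v h))) (at h)"
      by (intro has_derivative_add has_derivative_ident g.FDERIV)
    from has_derivative_add[OF has_derivative_const bounded_linear.has_derivative[OF L' this]]
    show ?thesis
      unfolding \<theta>_def gsym[of _ h] by (simp add: scaleR_2)
  qed
  have Linj: "v = 0" if "L v = 0" for v
  proof -
    have "f v = 0"
      using that AL[of v] by (simp add: linear_0[OF A])
    then show ?thesis
      using f(3)[of v] by simp
  qed
  have inj\<theta>: "inj_on \<theta> W"
  proof (rule inj_onI)
    fix h k assume hk: "h \<in> W" "k \<in> W" "\<theta> h = \<theta> k"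
    have "L ((h + g h h) - (k + g k k)) = 0"
      using hk(3) by (simp add: \<theta>_def linear_diff[OF L])
    then have "h - k = g k k - g h h"
      using Linj by (metis (no_types, lifting) add_diff_eq diff_add_cancel diff_diff_add diff_eq_diff_eq eq_iff_diff_eq_0)
    also have "\<dots> = - g (h + k) (h - k)"
      by (simp add: g.add_left g.diff_right gsym[of k h])
    finally have "norm (h - k) = norm (g (h + k) (h - k))"
      by (metis norm_minus_cancel)
    also have "\<dots> \<le> norm (h + k) * norm (h - k) * K"
      by (rule K(2))
    also have "\<dots> \<le> 1 / 2 * norm (h - k)"
    proof -
      have "norm (h + k) \<le> 1 / (2 * K)"
        using hk norm_triangle_ineq[of h k] by (simp add: W_def)
      then have "norm (h + k) * K \<le> 1/2"
        using K(1) by (simp add: field_simps)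
      from mult_right_mono[OF this norm_ge_zero[of "h - k"]] show ?thesis
        by (simp add: mult_ac)
    qed
    finally show "h = k" by simp
  qed
  have D\<theta>inj: "inj (frechet_derivative \<theta> (at h))" if "h \<in> W" for h
    unfolding frechet_derivative_eqI[OF D\<theta>]
  proof (rule injI)
    fix v w assume "L (v + 2 *\<^sub>R g h v) = L (w + 2 *\<^sub>R g h w)"
    then have "L ((v - w) + 2 *\<^sub>R g h (v - w)) = 0"
      by (simp add: linear_diff[OF L] linear_add[OF L] g.diff_right algebra_simps)
    then have "v - w = - (2 *\<^sub>R g h (v - w))"
      using Linj eq_neg_iff_add_eq_0 by blast
    then have "norm (v - w) = norm (2 *\<^sub>R g h (v - w))"
      by (metis norm_minus_cancel)
    also have "\<dots> = 2 * norm (g h (v - w))"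
      by simp
    also have "\<dots> \<le> 2 * (norm h * norm (v - w) * K)"
      using K(2) by simp
    also have "\<dots> \<le> 1 / 2 * norm (v - w)"
    proof -
      have "norm h * K \<le> 1/4"
        using that K(1) by (simp add: W_def field_simps)
      from mult_right_mono[OF this norm_ge_zero[of "v - w"]] show ?thesis
        by (simp add: mult_ac)
    qed
    finally show "v = w" by simp
  qed
  have sub: "\<theta> ` W \<subseteq> U"
    by (auto simp: W_def)
  have sm\<theta>: "smooth_on W \<theta>"
    using Ck\<theta>[OF W] by (simp add: smooth_on_def)
  have lp': "local_parametrization M W (\<lambda>w. \<phi> (\<theta> w))"
    "\<And>w. w \<in> W \<Longrightarrow> frechet_derivative (\<lambda>w. \<phi> (\<theta> w)) (at w) =
      (\<lambda>v. frechet_derivative \<phi> (at (\<theta> w)) (frechet_derivative \<theta> (at w) v))"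
    using local_parametrization_compose[OF lp W sm\<theta> sub inj\<theta>] D\<theta>inj by blast+
  let ?D = "\<lambda>u. frechet_derivative \<phi> (at u)"
  have D': "frechet_derivative (\<lambda>w. \<phi> (\<theta> w)) (at w) v = ?D (\<theta> w) (L v) + 2 *\<^sub>R ?D (\<theta> w) (L (g w v))"
    if "w \<in> W" for w v
  proof -
    have "linear (?D (\<theta> w))"
      using that sub by (intro Ck2_linear_derivative[OF U u0(1) C2]) auto
    then show ?thesis
      by (simp add: lp'(2)[OF that] frechet_derivative_eqI[OF D\<theta>] linear_add linear_scale L)
  qed
  have D0: "frechet_derivative (\<lambda>w. \<phi> (\<theta> w)) (at 0) v = f v" for v
    using D'[OF W0] by (simp add: \<theta>0 g.zero_left linear_0[OF L] linear_0[OF A] flip: A_def AL)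
  have D2: "deriv2 (\<lambda>w. \<phi> (\<theta> w)) 0 h v = deriv2 \<phi> u0 (L h) (L v) + 2 *\<^sub>R f (g h v)" for h v
  proof -
    have dD: "((\<lambda>w. ?D (\<theta> w) b) has_derivative (\<lambda>h. deriv2 \<phi> u0 (L h) b)) (at 0)" for b
    proof -
      have "((\<lambda>u. ?D u b) has_derivative (\<lambda>h. deriv2 \<phi> u0 h b)) (at (\<theta> 0))"
        unfolding \<theta>0 by (rule deriv2_has_derivative[OF U u0(1) C2])
      from has_derivative_compose[OF D\<theta> this] show ?thesis
        by (simp add: g.zero_left)
    qed
    have y: "((\<lambda>w. L (g w v) \<bullet> b) has_derivative (\<lambda>h. L (g h v) \<bullet> b)) (at 0)" for b
      by (intro bounded_linear_imp_has_derivative bounded_linear_compose[OF bounded_linear_inner_left]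
        bounded_linear_compose[OF L'] g.bounded_linear_left)
    \<comment> \<open>Both the point and the direction move with \<open>w\<close>, so the direction
      is expanded in \<open>Basis\<close>. At \<open>w = 0\<close> the term that differentiates the
      point drops out because \<open>g 0 v = 0\<close>.\<close>
    have "((\<lambda>w. \<Sum>b\<in>Basis. (L (g w v) \<bullet> b) *\<^sub>R ?D (\<theta> w) b) has_derivative
      (\<lambda>h. \<Sum>b\<in>Basis. (L (g 0 v) \<bullet> b) *\<^sub>R deriv2 \<phi> u0 (L h) b + (L (g h v) \<bullet> b) *\<^sub>R ?D (\<theta> 0) b)) (at 0)"
      by (intro has_derivative_sum has_derivative_scaleR y dD)
    then have "((\<lambda>w. \<Sum>b\<in>Basis. (L (g w v) \<bullet> b) *\<^sub>R ?D (\<theta> w) b) has_derivative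
      (\<lambda>h. \<Sum>b\<in>Basis. (L (g h v) \<bullet> b) *\<^sub>R A b)) (at 0)"
      by (simp add: \<theta>0 g.zero_left linear_0[OF L] A_def)
    also have "(\<lambda>h. \<Sum>b\<in>Basis. (L (g h v) \<bullet> b) *\<^sub>R A b) = (\<lambda>h. f (g h v))"
      by (subst AL[symmetric], subst (2) euclidean_representation[symmetric])
        (simp add: linear_sum[OF A] linear_scale[OF A])
    finally have "((\<lambda>w. ?D (\<theta> w) (L v) + 2 *\<^sub>R (\<Sum>b\<in>Basis. (L (g w v) \<bullet> b) *\<^sub>R ?D (\<theta> w) b)) has_derivative
      (\<lambda>h. deriv2 \<phi> u0 (L h) (L v) + 2 *\<^sub>R f (g h v))) (at 0)"
      by (intro has_derivative_add has_derivative_scaleR_right dD)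
    then have "((\<lambda>w. frechet_derivative (\<lambda>w. \<phi> (\<theta> w)) (at w) v) has_derivative
      (\<lambda>h. deriv2 \<phi> u0 (L h) (L v) + 2 *\<^sub>R f (g h v))) (at 0)"
    proof (rule has_derivative_transform_within_open[OF _ W W0])
      fix w assume w: "w \<in> W"
      have lin: "linear (?D (\<theta> w))"
        using w sub by (intro Ck2_linear_derivative[OF U u0(1) C2]) auto
      have "?D (\<theta> w) (L (g w v)) = (\<Sum>b\<in>Basis. (L (g w v) \<bullet> b) *\<^sub>R ?D (\<theta> w) b)"
        by (subst euclidean_representation[of "L (g w v)", symmetric])
          (simp only: linear_sum[OF lin] linear_scale[OF lin])
      then show "?D (\<theta> w) (L v) + 2 *\<^sub>R (\<Sum>b\<in>Basis. (L (g w v) \<bullet> b) *\<^sub>R ?D (\<theta> w) b)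
          = frechet_derivative (\<lambda>w. \<phi> (\<theta> w)) (at w) v"
        by (simp add: D'[OF w])
    qed
    then show ?thesis
      by (simp add: deriv2_def frechet_derivative_eqI)
  qed
  show thesis
  proof (rule that[OF lp'(1) W0])
    show "\<phi> (\<theta> 0) = x"
      by (simp add: \<theta>0 u0)
    show "frechet_derivative (\<lambda>w. \<phi> (\<theta> w)) (at 0) v \<bullet> frechet_derivative (\<lambda>w. \<phi> (\<theta> w)) (at 0) w = v \<bullet> w" for v w
      by (simp add: D0 ff)
    show "frechet_derivative (\<lambda>w. \<phi> (\<theta> w)) (at 0) z \<bullet> deriv2 (\<lambda>w. \<phi> (\<theta> w)) 0 v w = 0" for z v w
      using adjoint_works[OF f(1), of z "deriv2 \<phi> u0 (L v) (L w)"]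
      by (simp add: D0 D2 inner_add_right ff g_def)
  qed
qed

section \<open>The Laplace-Beltrami operator in normal coordinates\<close>

text \<open>The first-order term of the metric consists of inner products of
  \<open>frechet_derivative \<phi> (at 0)\<close> with \<open>deriv2 \<phi> 0\<close> and vanishes
  by normality. What remains is the remainder \<open>R\<close> paired with vectors of known length,
  and the quadratic term \<open>X v \<bullet> X w\<close>.\<close>

lemma metric_expansion:
  fixes \<phi> :: "'c::euclidean_space \<Rightarrow> 'a::euclidean_space"
  assumes U: "open U" "0 \<in> U" "Ck_on 2 \<phi> U"
    and iso: "\<And>v w. frechet_derivative \<phi> (at 0) v \<bullet> frechet_derivative \<phi> (at 0) w = v \<bullet> w"
    and nrm: "\<And>z v w. frechet_derivative \<phi> (at 0) z \<bullet> deriv2 \<phi> 0 v w = 0"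
    and e: "0 < e"
  shows "\<exists>d>0. ball 0 d \<subseteq> U \<and> (\<forall>u v w. norm u < d \<longrightarrow>
    \<bar>frechet_derivative \<phi> (at u) v \<bullet> frechet_derivative \<phi> (at u) w - v \<bullet> w\<bar> \<le> e * norm u * norm v * norm w)"
proof -
  let ?D = "\<lambda>u. frechet_derivative \<phi> (at u)"
  have niso: "norm (?D 0 v) = norm v" for v
    by (simp add: norm_eq_sqrt_inner iso)
  obtain K where K: "0 < K" "\<And>h v. norm (deriv2 \<phi> 0 h v) \<le> norm h * norm v * K"
    using bounded_bilinear.pos_bounded bilinear_deriv2[OF U] bilinear_conv_bounded_bilinear by metis
  obtain d0 where d0: "0 < d0" "ball 0 d0 \<subseteq> U" "\<And>h w. norm h < d0 \<Longrightarrow>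
      norm (?D (0 + h) w - ?D 0 w - deriv2 \<phi> 0 h w) \<le> e / 4 * norm h * norm w"
    using deriv2_expansion[OF U, of "e / 4"] e by auto
  \<comment> \<open>The second radius makes \<open>(K + e / 4)\<^sup>2 * norm u\<close> at most
    \<open>e / 2\<close>; the two terms with \<open>R\<close> take \<open>e / 4\<close>
    each.\<close>
  define d where "d = min d0 (e / (2 * (K + e / 4)\<^sup>2))"
  have dpos: "0 < d"
    using d0 e K by (simp add: d_def add_pos_pos)
  have "\<bar>?D u v \<bullet> ?D u w - v \<bullet> w\<bar> \<le> e * norm u * norm v * norm w" if u: "norm u < d" for u v w
  proof -
    define R where "R w = ?D u w - ?D 0 w - deriv2 \<phi> 0 u w" for w
    have R: "norm (R w) \<le> e / 4 * norm u * norm w" for w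
      using d0(3)[of u w] u by (simp add: R_def d_def)
    define X where "X w = deriv2 \<phi> 0 u w + R w" for w
    have X: "norm (X w) \<le> (K + e / 4) * norm u * norm w" for w
      using norm_triangle_ineq[of "deriv2 \<phi> 0 u w" "R w"] R[of w] K(2)[of u w]
      by (simp add: X_def algebra_simps)
    have "?D u v \<bullet> ?D u w = (?D 0 v + X v) \<bullet> (?D 0 w + X w)"
      by (simp add: X_def R_def)
    also have "\<dots> = v \<bullet> w + ?D 0 v \<bullet> R w + R v \<bullet> ?D 0 w + X v \<bullet> X w"
    proof -
      have "?D 0 v \<bullet> X w = ?D 0 v \<bullet> R w" for v w
        by (simp add: X_def inner_add_right nrm)
      from this[of v w] this[of w v] show ?thesis
        by (simp add: inner_add_left inner_add_right iso inner_commute[of _ "?D 0 w"] inner_commute[of w v])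
    qed
    finally have eq: "?D u v \<bullet> ?D u w - v \<bullet> w = ?D 0 v \<bullet> R w + R v \<bullet> ?D 0 w + X v \<bullet> X w"
      by simp
    have "\<bar>?D 0 v \<bullet> R w\<bar> \<le> norm v * (e / 4 * norm u * norm w)"
      using Cauchy_Schwarz_ineq2[of "?D 0 v" "R w"] mult_left_mono[OF R[of w] norm_ge_zero[of v]]
      by (simp add: niso)
    moreover have "\<bar>R v \<bullet> ?D 0 w\<bar> \<le> (e / 4 * norm u * norm v) * norm w"
      using Cauchy_Schwarz_ineq2[of "R v" "?D 0 w"] mult_right_mono[OF R[of v] norm_ge_zero[of w]]
      by (simp add: niso)
    moreover have "\<bar>X v \<bullet> X w\<bar> \<le> e / 2 * (norm u * norm v * norm w)"
    proof -
      have "\<bar>X v \<bullet> X w\<bar> \<le> norm (X v) * norm (X w)"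
        by (rule Cauchy_Schwarz_ineq2)
      also have "\<dots> \<le> ((K + e / 4) * norm u * norm v) * ((K + e / 4) * norm u * norm w)"
        using K e by (intro mult_mono X) auto
      also have "\<dots> = ((K + e / 4)\<^sup>2 * norm u) * (norm u * norm v * norm w)"
        by (simp add: power2_eq_square)
      also have "\<dots> \<le> e / 2 * (norm u * norm v * norm w)"
      proof (rule mult_right_mono)
        have "0 < (K + e / 4)\<^sup>2"
          using K e by (simp add: add_pos_pos)
        then show "(K + e / 4)\<^sup>2 * norm u \<le> e / 2"
          using u by (simp add: d_def field_simps)
      qed simp
      finally show ?thesis .
    qed
    ultimately show ?thesis
      unfolding eq by (simp add: algebra_simps)
  qed
  then show ?thesis
    using dpos d0(2) by (intro exI[of _ d]) (auto simp: d_def)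
qed

text \<open>\<open>divergence\<close> uses an unspecified orthonormal basis. Expanding one slot in
  \<open>Basis\<close> and resumming over \<open>B\<close> by orthonormality lets it be replaced by
  the standard one.\<close>

lemma trace_orthonormal_basis:
  fixes \<beta> :: "'c::euclidean_space \<Rightarrow> 'c \<Rightarrow> real"
  assumes \<beta>: "bilinear \<beta>" and B: "pairwise orthogonal B" "\<And>b. b \<in> B \<Longrightarrow> norm b = 1" "span B = UNIV"
  shows "(\<Sum>b\<in>B. \<beta> b b) = (\<Sum>b\<in>Basis. \<beta> b b)"
proof -
  have fin: "finite B"
    using B(1,2) by (intro pairwise_orthogonal_imp_finite)
  have lin: "linear (\<beta> x)" "linear (\<lambda>x. \<beta> x y)" for x y
    using \<beta> by (auto simp: bilinear_def)
  have "\<beta> b b = (\<Sum>e\<in>Basis. (b \<bullet> e) * \<beta> e b)" for b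
    using arg_cong[OF euclidean_representation[of b], of "\<lambda>x. \<beta> x b"]
    by (simp add: linear_sum[OF lin(2)] linear_scale[OF lin(2)])
  then have "(\<Sum>b\<in>B. \<beta> b b) = (\<Sum>b\<in>B. \<Sum>e\<in>Basis. (b \<bullet> e) * \<beta> e b)"
    by (rule sum.cong[OF refl])
  also have "\<dots> = (\<Sum>e\<in>Basis. \<Sum>b\<in>B. (b \<bullet> e) * \<beta> e b)"
    by (rule sum.swap)
  also have "\<dots> = (\<Sum>e\<in>Basis. \<beta> e (\<Sum>b\<in>B. (e \<bullet> b) *\<^sub>R b))"
    by (simp add: linear_sum[OF lin(1)] linear_scale[OF lin(1)] inner_commute)
  also have "\<dots> = (\<Sum>e\<in>Basis. \<beta> e e)"
    using B fin by (simp add: orthonormal_basis_expand)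
  finally show ?thesis .
qed

text \<open>The variational inequality for the closest point, tested at \<open>?c + b\<close> and
  \<open>?c - b\<close>, gives both signs. Thus the projection in
  \<open>covariant_derivative\<close> is invisible to inner products with tangent vectors.\<close>

lemma closest_point_subspace_inner:
  assumes "subspace T" "b \<in> T"
  shows "closest_point T z \<bullet> b = z \<bullet> (b::'a::euclidean_space)"
proof -
  let ?c = "closest_point T z"
  have T: "closed T" "convex T" "T \<noteq> {}"
    using assms by (auto simp: closed_subspace subspace_imp_convex)
  have c: "?c \<in> T"
    using T by (intro closest_point_in_set)
  have "(z - ?c) \<bullet> (y - ?c) \<le> 0" if "y \<in> T" for y
    using T that by (intro closest_point_dot)
  from this[of "?c + b"] this[of "?c - b"] show ?thesis
    using assms c by (auto simp: subspace_add subspace_diff inner_diff_left)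
qed

context
  fixes M :: "'a::euclidean_space set" and U and \<phi> :: "real^'k::finite \<Rightarrow> 'a" and f :: "'a \<Rightarrow> real"
    and F W
  assumes lp: "local_parametrization M U \<phi>"
    and W: "open W" "smooth_on W F" "\<phi> ` U \<subseteq> W" "\<And>y. y \<in> W \<inter> M \<Longrightarrow> F y = f y"
begin

lemma param_subset: "\<phi> ` U \<subseteq> M" and open_param_domain: "open U" and smooth_param: "smooth_on U \<phi>"
  and param_C2: "Ck_on 2 \<phi> U"
  using lp by (auto simp: local_parametrization_def smooth_on_def)

lemma coordinate_C2: "Ck_on 2 (\<lambda>u. f (\<phi> u)) U"
proof (rule Ck_on_cong[OF open_param_domain])
  show "Ck_on 2 (\<lambda>u. F (\<phi> u)) U"
    by (rule Ck_on_compose[OF open_param_domain W(1,3)]) (use W(2) param_C2 in \<open>simp_all add: smooth_on_def\<close>)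
  show "F (\<phi> u) = f (\<phi> u)" if "u \<in> U" for u
    using W param_subset that by blast
qed

text \<open>As a map on the ambient space \<open>Y'\<close> is not unique, but composition with the
  chart reduces to a derivative on the open set \<open>U\<close>, where uniqueness fixes its values
  on tangent vectors.\<close>

lemma derivative_within_submanifold_param:
  fixes Y :: "'a \<Rightarrow> 'b::real_normed_vector"
  assumes Y: "(Y has_derivative Y') (at (\<phi> u) within M)" and u: "u \<in> U"
    and Z: "((\<lambda>u. Y (\<phi> u)) has_derivative Z) (at u)"
  shows "Y' (frechet_derivative \<phi> (at u) v) = Z v"
proof -
  note \<phi> = local_parametrization_has_derivative[OF lp u]
  have "(\<phi> has_derivative frechet_derivative \<phi> (at u)) (at u within U)"
    using \<phi> by (rule has_derivative_at_withinI)
  moreover have "(Y has_derivative Y') (at (\<phi> u) within \<phi> ` U)"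
    using Y param_subset by (rule has_derivative_subset)
  ultimately have "((\<lambda>u. Y (\<phi> u)) has_derivative (\<lambda>v. Y' (frechet_derivative \<phi> (at u) v))) (at u within U)"
    by (rule has_derivative_in_compose)
  then have "((\<lambda>u. Y (\<phi> u)) has_derivative (\<lambda>v. Y' (frechet_derivative \<phi> (at u) v))) (at u)"
    using at_within_open[OF u open_param_domain] by simp
  from has_derivative_unique[OF this Z] show ?thesis
    by (rule fun_cong)
qed

lemma frechet_derivative_within_param:
  assumes u: "u \<in> U"
  shows "frechet_derivative f (at (\<phi> u) within M) (frechet_derivative \<phi> (at u) v)
    = frechet_derivative (\<lambda>u. f (\<phi> u)) (at u) v"
proof (rule derivative_within_submanifold_param[OF _ u])
  have uW: "\<phi> u \<in> W \<inter> M"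
    using u W(3) param_subset by auto
  have "(F has_derivative frechet_derivative F (at (\<phi> u))) (at (\<phi> u) within W \<inter> M)"
    using uW by (intro has_derivative_at_withinI[OF smooth_on_has_derivative[OF W(2)]]) auto
  then have "(f has_derivative frechet_derivative F (at (\<phi> u))) (at (\<phi> u) within W \<inter> M)"
    by (rule has_derivative_transform[OF uW, rotated]) (simp add: W(4))
  moreover have "at (\<phi> u) within W \<inter> M = at (\<phi> u) within M"
    using uW W(1) by (intro at_within_nhd[of _ W]) auto
  ultimately have "f differentiable (at (\<phi> u) within M)"
    by (auto simp: differentiable_def)
  then show "(f has_derivative frechet_derivative f (at (\<phi> u) within M)) (at (\<phi> u) within M)"
    by (simp add: frechet_derivative_works)
  show "((\<lambda>u. f (\<phi> u)) has_derivative frechet_derivative (\<lambda>u. f (\<phi> u)) (at u)) (at u)"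
    by (rule Ck2_has_derivative[OF open_param_domain u coordinate_C2 u])
qed

lemma grad_param:
  assumes u: "u \<in> U"
    and c: "\<And>w. frechet_derivative \<phi> (at u) c \<bullet> frechet_derivative \<phi> (at u) w = frechet_derivative (\<lambda>u. f (\<phi> u)) (at u) w"
  shows "grad M f (\<phi> u) = frechet_derivative \<phi> (at u) c"
  unfolding grad_def tangent_space_eq_range[OF lp u]
proof (rule the_equality)
  let ?D = "frechet_derivative \<phi> (at u)"
  show "?D c \<in> range ?D \<and> (\<forall>w\<in>range ?D. ?D c \<bullet> w = frechet_derivative f (at (\<phi> u) within M) w)"
    using c by (auto simp: frechet_derivative_within_param[OF u])
  fix v assume v: "v \<in> range ?D \<and> (\<forall>w\<in>range ?D. v \<bullet> w = frechet_derivative f (at (\<phi> u) within M) w)"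
  then obtain b where b: "v = ?D b" by blast
  have D: "linear ?D"
    by (rule Ck2_linear_derivative[OF open_param_domain u param_C2 u])
  have "?D b \<bullet> ?D (b - c) = ?D c \<bullet> ?D (b - c)"
    using v c by (auto simp: frechet_derivative_within_param[OF u] b)
  then have "(?D b - ?D c) \<bullet> (?D b - ?D c) = 0"
    by (simp add: linear_diff[OF D] inner_diff_left)
  then show "v = ?D c"
    by (simp add: b)
qed

text \<open>\<open>c\<close> solves the linear system whose matrix is the metric:
  \<open>adjoint ?D\<close> after \<open>?D\<close> is injective because \<open>?D\<close> is, hence
  surjective, and \<open>adjoint ?d 1\<close> is the vector of partial derivatives.\<close>

lemma gradient_coordinates_exist:
  assumes u: "u \<in> U"
  shows "\<exists>c. \<forall>w. frechet_derivative \<phi> (at u) c \<bullet> frechet_derivative \<phi> (at u) w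
    = frechet_derivative (\<lambda>u. f (\<phi> u)) (at u) w"
proof -
  let ?D = "frechet_derivative \<phi> (at u)" and ?d = "frechet_derivative (\<lambda>u. f (\<phi> u)) (at u)"
  have D: "linear ?D"
    by (rule Ck2_linear_derivative[OF open_param_domain u param_C2 u])
  have d: "linear ?d"
    by (rule Ck2_linear_derivative[OF open_param_domain u coordinate_C2 u])
  have "linear (\<lambda>c. adjoint ?D (?D c))"
    using linear_compose[OF D adjoint_linear[OF D]] by (simp add: o_def)
  moreover have "inj (\<lambda>c. adjoint ?D (?D c))"
  proof (rule injI)
    fix b c assume "adjoint ?D (?D b) = adjoint ?D (?D c)"
    then have "(b - c) \<bullet> adjoint ?D (?D b) = (b - c) \<bullet> adjoint ?D (?D c)"
      by simp
    then have "(?D b - ?D c) \<bullet> (?D b - ?D c) = 0"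
      by (simp add: adjoint_works[OF D] linear_diff[OF D] inner_diff_right)
    then have "?D b = ?D c" by simp
    then show "b = c"
      using lp u by (auto simp: local_parametrization_def inj_def)
  qed
  ultimately have "surj (\<lambda>c. adjoint ?D (?D c))"
    by (rule linear_inj_imp_surj)
  then obtain c where c: "adjoint ?D (?D c) = adjoint ?d 1"
    by (metis surjD)
  have "?D c \<bullet> ?D w = ?d w" for w
    using adjoint_works[OF D, of w "?D c"] adjoint_works[OF d, of w 1] by (simp add: c inner_commute)
  then show ?thesis by blast
qed

text \<open>Along the chart the gradient is \<open>?D u (c u)\<close>. Its derivative at 0 has a
  part with \<open>deriv2 \<phi> 0\<close>, which is normal and disappears against tangent vectors,
  and a part \<open>?D 0 (H h)\<close> with \<open>H\<close> the coordinate Hessian of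
  \<open>f o \<phi>\<close>, whose trace remains.\<close>

theorem laplace_beltrami_normal_coordinates:
  assumes zero: "0 \<in> U"
    and iso: "\<And>v w. frechet_derivative \<phi> (at 0) v \<bullet> frechet_derivative \<phi> (at 0) w = v \<bullet> w"
    and nrm: "\<And>z v w. frechet_derivative \<phi> (at 0) z \<bullet> deriv2 \<phi> 0 v w = 0"
  shows "laplace_beltrami M f (\<phi> 0) = - (\<Sum>b\<in>Basis. deriv2 (\<lambda>u. f (\<phi> u)) 0 b b)"
proof -
  define p where "p = (\<lambda>u. f (\<phi> u))"
  let ?D = "\<lambda>u. frechet_derivative \<phi> (at u)" and ?x = "\<phi> 0"
  note O = open_param_domain
  have C2p: "Ck_on 2 p U"
    unfolding p_def by (rule coordinate_C2)
  obtain c where c: "\<And>u w. u \<in> U \<Longrightarrow> ?D u (c u) \<bullet> ?D u w = frechet_derivative p (at u) w"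
    unfolding p_def using gradient_coordinates_exist by metis
  have gr: "grad M f (\<phi> u) = ?D u (c u)" if "u \<in> U" for u
    using c that unfolding p_def by (intro grad_param) auto
  define d where "d u = (\<Sum>b\<in>Basis. frechet_derivative p (at u) b *\<^sub>R b)" for u
  have dw: "d u \<bullet> w = frechet_derivative p (at u) w" if "u \<in> U" for u w
  proof -
    have lin: "linear (frechet_derivative p (at u))"
      by (rule Ck2_linear_derivative[OF O that C2p that])
    have "frechet_derivative p (at u) w = frechet_derivative p (at u) (\<Sum>b\<in>Basis. (w \<bullet> b) *\<^sub>R b)"
      by (simp only: euclidean_representation)
    also have "\<dots> = (\<Sum>b\<in>Basis. (w \<bullet> b) * frechet_derivative p (at u) b)"
      by (simp add: linear_sum[OF lin] linear_scale[OF lin])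
    finally show ?thesis
      by (simp add: d_def inner_sum_left mult.commute inner_commute[of w])
  qed
  define H where "H h = (\<Sum>b\<in>Basis. deriv2 p 0 h b *\<^sub>R b)" for h
  have dH: "(d has_derivative H) (at 0)"
    unfolding d_def[abs_def] H_def[abs_def]
    by (intro has_derivative_sum has_derivative_scaleR_left deriv2_has_derivative[OF O zero C2p])
  have Hw: "H h \<bullet> w = deriv2 p 0 h w" for h w
  proof -
    have lin: "linear (deriv2 p 0 h)"
      using bilinear_deriv2[OF O zero C2p] by (simp add: bilinear_def)
    have "deriv2 p 0 h w = deriv2 p 0 h (\<Sum>b\<in>Basis. (w \<bullet> b) *\<^sub>R b)"
      by (simp only: euclidean_representation)
    also have "\<dots> = (\<Sum>b\<in>Basis. (w \<bullet> b) * deriv2 p 0 h b)"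
      by (simp add: linear_sum[OF lin] linear_scale[OF lin])
    finally show ?thesis
      by (simp add: H_def inner_sum_left mult.commute inner_commute[of w])
  qed
  have c0: "c 0 = d 0"
  proof -
    have "(c 0 - d 0) \<bullet> w = 0" for w
      using c[OF zero, of w] dw[OF zero, of w] by (simp add: iso inner_diff_left)
    from this[of "c 0 - d 0"] show ?thesis by simp
  qed
  text \<open>Since the metric is Euclidean up to \<open>o(norm u)\<close>, the gradient coordinates \<open>c\<close> have the
    same derivative at \<open>0\<close> as the vector \<open>d\<close> of partial derivatives.\<close>
  have "((\<lambda>u. c u - d u) has_derivative (\<lambda>_. 0)) (at 0)"
    unfolding has_derivative_at_alt
  proof (intro conjI allI impI)
    fix e :: real assume e: "0 < e"
    have "isCont d 0"
      using dH by (rule has_derivative_continuous)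
    then obtain d1 where d1: "0 < d1" "\<And>u. norm u < d1 \<Longrightarrow> norm (d u - d 0) < 1"
      unfolding continuous_at_eps_delta by (metis dist_norm diff_zero zero_less_one)
    define N where "N = norm (d 0) + 1"
    have N: "0 < N" by (simp add: N_def add_nonneg_pos)
    obtain d2 where d2: "0 < d2" "ball 0 d2 \<subseteq> U" "\<And>u v w. norm u < d2 \<Longrightarrow>
        \<bar>?D u v \<bullet> ?D u w - v \<bullet> w\<bar> \<le> e / (2 * N) * norm u * norm v * norm w"
      using metric_expansion[OF O zero param_C2 iso nrm, of "e / (2 * N)"] e N by auto
    show "\<exists>\<delta>>0. \<forall>u. norm (u - 0) < \<delta> \<longrightarrow> norm (c u - d u - (c 0 - d 0) - 0) \<le> e * norm (u - 0)"
    \<comment> \<open>The last bound keeps \<open>e / (2 * N) * norm u\<close> below 1/2, which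
      gives the a priori estimate \<open>norm (c u) \<le> 2 * N\<close>.\<close>
    proof (intro exI[of _ "min (min d1 d2) (N / e)"] conjI allI impI)
      fix u :: "real^'k" assume "norm (u - 0) < min (min d1 d2) (N / e)"
      then have u: "norm u < d1" "norm u < d2" "norm u < N / e" by auto
      have uU: "u \<in> U" using u(2) d2(2) by auto
      \<comment> \<open>Both \<open>d u \<bullet> w\<close> and
        \<open>?D u (c u) \<bullet> ?D u w\<close> equal the derivative of \<open>p\<close> along
        \<open>w\<close>. With \<open>w = c u - d u\<close> the squared distance becomes a defect of
        the metric from the Euclidean one.\<close>
      have "(c u - d u) \<bullet> (c u - d u) = c u \<bullet> (c u - d u) - ?D u (c u) \<bullet> ?D u (c u - d u)"
        using c[OF uU, of "c u - d u"] dw[OF uU, of "c u - d u"] by (simp add: inner_diff_left)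
      also have "\<dots> \<le> e / (2 * N) * norm u * norm (c u) * norm (c u - d u)"
        using d2(3)[OF u(2), of "c u" "c u - d u"] by linarith
      finally have "norm (c u - d u) * norm (c u - d u) \<le> (e / (2 * N) * norm u * norm (c u)) * norm (c u - d u)"
        by (simp add: power2_norm_eq_inner flip: power2_eq_square)
      then have 1: "norm (c u - d u) \<le> e / (2 * N) * norm u * norm (c u)"
      proof (cases "c u = d u")
        case False
        then show ?thesis
          by (intro mult_right_le_imp_le[OF \<open>norm (c u - d u) * norm (c u - d u) \<le> _\<close>]) simp
      qed (use e N in simp)
      have "e / (2 * N) * norm u \<le> 1 / 2"
        using u(3) e N by (simp add: field_simps)
      from mult_right_mono[OF this norm_ge_zero[of "c u"]] 1
      have "norm (c u - d u) \<le> 1/2 * norm (c u)" by linarith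
      moreover have "norm (c u) \<le> norm (c u - d u) + norm (d u)" "norm (d u) \<le> norm (d u - d 0) + norm (d 0)"
        by norm+
      ultimately have "norm (c u) \<le> 2 * N"
        using d1(2)[OF u(1)] by (simp add: N_def)
      with 1 have "norm (c u - d u) \<le> e / (2 * N) * norm u * (2 * N)"
        using e N by (elim order_trans) (intro mult_left_mono, auto)
      then show "norm (c u - d u - (c 0 - d 0) - 0) \<le> e * norm (u - 0)"
        using N by (simp add: c0)
    qed (use d1 d2 N e in auto)
  qed simp
  from has_derivative_add[OF this dH] have cH: "(c has_derivative H) (at 0)"
    by simp
  define L where "L h = deriv2 \<phi> 0 h (c 0) + ?D 0 (H h)" for h
  have YL: "((\<lambda>u. grad M f (\<phi> u)) has_derivative L) (at 0)"
  proof (rule has_derivative_transform_within_open[OF _ O zero])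
    show "((\<lambda>u. \<Sum>b\<in>Basis. (c u \<bullet> b) *\<^sub>R ?D u b) has_derivative L) (at 0)"
    proof -
      have "((\<lambda>u. \<Sum>b\<in>Basis. (c u \<bullet> b) *\<^sub>R ?D u b) has_derivative
        (\<lambda>h. \<Sum>b\<in>Basis. (c 0 \<bullet> b) *\<^sub>R deriv2 \<phi> 0 h b + (H h \<bullet> b) *\<^sub>R ?D 0 b)) (at 0)"
        by (intro has_derivative_sum has_derivative_scaleR has_derivative_inner_left cH
            deriv2_has_derivative[OF O zero param_C2])
      also have "(\<lambda>h. \<Sum>b\<in>Basis. (c 0 \<bullet> b) *\<^sub>R deriv2 \<phi> 0 h b + (H h \<bullet> b) *\<^sub>R ?D 0 b) = L"
      proof
        fix h
        have l1: "linear (deriv2 \<phi> 0 h)" and l2: "linear (?D 0)"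
          using bilinear_deriv2[OF O zero param_C2] Ck2_linear_derivative[OF O zero param_C2 zero]
          by (simp_all add: bilinear_def)
        have "deriv2 \<phi> 0 h (\<Sum>b\<in>Basis. (c 0 \<bullet> b) *\<^sub>R b) = (\<Sum>b\<in>Basis. (c 0 \<bullet> b) *\<^sub>R deriv2 \<phi> 0 h b)"
          "?D 0 (\<Sum>b\<in>Basis. (H h \<bullet> b) *\<^sub>R b) = (\<Sum>b\<in>Basis. (H h \<bullet> b) *\<^sub>R ?D 0 b)"
          by (simp_all only: linear_sum[OF l1] linear_scale[OF l1] linear_sum[OF l2] linear_scale[OF l2])
        then show "(\<Sum>b\<in>Basis. (c 0 \<bullet> b) *\<^sub>R deriv2 \<phi> 0 h b + (H h \<bullet> b) *\<^sub>R ?D 0 b) = L h"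
          by (simp only: euclidean_representation sum.distrib L_def)
      qed
      finally show ?thesis .
    qed
    fix u assume u: "u \<in> U"
    have l: "linear (?D u)"
      by (rule Ck2_linear_derivative[OF O u param_C2 u])
    have "?D u (\<Sum>b\<in>Basis. (c u \<bullet> b) *\<^sub>R b) = (\<Sum>b\<in>Basis. (c u \<bullet> b) *\<^sub>R ?D u b)"
      by (simp only: linear_sum[OF l] linear_scale[OF l])
    then show "(\<Sum>b\<in>Basis. (c u \<bullet> b) *\<^sub>R ?D u b) = grad M f (\<phi> u)"
      by (simp only: euclidean_representation gr[OF u])
  qed
  obtain B where B: "linear B" "\<And>v. B (?D 0 v) = v"
    using local_parametrization_left_inverse[OF lp zero] by blast
  obtain \<psi> where \<psi>: "homeomorphism U (\<phi> ` U) \<phi> \<psi>" and op: "openin (top_of_set M) (\<phi> ` U)"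
    using lp by (auto simp: local_parametrization_def)
  have \<psi>0: "\<psi> ?x = 0"
    using \<psi> zero by (simp add: homeomorphism_def)
  \<comment> \<open>\<open>frechet_derivative\<close> denotes a derivative only once
    differentiability relative to \<open>M\<close> is known. It is inherited from the coordinate
    field through the inverse chart, whose derivative relative to \<open>M\<close> is
    \<open>B\<close>.\<close>
  have "(grad M f) differentiable (at ?x within M)"
  proof -
    have "(\<psi> has_derivative B) (at ?x within M)"
      using has_derivative_left_inverse_within[OF local_parametrization_has_derivative[OF lp zero] zero \<psi> op] B
      by (simp add: linear_conv_bounded_linear)
    moreover have "((\<lambda>u. grad M f (\<phi> u)) has_derivative L) (at (\<psi> ?x))"
      using YL by (simp add: \<psi>0)
    ultimately have "((\<lambda>y. grad M f (\<phi> (\<psi> y))) has_derivative (\<lambda>v. L (B v))) (at ?x within M)"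
      by (rule has_derivative_compose)
    then have "((\<lambda>y. grad M f (\<phi> (\<psi> y))) has_derivative (\<lambda>v. L (B v))) (at ?x within \<phi> ` U)"
      using param_subset by (rule has_derivative_subset)
    then have "(grad M f has_derivative (\<lambda>v. L (B v))) (at ?x within \<phi> ` U)"
      by (rule has_derivative_transform[rotated 2]) (use \<psi> zero in \<open>auto simp: homeomorphism_def\<close>)
    moreover obtain T where "open T" "\<phi> ` U = M \<inter> T"
      using op by (auto simp: openin_open)
    then have "at ?x within \<phi> ` U = at ?x within M"
      using zero by (intro at_within_nhd[of _ T]) auto
    ultimately show ?thesis
      by (auto simp: differentiable_def)
  qed
  then have Y': "(grad M f has_derivative frechet_derivative (grad M f) (at ?x within M)) (at ?x within M)"
    by (simp add: frechet_derivative_works)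
  note YD = derivative_within_submanifold_param[OF Y' zero YL]
  have T: "tangent_space M ?x = range (?D 0)"
    by (rule tangent_space_eq_range[OF lp zero])
  have D0: "linear (?D 0)"
    by (rule Ck2_linear_derivative[OF O zero param_C2 zero])
  have subT: "subspace (tangent_space M ?x)"
    unfolding T by (rule linear_subspace_image[OF D0 subspace_UNIV])
  \<comment> \<open>This is the very basis chosen inside \<open>divergence\<close>; \<open>B\<close>
    carries it to an orthonormal basis of \<open>real^'k\<close>.\<close>
  define E where "E = (SOME B. orthonormal_basis (tangent_space M ?x) B)"
  have "\<exists>B. orthonormal_basis (tangent_space M ?x) B"
    using orthonormal_basis_subspace[OF subT] unfolding orthonormal_basis_def by metis
  then have "orthonormal_basis (tangent_space M ?x) E"
    unfolding E_def by (rule someI_ex)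
  then have E: "pairwise orthogonal E" "\<And>b. b \<in> E \<Longrightarrow> norm b = 1" "span E = range (?D 0)"
    by (auto simp: orthonormal_basis_def T)
  have ET: "E \<subseteq> range (?D 0)"
    using E(3) span_superset by blast
  have DB: "?D 0 (B b) = b" if "b \<in> range (?D 0)" for b
    using that B(2) by auto
  have BB: "B b \<bullet> B b' = b \<bullet> b'" if "b \<in> E" "b' \<in> E" for b b'
    using that DB[OF subsetD[OF ET]] iso[of "B b" "B b'"] by simp
  have injB: "inj_on B E"
    using ET DB by (metis inj_onI subsetD)
  have "divergence M (grad M f) ?x = (\<Sum>b\<in>E. covariant_derivative M (grad M f) ?x b \<bullet> b)"
    by (simp add: divergence_def E_def)
  also have "\<dots> = (\<Sum>b\<in>E. deriv2 p 0 (B b) (B b))"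
  proof (rule sum.cong[OF refl])
    fix b assume "b \<in> E"
    then have b: "b \<in> range (?D 0)" using ET by blast
    have "covariant_derivative M (grad M f) ?x b \<bullet> b = frechet_derivative (grad M f) (at ?x within M) b \<bullet> b"
      unfolding covariant_derivative_def using b by (intro closest_point_subspace_inner subT) (simp add: T)
    also have "\<dots> = L (B b) \<bullet> ?D 0 (B b)"
      using YD[of "B b"] DB[OF b] by simp
    also have "\<dots> = deriv2 p 0 (B b) (B b)"
      using nrm by (simp add: L_def inner_add_left iso Hw inner_commute[of "deriv2 \<phi> 0 _ _"])
    finally show "covariant_derivative M (grad M f) ?x b \<bullet> b = deriv2 p 0 (B b) (B b)" .
  qed
  also have "\<dots> = (\<Sum>b\<in>B ` E. deriv2 p 0 b b)"
    by (simp add: sum.reindex[OF injB])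
  also have "\<dots> = (\<Sum>b\<in>Basis. deriv2 p 0 b b)"
  proof (rule trace_orthonormal_basis[OF bilinear_deriv2[OF O zero C2p]])
    show "pairwise orthogonal (B ` E)"
      using E(1) by (auto simp: pairwise_def orthogonal_def BB)
    show "norm b = 1" if "b \<in> B ` E" for b
      using that E(2) by (auto simp: norm_eq_sqrt_inner BB)
    have "span (B ` E) = B ` range (?D 0)"
      using linear_span_image[OF B(1)] E(3) by simp
    also have "\<dots> = UNIV"
      using B(2) by (auto simp: image_image)
    finally show "span (B ` E) = UNIV" .
  qed
  finally show ?thesis
    by (simp add: laplace_beltrami_def p_def)
qed

end

section \<open>The heat kernel of Euclidean space\<close>

text \<open>\<open>lborel_eq\<close> presents Lebesgue measure as an image of a product of
  one-dimensional measures; Gaussian moments thereby reduce to moments of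
  \<open>normal_density\<close>.\<close>

lemma has_bochner_integral_lborel_prod:
  fixes F :: "'c::euclidean_space \<Rightarrow> real \<Rightarrow> real"
  assumes F: "\<And>b. b \<in> Basis \<Longrightarrow> has_bochner_integral lborel (F b) (I b)"
  shows "has_bochner_integral lborel (\<lambda>x. \<Prod>b\<in>Basis. F b (x \<bullet> b)) (\<Prod>b\<in>Basis. I b)"
proof -
  interpret product_sigma_finite "\<lambda>_::'c. lborel :: real measure" ..
  have int: "\<And>b. b \<in> Basis \<Longrightarrow> integrable lborel (F b)"
    using F by (auto simp: has_bochner_integral_iff)
  then have [measurable]: "\<And>b. b \<in> Basis \<Longrightarrow> F b \<in> borel_measurable borel"
    by auto
  have eq: "(\<Prod>b\<in>Basis. F b ((\<Sum>b\<in>Basis. f b *\<^sub>R b) \<bullet> b)) = (\<Prod>b\<in>Basis. F b (f b))" for f :: "'c \<Rightarrow> real"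
    by (intro prod.cong) auto
  have m: "(\<lambda>f. \<Sum>b\<in>Basis. f b *\<^sub>R b) \<in> measurable (\<Pi>\<^sub>M b\<in>Basis. lborel) (borel :: 'c measure)"
    by measurable
  have "integrable lborel (\<lambda>x. \<Prod>b\<in>Basis. F b (x \<bullet> b))"
    by (subst lborel_eq, subst integrable_distr_eq[OF m])
      (simp_all add: eq product_integrable_prod int)
  moreover have "(\<integral>x. (\<Prod>b\<in>Basis. F b (x \<bullet> b)) \<partial>lborel) = (\<Prod>b\<in>Basis. I b)"
    by (subst lborel_eq, subst integral_distr[OF m])
      (simp_all add: eq product_integral_prod int has_bochner_integral_integral_eq[OF F])
  ultimately show ?thesis
    by (simp add: has_bochner_integral_iff)
qed

text \<open>The fundamental solution of the heat equation, without cut-off: independent centred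
  normal coordinates of variance \<open>2 * t\<close>.\<close>

definition heat_kernel :: "real \<Rightarrow> 'c::euclidean_space \<Rightarrow> real" where
  "heat_kernel t h = 1 / (4 * pi * t) powr (real DIM('c) / 2) * exp (- ((norm h)\<^sup>2 / (4 * t)))"

lemma heat_kernel_eq_prod:
  assumes "0 < t"
  shows "heat_kernel t (h :: 'c::euclidean_space) = (\<Prod>b\<in>Basis. normal_density 0 (sqrt (2 * t)) (h \<bullet> b))"
proof -
  have "(\<Prod>b\<in>(Basis :: 'c set). normal_density 0 (sqrt (2 * t)) (h \<bullet> b))
      = (\<Prod>b\<in>(Basis :: 'c set). 1 / sqrt (4 * pi * t) * exp (- (h \<bullet> b)\<^sup>2 / (4 * t)))"
    using assms by (simp add: normal_density_def mult.assoc)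
  also have "\<dots> = (1 / sqrt (4 * pi * t)) ^ DIM('c) * exp (\<Sum>b\<in>(Basis :: 'c set). - (h \<bullet> b)\<^sup>2 / (4 * t))"
    by (simp add: prod.distrib exp_sum prod_dividef power_divide)
  also have "(\<Sum>b\<in>(Basis :: 'c set). - (h \<bullet> b)\<^sup>2 / (4 * t)) = - ((norm h)\<^sup>2 / (4 * t))"
  proof -
    have "(norm h)\<^sup>2 = (\<Sum>b\<in>(Basis :: 'c set). (h \<bullet> b)\<^sup>2)"
      unfolding norm_eq_sqrt_inner by (subst euclidean_inner) (simp add: sum_nonneg power2_eq_square)
    then show ?thesis
      by (simp add: sum_divide_distrib sum_negf)
  qed
  also have "(1 / sqrt (4 * pi * t)) ^ DIM('c) = 1 / (4 * pi * t) powr (real DIM('c) / 2)"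
    using assms by (simp add: powr_half_sqrt[symmetric] power_divide powr_powr powr_realpow[symmetric])
  finally show ?thesis by (simp add: heat_kernel_def)
qed

lemma heat_kernel_nonneg: "0 \<le> heat_kernel t h"
  by (simp add: heat_kernel_def)

context
  fixes t :: real
  assumes t: "0 < t"
begin

lemma normal_density_moments:
  "has_bochner_integral lborel (normal_density 0 (sqrt (2 * t))) 1"
  "has_bochner_integral lborel (\<lambda>x. normal_density 0 (sqrt (2 * t)) x * x) 0"
  "has_bochner_integral lborel (\<lambda>x. normal_density 0 (sqrt (2 * t)) x * (x * x)) (2 * t)"
  using normal_moment_even[of "sqrt (2 * t)" 0 0] normal_moment_odd[of "sqrt (2 * t)" 0 0]
    normal_moment_even[of "sqrt (2 * t)" 0 1] t
  by (simp_all add: power2_eq_square)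

lemma heat_kernel_integral: "has_bochner_integral lborel (heat_kernel t :: 'c::euclidean_space \<Rightarrow> real) 1"
  using has_bochner_integral_lborel_prod[where 'c = 'c and F = "\<lambda>_. normal_density 0 (sqrt (2 * t))" and I = "\<lambda>_. 1"]
    normal_density_moments(1)
  by (simp add: heat_kernel_eq_prod[OF t, abs_def])

lemma heat_kernel_first_moment:
  assumes i: "i \<in> Basis"
  shows "has_bochner_integral lborel (\<lambda>h :: 'c::euclidean_space. heat_kernel t h * (h \<bullet> i)) 0"
proof -
  have "has_bochner_integral lborel
      (\<lambda>h :: 'c. \<Prod>b\<in>Basis. normal_density 0 (sqrt (2 * t)) (h \<bullet> b) * (if b = i then h \<bullet> b else 1))
      (\<Prod>b\<in>Basis. if b = i then 0 else 1)"
    using normal_density_moments by (intro has_bochner_integral_lborel_prod[where F = "\<lambda>b x. normal_density 0 (sqrt (2 * t)) x * (if b = i then x else 1)"]) auto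
  then show ?thesis
    using i by (simp add: prod.distrib heat_kernel_eq_prod[OF t])
qed

lemma heat_kernel_second_moment:
  assumes i: "i \<in> Basis" and j: "j \<in> Basis"
  shows "has_bochner_integral lborel (\<lambda>h :: 'c::euclidean_space. heat_kernel t h * ((h \<bullet> i) * (h \<bullet> j)))
    (if i = j then 2 * t else 0)"
proof -
  \<comment> \<open>The one-dimensional integrals, coordinate by coordinate: for
    \<open>i \<noteq> j\<close> the factors at \<open>i\<close> and \<open>j\<close> are first
    moments and vanish.\<close>
  let ?I = "\<lambda>b. if b = i then if i = j then 2 * t else 0 else if b = j then 0 else 1"
  have "has_bochner_integral lborel
      (\<lambda>h :: 'c. \<Prod>b\<in>Basis. normal_density 0 (sqrt (2 * t)) (h \<bullet> b) * ((if b = i then h \<bullet> b else 1) * (if b = j then h \<bullet> b else 1)))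
      (\<Prod>b\<in>Basis. ?I b)"
    using normal_density_moments
    by (intro has_bochner_integral_lborel_prod[where F = "\<lambda>b x. normal_density 0 (sqrt (2 * t)) x * ((if b = i then x else 1) * (if b = j then x else 1))"]) auto
  moreover have "(\<Prod>b\<in>Basis. ?I b) = (if i = j then 2 * t else 0)"
  proof (cases "i = j")
    case True
    then have "(\<Prod>b\<in>Basis. ?I b) = (\<Prod>b\<in>Basis. if b = i then 2 * t else 1)"
      by (intro prod.cong) auto
    then show ?thesis using i True by simp
  qed (use i in auto)
  ultimately show ?thesis
    using i j by (simp add: prod.distrib heat_kernel_eq_prod[OF t])
qed

lemma heat_kernel_linear:
  assumes "linear l"
  shows "has_bochner_integral lborel (\<lambda>h :: 'c::euclidean_space. heat_kernel t h * l h) (0 :: real)"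
proof -
  have "has_bochner_integral lborel (\<lambda>h :: 'c. \<Sum>i\<in>Basis. heat_kernel t h * (h \<bullet> i) * l i) (\<Sum>i\<in>(Basis :: 'c set). 0 * l i)"
    by (intro has_bochner_integral_sum has_bochner_integral_mult_left heat_kernel_first_moment)
  moreover have "(\<Sum>i\<in>Basis. heat_kernel t h * (h \<bullet> i) * l i) = heat_kernel t h * l h" for h
  proof -
    have "l (\<Sum>i\<in>Basis. (h \<bullet> i) *\<^sub>R i) = (\<Sum>i\<in>Basis. (h \<bullet> i) * l i)"
      by (simp add: linear_sum[OF assms] linear_scale[OF assms])
    then show ?thesis
      by (simp only: euclidean_representation) (simp add: sum_distrib_left mult.assoc)
  qed
  ultimately show ?thesis by simp
qed

lemma heat_kernel_bilinear:
  assumes "bilinear \<beta>"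
  shows "has_bochner_integral lborel (\<lambda>h :: 'c::euclidean_space. heat_kernel t h * \<beta> h h)
    (2 * t * (\<Sum>i\<in>Basis. \<beta> i i) :: real)"
proof -
  have "has_bochner_integral lborel (\<lambda>h :: 'c. \<Sum>i\<in>Basis. \<Sum>j\<in>Basis. heat_kernel t h * ((h \<bullet> i) * (h \<bullet> j)) * \<beta> i j)
    (\<Sum>i\<in>(Basis :: 'c set). \<Sum>j\<in>(Basis :: 'c set). (if i = j then 2 * t else 0) * \<beta> i j)"
    by (intro has_bochner_integral_sum has_bochner_integral_mult_left heat_kernel_second_moment)
  moreover have "(\<Sum>i\<in>Basis. \<Sum>j\<in>Basis. heat_kernel t h * ((h \<bullet> i) * (h \<bullet> j)) * \<beta> i j) = heat_kernel t h * \<beta> h h" for h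
  proof -
    have "\<beta> (\<Sum>i\<in>Basis. (h \<bullet> i) *\<^sub>R i) (\<Sum>j\<in>Basis. (h \<bullet> j) *\<^sub>R j)
      = (\<Sum>(i, j)\<in>Basis \<times> Basis. \<beta> ((h \<bullet> i) *\<^sub>R i) ((h \<bullet> j) *\<^sub>R j))"
      by (rule bilinear_sum[OF assms])
    also have "\<dots> = (\<Sum>i\<in>Basis. \<Sum>j\<in>Basis. (h \<bullet> i) * ((h \<bullet> j) * \<beta> i j))"
      by (simp add: sum.cartesian_product bilinear_lmul[OF assms] bilinear_rmul[OF assms] split_beta mult.left_commute)
    finally show ?thesis
      by (simp only: euclidean_representation) (simp add: sum_distrib_left mult_ac)
  qed
  moreover have "(\<Sum>i\<in>(Basis :: 'c set). \<Sum>j\<in>(Basis :: 'c set). (if i = j then 2 * t else 0) * \<beta> i j) = 2 * t * (\<Sum>i\<in>Basis. \<beta> i i)"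
    by (simp add: if_distrib[of "\<lambda>x. x * _"] sum_distrib_left cong: if_cong)
  ultimately show ?thesis by simp
qed

text \<open>Since \<open>y^m * exp (- y)\<close> is bounded, moments are absorbed by doubling the time.\<close>

lemma heat_kernel_norm2_le:
  "heat_kernel t (h :: 'c::euclidean_space) * (norm h)\<^sup>2 \<le> 2 powr (real DIM('c) / 2) * (8 * t) * heat_kernel (2 * t) h"
  and heat_kernel_norm4_le:
  "heat_kernel t h * (norm h) ^ 4 \<le> 2 powr (real DIM('c) / 2) * (256 * t\<^sup>2) * heat_kernel (2 * t) h"
proof -
  \<comment> \<open>The exponential at time \<open>t\<close> is the square of
    \<open>exp (- y)\<close>: one factor absorbs the powers of \<open>norm h\<close>, the other
    belongs to time \<open>2 * t\<close>, up to the change of normalization by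
    \<open>2 powr (real DIM('c) / 2)\<close>.\<close>
  define y where "y = (norm h)\<^sup>2 / (8 * t)"
  have y: "0 \<le> y" using t by (simp add: y_def)
  let ?N = "1 / (4 * pi * t) powr (real DIM('c) / 2)"
  have H: "heat_kernel t h = ?N * (exp (- y) * exp (- y))"
    by (simp add: heat_kernel_def y_def flip: exp_add)
  have "(4 * pi * (2 * t)) powr (real DIM('c) / 2) = 2 powr (real DIM('c) / 2) * (4 * pi * t) powr (real DIM('c) / 2)"
    using t by (simp add: powr_mult[symmetric] mult_ac)
  then have H2: "2 powr (real DIM('c) / 2) * heat_kernel (2 * t) h = ?N * exp (- y)"
    by (simp add: heat_kernel_def y_def)
  have n2: "(norm h)\<^sup>2 = 8 * t * y" and n4: "(norm h) ^ 4 = 64 * t\<^sup>2 * y\<^sup>2"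
    using t by (simp_all add: y_def power2_eq_square power4_eq_xxxx)
  have e1: "y * exp (- y) \<le> 1"
  proof -
    have "y \<le> exp y"
      using exp_ge_add_one_self[of y] by linarith
    then show ?thesis by (simp add: exp_minus field_simps)
  qed
  have e2: "y\<^sup>2 * exp (- y) \<le> 4"
  proof -
    have "(y / 2)\<^sup>2 \<le> (exp (y / 2))\<^sup>2"
    proof (rule power_mono)
      show "y / 2 \<le> exp (y / 2)"
        using exp_ge_add_one_self[of "y / 2"] by linarith
    qed (use y in simp)
    also have "\<dots> = exp y"
      by (simp add: power2_eq_square flip: exp_add)
    finally show ?thesis by (simp add: exp_minus field_simps)
  qed
  have "heat_kernel t h * (norm h)\<^sup>2 = (?N * exp (- y) * (8 * t)) * (y * exp (- y))"
    by (simp add: H n2)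
  also have "\<dots> \<le> (?N * exp (- y) * (8 * t)) * 1"
    using t by (intro mult_left_mono e1) simp
  also have "\<dots> = 2 powr (real DIM('c) / 2) * (8 * t) * heat_kernel (2 * t) h"
    using H2 by (simp add: mult_ac)
  finally show "heat_kernel t h * (norm h)\<^sup>2 \<le> 2 powr (real DIM('c) / 2) * (8 * t) * heat_kernel (2 * t) h" .
  have "heat_kernel t h * (norm h) ^ 4 = (?N * exp (- y) * (64 * t\<^sup>2)) * (y\<^sup>2 * exp (- y))"
    by (simp add: H n4)
  also have "\<dots> \<le> (?N * exp (- y) * (64 * t\<^sup>2)) * 4"
    by (intro mult_left_mono e2) simp
  also have "\<dots> = 256 * t\<^sup>2 * (?N * exp (- y))"
    by simp
  also have "\<dots> = 2 powr (real DIM('c) / 2) * (256 * t\<^sup>2) * heat_kernel (2 * t) h"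
    unfolding H2[symmetric] by (simp only: mult_ac)
  finally show "heat_kernel t h * (norm h) ^ 4 \<le> 2 powr (real DIM('c) / 2) * (256 * t\<^sup>2) * heat_kernel (2 * t) h" .
qed

end

section \<open>Small-time asymptotics in a chart\<close>

text \<open>With \<open>q h\<close>, \<open>\<rho> h\<close> and \<open>p h\<close> standing for \<open>(norm (\<phi> h - x))\<^sup>2\<close>, the volume density and
  \<open>f x - f (\<phi> h)\<close> in a normal parametrization \<open>\<phi>\<close>. The constant in front of \<open>e\<close> must not depend on \<open>d\<close>.\<close>

lemma heat_kernel_perturbation:
  fixes q \<rho> p :: "'c::euclidean_space \<Rightarrow> real" and l \<beta>
  assumes d: "0 < d" and e: "0 \<le> e" and C: "0 \<le> C"
    and l: "linear l" and \<beta>: "bilinear \<beta>"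
    and cont: "continuous_on (ball 0 d) q" "continuous_on (ball 0 d) \<rho>" "continuous_on (ball 0 d) p"
    and q: "\<And>h. norm h < d \<Longrightarrow> \<bar>q h - (norm h)\<^sup>2\<bar> \<le> e * norm h ^ 3" "\<And>h. norm h < d \<Longrightarrow> (norm h)\<^sup>2 / 2 \<le> q h"
    and \<rho>: "\<And>h. norm h < d \<Longrightarrow> \<bar>\<rho> h - 1\<bar> \<le> e * norm h" "\<And>h. norm h < d \<Longrightarrow> \<bar>\<rho> h\<bar> \<le> 2"
    and p: "\<And>h. norm h < d \<Longrightarrow> \<bar>p h\<bar> \<le> C * norm h" "\<And>h. norm h < d \<Longrightarrow> \<bar>p h + l h + \<beta> h h / 2\<bar> \<le> e * (norm h)\<^sup>2"
  shows "\<exists>C2. \<forall>t>0. \<bar>(\<integral>h. indicator (ball 0 d) h *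
      (1 / (4 * pi * t) powr (real DIM('c) / 2) * exp (- (q h / (4 * t))) * p h * \<rho> h) \<partial>lborel)
      + t * (\<Sum>b\<in>Basis. \<beta> b b)\<bar> \<le> e * (2 powr real DIM('c) * (528 * C + 16)) * t + C2 * t\<^sup>2"
proof -
  \<comment> \<open>\<open>\<kappa>\<close> is the price of doubling the time once. The estimate on
    the ball doubles twice, once for the comparison with \<open>G\<close> and once for the moments,
    hence \<open>\<kappa> * \<kappa>\<close>.\<close>
  define \<kappa> where "\<kappa> = 2 powr (real DIM('c) / 2)"
  have \<kappa>: "0 < \<kappa>" "\<kappa> * \<kappa> = 2 powr real DIM('c)"
    by (simp_all add: \<kappa>_def flip: powr_add)
  obtain L where L: "0 < L" "\<And>h. \<bar>l h\<bar> \<le> L * norm h"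
    using linear_bounded_pos[OF l] by auto
  obtain N where N: "0 < N" "\<And>h k. \<bar>\<beta> h k\<bar> \<le> N * norm h * norm k"
    using bilinear_bounded_pos[OF \<beta>] by auto
  \<comment> \<open>Outside the ball \<open>norm h\<close> and its square are at most
    \<open>norm h ^ 4\<close> divided by \<open>d ^ 3\<close> and \<open>d\<^sup>2\<close>, so the
    missing tail costs a fourth moment, of order \<open>t\<^sup>2\<close>.\<close>
  define C2 where "C2 = (L / d ^ 3 + N / d\<^sup>2) * \<kappa> * 256"
  have "\<bar>(\<integral>h. indicator (ball 0 d) h *
      (1 / (4 * pi * t) powr (real DIM('c) / 2) * exp (- (q h / (4 * t))) * p h * \<rho> h) \<partial>lborel)
      + t * (\<Sum>b\<in>Basis. \<beta> b b)\<bar> \<le> e * (2 powr real DIM('c) * (528 * C + 16)) * t + C2 * t\<^sup>2"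
    if t: "0 < t" for t
  proof -
    define n where "n = 1 / (4 * pi * t) powr (real DIM('c) / 2)"
    have n: "0 \<le> n" by (simp add: n_def)
    define X where "X h = indicator (ball 0 d) h * (n * exp (- (q h / (4 * t))) * p h * \<rho> h)" for h
    define Y where "Y h = heat_kernel t h * (- l h - \<beta> h h / 2)" for h
    \<comment> \<open>Since \<open>q h\<close> is at least half of the squared norm,
      \<open>G\<close> with its halved exponent dominates both the curved and the flat Gaussian on
      the ball.\<close>
    define G where "G h = n * exp (- ((norm h)\<^sup>2 / (8 * t)))" for h :: 'c
    have G: "G h = \<kappa> * heat_kernel (2 * t) h" for h
    proof -
      have "(4 * pi * (2 * t)) powr (real DIM('c) / 2) = \<kappa> * (4 * pi * t) powr (real DIM('c) / 2)"
        using t unfolding \<kappa>_def by (simp add: powr_mult[symmetric] mult_ac)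
      then show ?thesis
        using \<kappa> by (simp add: heat_kernel_def G_def n_def)
    qed
    have G0: "0 \<le> G h" for h
      by (simp add: G_def n)
    have HG: "heat_kernel t h \<le> G h" for h :: 'c
      unfolding G_def heat_kernel_def n_def using t by (intro mult_left_mono) (auto simp: field_simps)
    \<comment> \<open>Fourth and second moments at time \<open>2 * t\<close> give
      \<open>512 * C\<close> and \<open>16 * (C + 1)\<close>, together
      \<open>528 * C + 16\<close>.\<close>
    define bound where "bound h = e * (2 powr real DIM('c) * (528 * C + 16)) * t * heat_kernel (2 * (2 * t)) h
      + C2 * t\<^sup>2 * heat_kernel (2 * t) h" for h :: 'c
    have hk: "has_bochner_integral lborel (heat_kernel s :: 'c \<Rightarrow> real) 1" if "0 < s" for s
      by (rule heat_kernel_integral[OF that])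
    have bound: "has_bochner_integral lborel bound (e * (2 powr real DIM('c) * (528 * C + 16)) * t * 1 + C2 * t\<^sup>2 * 1)"
      unfolding bound_def using t by (intro has_bochner_integral_add has_bochner_integral_mult_right hk) auto
    have Y: "has_bochner_integral lborel Y (- t * (\<Sum>b\<in>Basis. \<beta> b b))"
    proof -
      have "has_bochner_integral lborel (\<lambda>h. heat_kernel t h * l h * (- 1) + heat_kernel t h * \<beta> h h * (- 1 / 2))
        (0 * (- 1) + 2 * t * (\<Sum>b\<in>Basis. \<beta> b b) * (- 1 / 2))"
        by (intro has_bochner_integral_add has_bochner_integral_mult_left heat_kernel_linear heat_kernel_bilinear t l \<beta>)
      then show ?thesis
        by (simp add: Y_def[abs_def] algebra_simps)
    qed
    have cX: "continuous_on (ball 0 d) (\<lambda>h. n * exp (- (q h / (4 * t))) * p h * \<rho> h)"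
      using cont t by (intro continuous_intros) auto
    have X: "X \<in> borel_measurable borel"
      using borel_measurable_continuous_on_indicator[OF _ cX] by (simp add: X_def[abs_def])
    have main: "norm (X h - Y h) \<le> bound h" for h
    proof (cases "norm h < d")
      case True
      let ?r = "norm h"
      define E where "E = exp (- (q h / (4 * t)))"
      define E0 where "E0 = exp (- (?r\<^sup>2 / (4 * t)))"
      define E1 where "E1 = exp (- (?r\<^sup>2 / (8 * t)))"
      have hkE: "heat_kernel t h = n * E0"
        by (simp add: heat_kernel_def n_def E0_def)
      have "\<bar>exp a - exp b\<bar> \<le> exp c * \<bar>a - b\<bar>" if "a \<le> c" "b \<le> c" for a b c :: real
      proof -
        have *: "exp v - exp u \<le> exp c * (v - u)" if "u \<le> v" "v \<le> c" for u v :: real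
        proof -
          have "1 - exp (u - v) \<le> v - u"
            using exp_ge_add_one_self[of "u - v"] by linarith
          then have "exp v * (1 - exp (u - v)) \<le> exp v * (v - u)"
            by (intro mult_left_mono) auto
          also have "\<dots> \<le> exp c * (v - u)"
            using that by (intro mult_right_mono) auto
          finally show ?thesis by (simp add: right_diff_distrib flip: exp_add)
        qed
        then show ?thesis
          using that *[of a b] *[of b a] by (cases "a \<le> b") auto
      qed
      moreover have "?r\<^sup>2 / (8 * t) \<le> ?r\<^sup>2 / (4 * t)" "?r\<^sup>2 / (8 * t) \<le> q h / (4 * t)"
        using q(2)[OF True] t by (auto simp: field_simps)
      ultimately have "\<bar>E - E0\<bar> \<le> E1 * \<bar>- (q h / (4 * t)) - - (?r\<^sup>2 / (4 * t))\<bar>"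
        unfolding E_def E0_def E1_def by (metis neg_le_iff_le)
      also have "\<bar>- (q h / (4 * t)) - - (?r\<^sup>2 / (4 * t))\<bar> = \<bar>q h - ?r\<^sup>2\<bar> / (4 * t)"
        using t by (simp add: diff_divide_distrib[symmetric] abs_minus_commute)
      also have "E1 * \<dots> \<le> E1 * (e * ?r ^ 3 / (4 * t))"
        using t q(1)[OF True] by (intro mult_left_mono divide_right_mono) (auto simp: E1_def)
      finally have EE0: "\<bar>E - E0\<bar> \<le> E1 * (e * ?r ^ 3 / (4 * t))" .
      have Xh: "X h = n * E * p h * \<rho> h"
        using True by (simp add: X_def E_def)
      \<comment> \<open>Three replacements with one error each: the distance in the exponent, the
        volume density, and the Taylor polynomial of \<open>p\<close>.\<close>
      have XY: "X h - Y h = n * ((E - E0) * p h * \<rho> h + E0 * p h * (\<rho> h - 1) + E0 * (p h + l h + \<beta> h h / 2))"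
        unfolding Xh Y_def hkE by (simp add: algebra_simps)
      have 1: "\<bar>(E - E0) * p h * \<rho> h\<bar> \<le> E1 * (e * ?r ^ 3 / (4 * t)) * (C * ?r) * 2"
        unfolding abs_mult using EE0 p(1)[OF True] \<rho>(2)[OF True] C t e
        by (intro mult_mono) (auto simp: E1_def)
      have 2: "\<bar>E0 * p h * (\<rho> h - 1)\<bar> \<le> E0 * (C * ?r) * (e * ?r)"
        unfolding abs_mult using p(1)[OF True] \<rho>(1)[OF True] C e
        by (intro mult_mono) (auto simp: E0_def)
      have 3: "\<bar>E0 * (p h + l h + \<beta> h h / 2)\<bar> \<le> E0 * (e * ?r\<^sup>2)"
        unfolding abs_mult using p(2)[OF True] by (intro mult_mono) (auto simp: E0_def)
      have "norm (X h - Y h) \<le> n * (E1 * (e * ?r ^ 3 / (4 * t)) * (C * ?r) * 2 + E0 * (C * ?r) * (e * ?r) + E0 * (e * ?r\<^sup>2))"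
      proof -
        have "\<bar>(E - E0) * p h * \<rho> h + E0 * p h * (\<rho> h - 1) + E0 * (p h + l h + \<beta> h h / 2)\<bar>
          \<le> E1 * (e * ?r ^ 3 / (4 * t)) * (C * ?r) * 2 + E0 * (C * ?r) * (e * ?r) + E0 * (e * ?r\<^sup>2)"
          using 1 2 3 by linarith
        from mult_left_mono[OF this n] show ?thesis
          unfolding XY real_norm_def abs_mult[of n] using n by simp
      qed
      also have "\<dots> = (n * E1) * ?r ^ 4 * (e * C / (2 * t)) + heat_kernel t h * ?r\<^sup>2 * (e * (C + 1))"
        using t unfolding hkE by (simp add: power2_eq_square power3_eq_cube power4_eq_xxxx field_simps)
      also have "\<dots> \<le> G h * ?r ^ 4 * (e * C / (2 * t)) + G h * ?r\<^sup>2 * (e * (C + 1))"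
        using HG[of h] e C t by (intro add_mono mult_right_mono) (auto simp: G_def E1_def)
      also have "\<dots> = \<kappa> * (heat_kernel (2 * t) h * ?r ^ 4) * (e * C / (2 * t)) + \<kappa> * (heat_kernel (2 * t) h * ?r\<^sup>2) * (e * (C + 1))"
        by (simp add: G)
      also have "\<dots> \<le> \<kappa> * (\<kappa> * (256 * (2 * t)\<^sup>2) * heat_kernel (2 * (2 * t)) h) * (e * C / (2 * t))
          + \<kappa> * (\<kappa> * (8 * (2 * t)) * heat_kernel (2 * (2 * t)) h) * (e * (C + 1))"
        using heat_kernel_norm4_le[of "2 * t" h] heat_kernel_norm2_le[of "2 * t" h] t e C \<kappa>(1)
        unfolding \<kappa>_def[symmetric] by (intro add_mono mult_right_mono mult_left_mono) auto
      also have "\<dots> = e * ((\<kappa> * \<kappa>) * (528 * C + 16)) * t * heat_kernel (2 * (2 * t)) h"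
        using t by (simp add: power2_eq_square field_simps)
      also have "\<dots> \<le> bound h"
        unfolding bound_def \<kappa>(2) C2_def using L N d \<kappa>(1)
        by (simp add: heat_kernel_nonneg)
      finally show ?thesis .
    next
      case False
      then have r: "d \<le> norm h" by simp
      let ?r = "norm h"
      have "\<bar>- l h - \<beta> h h / 2\<bar> \<le> \<bar>l h\<bar> + \<bar>\<beta> h h\<bar>"
        by linarith
      also have "\<dots> \<le> L * ?r + N * ?r\<^sup>2"
        using L(2)[of h] N(2)[of h h] by (simp add: power2_eq_square)
      also have "\<dots> \<le> L * (?r ^ 4 / d ^ 3) + N * (?r ^ 4 / d\<^sup>2)"
      proof (intro add_mono mult_left_mono)
        have "?r * d ^ 3 \<le> ?r * ?r ^ 3"
          using r d by (intro mult_left_mono power_mono) auto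
        then show "?r \<le> ?r ^ 4 / d ^ 3"
          using d by (simp add: pos_le_divide_eq power4_eq_xxxx power3_eq_cube)
        have "?r\<^sup>2 * d\<^sup>2 \<le> ?r\<^sup>2 * ?r\<^sup>2"
          using r d by (intro mult_left_mono power_mono) auto
        then show "?r\<^sup>2 \<le> ?r ^ 4 / d\<^sup>2"
          using d by (simp add: pos_le_divide_eq power4_eq_xxxx power2_eq_square)
      qed (use L N in auto)
      finally have lb: "\<bar>- l h - \<beta> h h / 2\<bar> \<le> (L / d ^ 3 + N / d\<^sup>2) * ?r ^ 4"
        by (simp add: algebra_simps)
      have "norm (X h - Y h) = heat_kernel t h * \<bar>- l h - \<beta> h h / 2\<bar>"
        using False by (simp add: X_def Y_def abs_mult heat_kernel_nonneg abs_minus_commute)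
      also have "\<dots> \<le> heat_kernel t h * ((L / d ^ 3 + N / d\<^sup>2) * ?r ^ 4)"
        by (intro mult_left_mono lb heat_kernel_nonneg)
      also have "\<dots> = (L / d ^ 3 + N / d\<^sup>2) * (heat_kernel t h * ?r ^ 4)"
        by simp
      also have "\<dots> \<le> (L / d ^ 3 + N / d\<^sup>2) * (\<kappa> * (256 * t\<^sup>2) * heat_kernel (2 * t) h)"
        unfolding \<kappa>_def using L N d by (intro mult_left_mono heat_kernel_norm4_le t) auto
      also have "\<dots> = C2 * t\<^sup>2 * heat_kernel (2 * t) h"
        by (simp add: C2_def)
      also have "\<dots> \<le> bound h"
        unfolding bound_def using e C t by (simp add: heat_kernel_nonneg)
      finally show ?thesis .
    qed
    have intY: "integrable lborel Y" "(\<integral>h. Y h \<partial>lborel) = - t * (\<Sum>b\<in>Basis. \<beta> b b)"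
      and intb: "integrable lborel bound"
      "(\<integral>h. bound h \<partial>lborel) = e * (2 powr real DIM('c) * (528 * C + 16)) * t + C2 * t\<^sup>2"
      using Y bound by (simp_all add: has_bochner_integral_iff)
    have intXY: "integrable lborel (\<lambda>h. X h - Y h)"
    proof (rule Bochner_Integration.integrable_bound[OF intb(1)])
      show "(\<lambda>h. X h - Y h) \<in> borel_measurable lborel"
        using X borel_measurable_integrable[OF intY(1)] by (intro borel_measurable_diff) auto
      show "AE h in lborel. norm (X h - Y h) \<le> norm (bound h)"
        using order_trans[OF main abs_ge_self] by (intro AE_I2) simp
    qed
    have "(\<integral>h. X h \<partial>lborel) = (\<integral>h. (X h - Y h) + Y h \<partial>lborel)"
      by simp
    also have "\<dots> = (\<integral>h. X h - Y h \<partial>lborel) - t * (\<Sum>b\<in>Basis. \<beta> b b)"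
      by (subst Bochner_Integration.integral_add[OF intXY intY(1)]) (simp add: intY(2))
    finally have "(\<integral>h. X h \<partial>lborel) + t * (\<Sum>b\<in>Basis. \<beta> b b) = (\<integral>h. X h - Y h \<partial>lborel)"
      by simp
    also have "\<bar>\<dots>\<bar> \<le> (\<integral>h. bound h \<partial>lborel)"
      using Bochner_Integration.integral_norm_bound_integral[OF intXY intb(1)] main by simp
    finally show ?thesis
      unfolding intb(2) X_def n_def .
  qed
  then show ?thesis by blast
qed

section \<open>Volume density and squared distance in normal coordinates\<close>

lemma volume_density_continuous_on:
  assumes "local_parametrization M U \<phi>"
  shows "continuous_on U (volume_density \<phi>)"
proof -
  have "continuous_on U (\<lambda>u. frechet_derivative \<phi> (at u) v)" for v
    using assms smooth_on_derivative[of U \<phi> v] unfolding local_parametrization_def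
    by (blast intro: smooth_on_imp_continuous_on)
  then show ?thesis
    unfolding volume_density_def[abs_def] det_def
    by (auto intro!: continuous_intros)
qed

lemma lower_order_has_derivative_zero:
  fixes g :: "'c::real_normed_vector \<Rightarrow> 'b::real_normed_vector"
  assumes "\<And>e. 0 < e \<Longrightarrow> \<exists>d>0. \<forall>u. norm u < d \<longrightarrow> norm (g u - c) \<le> e * norm u" and "g 0 = c"
  shows "(g has_derivative (\<lambda>_. 0)) (at 0)"
  unfolding has_derivative_at_alt using assms by simp

context
  fixes M :: "'a::euclidean_space set" and U and \<phi> :: "real^'k::finite \<Rightarrow> 'a"
  assumes lp: "local_parametrization M U \<phi>" and zero: "0 \<in> U"
    and iso: "\<And>v w. frechet_derivative \<phi> (at 0) v \<bullet> frechet_derivative \<phi> (at 0) w = v \<bullet> w"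
    and nrm: "\<And>z v w. frechet_derivative \<phi> (at 0) z \<bullet> deriv2 \<phi> 0 v w = 0"
begin

text \<open>The determinant is differentiated through its expansion over permutations; every product
  rule term contains the derivative of a metric entry, and these all vanish at 0.\<close>

lemma volume_density_normal: "volume_density \<phi> 0 = 1"
  "(volume_density \<phi> has_derivative (\<lambda>_. 0)) (at 0)"
proof -
  have U: "open U" "0 \<in> U" "Ck_on 2 \<phi> U"
    using lp zero by (auto simp: local_parametrization_def smooth_on_def)
  define g where "g i j u = frechet_derivative \<phi> (at u) (axis i 1) \<bullet> frechet_derivative \<phi> (at u) (axis j (1::real))"
    for i j :: 'k and u
  have g0: "g i j 0 = (if i = j then 1 else 0)" for i j
    by (simp add: g_def iso inner_axis_axis)
  have g': "(g i j has_derivative (\<lambda>_. 0)) (at 0)" for i j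
  proof (rule lower_order_has_derivative_zero[OF _ refl])
    fix e :: real assume "0 < e"
    then obtain d where d: "0 < d" "\<And>u v w. norm u < d \<Longrightarrow>
      \<bar>frechet_derivative \<phi> (at u) v \<bullet> frechet_derivative \<phi> (at u) w - v \<bullet> w\<bar> \<le> e * norm u * norm v * norm w"
      using metric_expansion[OF U iso nrm] by blast
    then have "\<forall>u. norm u < d \<longrightarrow> norm (g i j u - g i j 0) \<le> e * norm u"
      using d(2)[of _ "axis i 1" "axis j 1"] by (simp add: g_def iso)
    then show "\<exists>d>0. \<forall>u. norm u < d \<longrightarrow> norm (g i j u - g i j 0) \<le> e * norm u"
      using d(1) by blast
  qed
  have vd: "volume_density \<phi> = (\<lambda>u. sqrt (det (\<chi> i j. g i j u)))"
    by (simp add: volume_density_def[abs_def] g_def)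
  have "((\<lambda>u. \<Sum>\<pi>\<in>{\<pi>. \<pi> permutes (UNIV :: 'k set)}. of_int (sign \<pi>) * (\<Prod>i\<in>UNIV. g i (\<pi> i) u)) has_derivative
    (\<lambda>v. \<Sum>\<pi>\<in>{\<pi>. \<pi> permutes (UNIV :: 'k set)}. of_int (sign \<pi>) * (\<Sum>i\<in>UNIV. 0 * (\<Prod>j\<in>UNIV - {i}. g j (\<pi> j) 0)))) (at 0)"
    by (intro has_derivative_sum has_derivative_mult_right has_derivative_prod g')
  then have det: "((\<lambda>u. det (\<chi> i j. g i j u)) has_derivative (\<lambda>_. 0)) (at 0)"
    by (simp add: det_def)
  have "(\<chi> i j. g i j 0) = mat 1"
    by (simp add: g0 mat_def)
  then have det0: "det (\<chi> i j. g i j 0) = 1"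
    by simp
  then show "volume_density \<phi> 0 = 1"
    by (simp add: vd)
  show "(volume_density \<phi> has_derivative (\<lambda>_. 0)) (at 0)"
    using has_derivative_real_sqrt[OF _ det] by (simp add: vd det0)
qed

text \<open>The cubic term is an inner product of the first with the second derivative and vanishes
  by normality. What is left is the Taylor remainder \<open>E\<close> against the linear part, and
  the square of \<open>X\<close>, of fourth order.\<close>

lemma squared_distance_expansion:
  assumes "0 < e"
  shows "\<exists>d>0. ball 0 d \<subseteq> U \<and> (\<forall>h. norm h < d \<longrightarrow> \<bar>(norm (\<phi> h - \<phi> 0))\<^sup>2 - (norm h)\<^sup>2\<bar> \<le> e * norm h ^ 3)"
proof -
  have U: "open U" "0 \<in> U" "Ck_on 2 \<phi> U"
    using lp zero by (auto simp: local_parametrization_def smooth_on_def)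
  let ?D = "frechet_derivative \<phi> (at 0)"
  have niso: "norm (?D v) = norm v" for v
    by (simp add: norm_eq_sqrt_inner iso)
  obtain K where K: "0 < K" "\<And>h v. norm (deriv2 \<phi> 0 h v) \<le> norm h * norm v * K"
    using bounded_bilinear.pos_bounded bilinear_deriv2[OF U] bilinear_conv_bounded_bilinear by metis
  obtain d0 where d0: "0 < d0" "ball 0 d0 \<subseteq> U" "\<And>h. norm h < d0 \<Longrightarrow>
      norm (\<phi> (0 + h) - \<phi> 0 - ?D h - (1/2) *\<^sub>R deriv2 \<phi> 0 h h) \<le> e / 4 * (norm h)\<^sup>2"
    using second_order_Taylor[OF U, of "e / 4"] assms by auto
  define d where "d = min d0 (e / (2 * (K + e / 4)\<^sup>2))"
  have dpos: "0 < d"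
    using d0 assms K by (simp add: d_def add_pos_pos)
  have "\<bar>(norm (\<phi> h - \<phi> 0))\<^sup>2 - (norm h)\<^sup>2\<bar> \<le> e * norm h ^ 3" if h: "norm h < d" for h
  proof -
    define E where "E = \<phi> h - \<phi> 0 - ?D h - (1/2) *\<^sub>R deriv2 \<phi> 0 h h"
    define X where "X = (1/2) *\<^sub>R deriv2 \<phi> 0 h h + E"
    have E: "norm E \<le> e / 4 * (norm h)\<^sup>2"
      using d0(3)[of h] h by (simp add: E_def d_def)
    have "norm X \<le> norm (deriv2 \<phi> 0 h h) / 2 + norm E"
      using norm_triangle_ineq[of "(1/2) *\<^sub>R deriv2 \<phi> 0 h h" E] by (simp add: X_def)
    also have "\<dots> \<le> (K + e / 4) * (norm h)\<^sup>2"
    proof -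
      have "norm (deriv2 \<phi> 0 h h) \<le> K * (norm h)\<^sup>2"
        using K(2)[of h h] by (simp add: power2_eq_square mult_ac)
      then show ?thesis
        unfolding distrib_right using E norm_ge_zero[of "deriv2 \<phi> 0 h h"] by linarith
    qed
    finally have X: "norm X \<le> (K + e / 4) * (norm h)\<^sup>2" .
    have "\<phi> h - \<phi> 0 = ?D h + X"
      by (simp add: X_def E_def)
    moreover have "?D h \<bullet> X = ?D h \<bullet> E"
      by (simp add: X_def inner_add_right nrm)
    ultimately have eq: "(norm (\<phi> h - \<phi> 0))\<^sup>2 - (norm h)\<^sup>2 = 2 * (?D h \<bullet> E) + (norm X)\<^sup>2"
      using dot_norm[of "?D h" X] by (simp add: niso)
    have "\<bar>?D h \<bullet> E\<bar> \<le> norm h * (e / 4 * (norm h)\<^sup>2)"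
      using Cauchy_Schwarz_ineq2[of "?D h" E] mult_left_mono[OF E norm_ge_zero[of h]] by (simp add: niso)
    moreover have "(norm X)\<^sup>2 \<le> e / 2 * norm h ^ 3"
    proof -
      have "(norm X)\<^sup>2 \<le> ((K + e / 4) * (norm h)\<^sup>2)\<^sup>2"
        using X by (intro power_mono) auto
      also have "\<dots> = ((K + e / 4)\<^sup>2 * norm h) * norm h ^ 3"
        by (simp add: power2_eq_square power3_eq_cube)
      also have "\<dots> \<le> e / 2 * norm h ^ 3"
      proof (rule mult_right_mono)
        have "0 < (K + e / 4)\<^sup>2"
          using K assms by (simp add: add_pos_pos)
        then show "(K + e / 4)\<^sup>2 * norm h \<le> e / 2"
          using h by (simp add: d_def field_simps)
      qed simp
      finally show ?thesis .
    qed
    moreover have "norm h * (e / 4 * (norm h)\<^sup>2) = e / 4 * norm h ^ 3"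
      by (simp add: power2_eq_square power3_eq_cube)
    ultimately show ?thesis
      unfolding eq using zero_le_power2[of "norm X"] by linarith
  qed
  then show ?thesis
    using dpos d0(2) by (intro exI[of _ d]) (auto simp: d_def)
qed

end

section \<open>Integration against the Riemannian volume in a chart\<close>

lemma riemannian_volume_restrict_eq_distr:
  fixes M :: "'a::euclidean_space set" and \<phi> :: "real^'k::finite \<Rightarrow> 'a"
  assumes V: "riemannian_volume TYPE('k) M V" and lp: "local_parametrization M S \<phi>"
  shows "restrict_space V (\<phi> ` S) = distr (density (restrict_space lborel S) (\<lambda>u. ennreal (volume_density \<phi> u)))
      (restrict_space V (\<phi> ` S)) \<phi>" (is "?R = distr ?D _ _")
    and "\<phi> ` S \<in> sets V"
    and "\<phi> \<in> measurable (restrict_space lborel S) (restrict_space V (\<phi> ` S))"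
proof -
  have S: "open S" "\<phi> ` S \<subseteq> M" "openin (top_of_set M) (\<phi> ` S)"
    using lp by (auto simp: local_parametrization_def)
  have sV: "sets V = sets (restrict_space borel M)"
    using V by (simp add: riemannian_volume_def)
  obtain T where T: "open T" "\<phi> ` S = M \<inter> T"
    using S(3) by (auto simp: openin_open)
  then show NV: "\<phi> ` S \<in> sets V"
    by (auto simp: sV sets_restrict_space)
  have cont: "continuous_on S \<phi>"
    using lp by (auto simp: local_parametrization_def intro: smooth_on_imp_continuous_on)
  have "sets (restrict_space V (\<phi> ` S)) = sets (restrict_space (restrict_space borel M) (\<phi> ` S))"
    using sV by (simp add: sets_restrict_space)
  also have "\<dots> = sets (restrict_space borel (\<phi> ` S))"
    using S(2) by (auto simp: sets_restrict_space image_image intro!: image_cong)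
  finally have sR: "sets (restrict_space V (\<phi> ` S)) = sets (restrict_space borel (\<phi> ` S))" .
  have "\<phi> \<in> measurable (restrict_space borel S) (restrict_space borel (\<phi> ` S))"
    using borel_measurable_continuous_on_restrict[OF cont]
    by (intro measurable_restrict_space2) (auto simp: space_restrict_space)
  then show \<phi>m: "\<phi> \<in> measurable (restrict_space lborel S) (restrict_space V (\<phi> ` S))"
    by (subst measurable_cong_sets[OF _ sR, of _ "restrict_space borel S"]) (auto simp: sets_restrict_space)
  have vdm: "(\<lambda>u. ennreal (volume_density \<phi> u)) \<in> borel_measurable (restrict_space lborel S)"
  proof -
    have "volume_density \<phi> \<in> borel_measurable (restrict_space borel S)"
      by (rule borel_measurable_continuous_on_restrict[OF volume_density_continuous_on[OF lp]])
    then have "(\<lambda>u. ennreal (volume_density \<phi> u)) \<in> borel_measurable (restrict_space borel S)"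
      by measurable
    then show ?thesis
      by (subst measurable_cong_sets[OF _ refl, of _ "restrict_space borel S"]) (auto simp: sets_restrict_space)
  qed
  \<comment> \<open>Every measurable set here lies in the chart image, which is exactly where
    \<open>riemannian_volume\<close> prescribes the measure.\<close>
  show "?R = distr ?D ?R \<phi>"
  proof (rule measure_eqI)
    fix A assume A: "A \<in> sets ?R"
    then have AS: "A \<subseteq> \<phi> ` S" and AV: "A \<in> sets V"
      using NV by (auto simp: sets_restrict_space_iff)
    have "emeasure (distr ?D ?R \<phi>) A = emeasure ?D (\<phi> -` A \<inter> S)"
      using A \<phi>m by (subst emeasure_distr) (auto simp: space_restrict_space)
    also have "\<dots> = (\<integral>\<^sup>+u\<in>\<phi> -` A \<inter> S. ennreal (volume_density \<phi> u) \<partial>restrict_space lborel S)"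
      using measurable_sets[OF \<phi>m A] by (intro emeasure_density vdm) (simp add: space_restrict_space)
    also have "\<dots> = (\<integral>\<^sup>+u. ennreal (volume_density \<phi> u) * indicator (\<phi> -` A \<inter> S) u * indicator S u \<partial>lborel)"
      using S(1) by (subst nn_integral_restrict_space) (auto intro: borel_open)
    also have "\<dots> = (\<integral>\<^sup>+u\<in>S \<inter> \<phi> -` A. ennreal (volume_density \<phi> u) \<partial>lborel)"
      by (intro nn_integral_cong) (auto simp: indicator_def)
    also have "\<dots> = emeasure V A"
      using V lp AS AV unfolding riemannian_volume_def by simp
    also have "\<dots> = emeasure ?R A"
      using AS NV by (subst emeasure_restrict_space) (auto simp: sets.Int_space_eq2)
    finally show "emeasure ?R A = emeasure (distr ?D ?R \<phi>) A" by simp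
  qed simp
qed

text \<open>The image measure turns the prescribed values on sets into a change of variables for
  integrals. Nonnegativity of the density is assumed; in normal coordinates it holds near 0 because
  the density is close to 1.\<close>

lemma integral_riemannian_volume_param:
  fixes M :: "'a::euclidean_space set" and \<phi> :: "real^'k::finite \<Rightarrow> 'a" and h :: "'a \<Rightarrow> real"
  assumes V: "riemannian_volume TYPE('k) M V" and lp: "local_parametrization M S \<phi>"
    and nonneg: "\<And>u. u \<in> S \<Longrightarrow> 0 \<le> volume_density \<phi> u"
    and h: "h \<in> borel_measurable V"
  shows "(\<integral>y. indicator (\<phi> ` S) y * h y \<partial>V) = (\<integral>u. indicator S u * (h (\<phi> u) * volume_density \<phi> u) \<partial>lborel)"
proof -
  note D = riemannian_volume_restrict_eq_distr[OF V lp]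
  let ?S = "restrict_space lborel S" and ?D = "density (restrict_space lborel S) (\<lambda>u. ennreal (volume_density \<phi> u))"
  have S: "open S" using lp by (auto simp: local_parametrization_def)
  have hR: "h \<in> borel_measurable (restrict_space V (\<phi> ` S))"
    by (rule measurable_restrict_space1[OF h])
  have vdm: "volume_density \<phi> \<in> borel_measurable ?S"
    using borel_measurable_continuous_on_restrict[OF volume_density_continuous_on[OF lp]]
    by (subst measurable_cong_sets[OF _ refl, of _ "restrict_space borel S"]) (auto simp: sets_restrict_space)
  have "(\<integral>y. indicator (\<phi> ` S) y * h y \<partial>V) = (\<integral>y. h y \<partial>restrict_space V (\<phi> ` S))"
    using D(2) by (subst integral_restrict_space) (auto simp: set_lebesgue_integral_def sets.Int_space_eq2)
  also have "\<dots> = (\<integral>y. h y \<partial>distr ?D (restrict_space V (\<phi> ` S)) \<phi>)"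
    using D(1) by simp
  also have "\<dots> = (\<integral>u. h (\<phi> u) \<partial>?D)"
    using D(3) hR by (intro integral_distr) simp_all
  also have "\<dots> = (\<integral>u. volume_density \<phi> u *\<^sub>R h (\<phi> u) \<partial>?S)"
    using nonneg measurable_compose[OF D(3) hR] vdm
    by (intro integral_density) (auto simp: space_restrict_space intro!: AE_I2)
  also have "\<dots> = (\<integral>u. indicator S u * (h (\<phi> u) * volume_density \<phi> u) \<partial>lborel)"
    using S by (subst integral_restrict_space) (auto simp: set_lebesgue_integral_def mult.commute borel_open)
  finally show ?thesis .
qed

section \<open>The limit of the expectation\<close>

lemma smooth_on_submanifold_imp_continuous_on:
  assumes "smooth_on_submanifold M f"
  shows "continuous_on M f"
  unfolding continuous_on_eq_continuous_within
proof
  fix p assume p: "p \<in> M"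
  obtain W F where W: "open W" "p \<in> W" "smooth_on W F" "\<forall>q\<in>W \<inter> M. F q = f q"
    using assms[unfolded smooth_on_submanifold_def, rule_format, OF p] by blast
  have "continuous_on (W \<inter> M) f"
    by (rule continuous_on_eq[OF continuous_on_subset[OF smooth_on_imp_continuous_on[OF W(3)]]])
      (use W(4) in auto)
  then have "continuous (at p within W \<inter> M) f"
    using p W(2) by (simp add: continuous_on_eq_continuous_within)
  moreover have "at p within W \<inter> M = at p within M"
    using W by (intro at_within_nhd[of _ W]) auto
  ultimately show "continuous (at p within M) f"
    by (simp add: continuous_within)
qed

lemma gauss_kernel_measurable [measurable]: "gauss_kernel k \<epsilon> t x \<in> borel_measurable borel"
  unfolding gauss_kernel_def[abs_def] by measurable

lemma gauss_kernel_nonneg: "0 \<le> gauss_kernel k \<epsilon> t x y"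
  by (simp add: gauss_kernel_def)

lemma gauss_kernel_le:
  assumes "0 < t" "0 \<le> r" "r \<le> norm (x - y)"
  shows "gauss_kernel k \<epsilon> t x y \<le> 1 / (4 * pi * t) powr (real k / 2) * exp (- (r\<^sup>2 / (4 * t)))"
proof -
  have "r\<^sup>2 \<le> (norm (x - y))\<^sup>2"
    using assms by (intro power_mono) auto
  then have "exp (- ((norm (x - y))\<^sup>2 / (4 * t))) \<le> exp (- (r\<^sup>2 / (4 * t)))"
    using assms(1) by (simp add: divide_right_mono)
  then show ?thesis
    by (simp add: gauss_kernel_def divide_right_mono)
qed

lemma gauss_tail_tendsto:
  assumes "0 < (r::real)"
  shows "((\<lambda>t. 1 / (4 * pi * t) powr (real k / 2) * exp (- (r\<^sup>2 / (4 * t))) / t) \<longlongrightarrow> 0) (at_right 0)"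
  using assms by real_asymp

text \<open>The tolerance \<open>e'\<close> fixes \<open>e\<close>, this fixes the chart radius
  \<open>d\<close>, and \<open>d\<close> fixes a distance \<open>r\<close> that separates
  \<open>x\<close> from the part of \<open>M\<close> outside the small chart. Terms whose constants
  depend on \<open>d\<close> and \<open>r\<close> carry, after division by \<open>t\<close>, a
  factor \<open>t\<close> or Gaussian decay, so they vanish in the limit.\<close>

theorem gauss_kernel_average_tendsto:
  fixes M :: "'a::euclidean_space set"
  assumes M: "compact M" "smooth_submanifold TYPE('k::finite) M"
    and V: "riemannian_volume TYPE('k) M V" "finite_measure V"
    and f: "smooth_on_submanifold M f" and x: "x \<in> M" and \<epsilon>: "0 < \<epsilon>"
  shows "((\<lambda>t. 1 / t * (\<integral>y. gauss_kernel CARD('k) \<epsilon> t x y * (f x - f y) \<partial>V)) \<longlongrightarrow> laplace_beltrami M f x) (at_right 0)"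
proof -
  interpret V: finite_measure V by fact
  obtain W0 and \<phi> :: "real^'k \<Rightarrow> 'a" where lp0: "local_parametrization M W0 \<phi>" and W0: "0 \<in> W0" and \<phi>0: "\<phi> 0 = x"
    and iso: "\<And>v w. frechet_derivative \<phi> (at 0) v \<bullet> frechet_derivative \<phi> (at 0) w = v \<bullet> w"
    and nrm: "\<And>z v w. frechet_derivative \<phi> (at 0) z \<bullet> deriv2 \<phi> 0 v w = 0"
    by (rule normal_parametrization[OF M(2) x]) blast
  obtain W F where W: "open W" "x \<in> W" "smooth_on W F" "\<forall>q\<in>W \<inter> M. F q = f q"
    using f[unfolded smooth_on_submanifold_def, rule_format, OF x] by blast
  \<comment> \<open>Inside \<open>W\<close> the extension \<open>F\<close> of \<open>f\<close> is
    available, and inside the ball of radius \<open>\<epsilon>\<close> the cut-off of the kernel is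
    inactive.\<close>
  define S where "S = W0 \<inter> \<phi> -` (W \<inter> ball x \<epsilon>)"
  have c\<phi>: "continuous_on W0 \<phi>" and oW0: "open W0"
    using lp0 by (auto simp: local_parametrization_def intro: smooth_on_imp_continuous_on)
  have S: "open S" "0 \<in> S"
    unfolding S_def using continuous_open_preimage[OF c\<phi> oW0 open_Int[OF W(1) open_ball]] W(2) W0 \<epsilon> \<phi>0
    by auto
  have lp: "local_parametrization M S \<phi>"
    using lp0 S(1) by (rule local_parametrization_restrict) (auto simp: S_def)
  have SW: "\<phi> ` S \<subseteq> W" "\<phi> ` S \<subseteq> ball x \<epsilon>" and SM: "\<phi> ` S \<subseteq> M"
    using lp by (auto simp: S_def local_parametrization_def)
  have FW: "\<And>y. y \<in> W \<inter> M \<Longrightarrow> F y = f y" using W(4) by blast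
  define p where "p = (\<lambda>u. f (\<phi> u))"
  have C2: "Ck_on 2 p S"
    unfolding p_def by (rule coordinate_C2[OF lp W(1,3) SW(1) FW])
  define l where "l = frechet_derivative p (at 0)"
  define \<beta> where "\<beta> = deriv2 p 0"
  define \<Delta> where "\<Delta> = - (\<Sum>b\<in>Basis. \<beta> b b)"
  have \<Delta>: "laplace_beltrami M f x = \<Delta>"
    using laplace_beltrami_normal_coordinates[OF lp W(1,3) SW(1) FW S(2) iso nrm]
    by (simp add: \<phi>0 p_def \<beta>_def \<Delta>_def)
  have l: "linear l" and \<beta>: "bilinear \<beta>"
    unfolding l_def \<beta>_def
    by (rule Ck2_linear_derivative[OF S C2 S(2)], rule bilinear_deriv2[OF S C2])
  obtain L where L: "0 < L" "\<And>h. \<bar>l h\<bar> \<le> L * norm h"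
    using linear_bounded_pos[OF l] by auto
  obtain N where N: "0 < N" "\<And>h k. \<bar>\<beta> h k\<bar> \<le> N * norm h * norm k"
    using bilinear_bounded_pos[OF \<beta>] by auto
  \<comment> \<open>Chosen before \<open>e\<close> and \<open>d\<close>, because the factor of
    \<open>e\<close> in the error must depend on neither. The summands account for the linear,
    quadratic and remainder terms when \<open>norm h\<close> and \<open>e\<close> are at most
    1.\<close>
  define C where "C = L + N + 1"
  have C: "0 \<le> C" using L N by (simp add: C_def)
  have chart: "\<exists>d>0. ball 0 d \<subseteq> S \<and> (\<forall>h. norm h < d \<longrightarrow>
      \<bar>(norm (\<phi> h - \<phi> 0))\<^sup>2 - (norm h)\<^sup>2\<bar> \<le> e * norm h ^ 3 \<and> (norm h)\<^sup>2 / 2 \<le> (norm (\<phi> h - \<phi> 0))\<^sup>2 \<and>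
      \<bar>volume_density \<phi> h - 1\<bar> \<le> e * norm h \<and> \<bar>volume_density \<phi> h\<bar> \<le> 2 \<and> 0 \<le> volume_density \<phi> h \<and>
      \<bar>p 0 - p h\<bar> \<le> C * norm h \<and> \<bar>p 0 - p h + l h + \<beta> h h / 2\<bar> \<le> e * (norm h)\<^sup>2)"
    if e: "0 < e" "e \<le> 1" for e
  proof -
    obtain d1 where d1: "0 < d1" "ball 0 d1 \<subseteq> S"
      "\<And>h. norm h < d1 \<Longrightarrow> \<bar>(norm (\<phi> h - \<phi> 0))\<^sup>2 - (norm h)\<^sup>2\<bar> \<le> e * norm h ^ 3"
      using squared_distance_expansion[OF lp S(2) iso nrm e(1)] by blast
    obtain d2 where d2: "0 < d2"
      "\<And>h. norm h < d2 \<Longrightarrow> \<bar>volume_density \<phi> h - 1\<bar> \<le> e * norm h"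
      using volume_density_normal[OF lp S(2) iso nrm] e(1) unfolding has_derivative_at_alt by auto
    obtain d3 where d3: "0 < d3"
      "\<And>h. norm h < d3 \<Longrightarrow> norm (p (0 + h) - p 0 - frechet_derivative p (at 0) h - (1/2) *\<^sub>R deriv2 p 0 h h) \<le> e * (norm h)\<^sup>2"
      using second_order_Taylor[OF S C2 e(1)] by blast
    \<comment> \<open>The cap 1/2 gives \<open>e * norm h \<le> 1 / 2\<close>, hence the lower bound
      on the distance and the nonnegativity of the density.\<close>
    define d where "d = min (min d1 d2) (min d3 (1/2))"
    show ?thesis
    proof (intro exI[of _ d] conjI allI impI)
      show "0 < d" using d1 d2 d3 by (simp add: d_def)
      show "ball 0 d \<subseteq> S" using d1(2) by (auto simp: d_def)
      fix h :: "real^'k" assume "norm h < d"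
      then have h: "norm h < d1" "norm h < d2" "norm h < d3" "norm h < 1/2"
        by (auto simp: d_def)
      let ?r = "norm h"
      show q: "\<bar>(norm (\<phi> h - \<phi> 0))\<^sup>2 - ?r\<^sup>2\<bar> \<le> e * ?r ^ 3"
        by (rule d1(3)[OF h(1)])
      have er: "e * ?r \<le> 1/2"
        using mult_mono[OF e(2), of ?r "1/2"] h(4) by simp
      have "e * ?r ^ 3 = e * ?r * ?r\<^sup>2"
        by (simp add: power2_eq_square power3_eq_cube)
      also have "\<dots> \<le> 1/2 * ?r\<^sup>2"
        using er by (intro mult_right_mono) auto
      finally show "?r\<^sup>2 / 2 \<le> (norm (\<phi> h - \<phi> 0))\<^sup>2"
        using q by linarith
      show \<rho>: "\<bar>volume_density \<phi> h - 1\<bar> \<le> e * ?r"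
        by (rule d2(2)[OF h(2)])
      show "\<bar>volume_density \<phi> h\<bar> \<le> 2" "0 \<le> volume_density \<phi> h"
        using \<rho> er by linarith+
      have "\<bar>p h - p 0 - l h - \<beta> h h / 2\<bar> \<le> e * ?r\<^sup>2"
        using d3(2)[OF h(3)] by (simp add: l_def \<beta>_def)
      then show p: "\<bar>p 0 - p h + l h + \<beta> h h / 2\<bar> \<le> e * ?r\<^sup>2"
        by linarith
      have "\<bar>p 0 - p h\<bar> \<le> \<bar>l h\<bar> + \<bar>\<beta> h h\<bar> + e * ?r\<^sup>2"
        using p by linarith
      also have "\<dots> \<le> L * ?r + N * ?r\<^sup>2 + 1 * ?r\<^sup>2"
        using L(2)[of h] N(2)[of h h] e(2) by (intro add_mono mult_right_mono) (auto simp: power2_eq_square)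
      also have "\<dots> \<le> L * ?r + N * ?r + 1 * ?r"
      proof -
        have "?r\<^sup>2 \<le> ?r"
          using mult_left_mono[of ?r 1 ?r] h(4) by (simp add: power2_eq_square)
        then show ?thesis
          using L(1) N(1) by (intro add_mono mult_left_mono) auto
      qed
      finally show "\<bar>p 0 - p h\<bar> \<le> C * ?r"
        by (simp add: C_def algebra_simps)
    qed
  qed
  have contf: "continuous_on M f"
    by (rule smooth_on_submanifold_imp_continuous_on[OF f])
  obtain B where B: "\<And>y. y \<in> M \<Longrightarrow> \<bar>f x - f y\<bar> \<le> B"
  proof -
    have "bounded ((\<lambda>y. f x - f y) ` M)"
      using contf M(1) by (intro compact_imp_bounded compact_continuous_image continuous_intros)
    then show thesis
      using that unfolding bounded_iff by auto
  qed
  have B0: "0 \<le> B" using B[OF x] by simp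
  have sV: "sets V = sets (restrict_space borel M)" and spV: "space V = M"
    using V(1) sets_eq_imp_space_eq[of V "restrict_space borel M"]
    by (auto simp: riemannian_volume_def space_restrict_space)
  have fm: "f \<in> borel_measurable V"
    using borel_measurable_continuous_on_restrict[OF contf] measurable_cong_sets[OF sV refl] by blast
  have gm: "gauss_kernel k \<epsilon> t x \<in> borel_measurable V" for k t
    using measurable_restrict_space1[OF gauss_kernel_measurable, of k \<epsilon> t x M] measurable_cong_sets[OF sV refl] by blast
  define J where "J t y = gauss_kernel CARD('k) \<epsilon> t x y * (f x - f y)" for t y
  have Jm: "J t \<in> borel_measurable V" for t
    unfolding J_def[abs_def] using fm gm by measurable
  \<comment> \<open>A bound at distance at least \<open>r\<close> from \<open>x\<close>: with
    \<open>r = 0\<close> it yields integrability, with positive \<open>r\<close> the exponentially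
    small tail.\<close>
  define T where "T r t = 1 / (4 * pi * t) powr (real CARD('k) / 2) * exp (- (r\<^sup>2 / (4 * t))) * B" for r t
  have JT: "\<bar>J t y\<bar> \<le> T r t" if "0 < t" "0 \<le> r" "r \<le> norm (x - y)" "y \<in> M" for t r y
    unfolding J_def T_def abs_mult
    using gauss_kernel_le[OF that(1-3)] B[OF that(4)] by (intro mult_mono) (auto simp: gauss_kernel_nonneg)
  have Ji: "integrable V (J t)" if "0 < t" for t
    using JT[OF that, of 0] by (intro V.integrable_const_bound[of _ "T 0 t"] Jm) (auto simp: spV)
  have "((\<lambda>t. 1 / t * (\<integral>y. J t y \<partial>V)) \<longlongrightarrow> \<Delta>) (at_right 0)"
    unfolding tendsto_iff dist_real_def
  proof (intro allI impI)
    fix e' :: real assume e': "0 < e'"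
    define C1 where "C1 = 2 powr real DIM(real^'k) * (528 * C + 16)"
    have C1: "0 < C1" using C by (simp add: C1_def add_nonneg_pos)
    \<comment> \<open>Each of the three error terms is allowed a quarter of
      \<open>e'\<close>.\<close>
    define e where "e = min 1 (e' / (4 * C1))"
    have e: "0 < e" "e \<le> 1" and eC1: "e * C1 \<le> e' / 4"
      using e' C1 by (auto simp: e_def min_def field_simps)
    obtain d where d: "0 < d" "ball 0 d \<subseteq> S"
      and q: "\<And>h. norm h < d \<Longrightarrow> \<bar>(norm (\<phi> h - \<phi> 0))\<^sup>2 - (norm h)\<^sup>2\<bar> \<le> e * norm h ^ 3"
        "\<And>h. norm h < d \<Longrightarrow> (norm h)\<^sup>2 / 2 \<le> (norm (\<phi> h - \<phi> 0))\<^sup>2"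
      and \<rho>: "\<And>h. norm h < d \<Longrightarrow> \<bar>volume_density \<phi> h - 1\<bar> \<le> e * norm h"
        "\<And>h. norm h < d \<Longrightarrow> \<bar>volume_density \<phi> h\<bar> \<le> 2" "\<And>h. norm h < d \<Longrightarrow> 0 \<le> volume_density \<phi> h"
      and p: "\<And>h. norm h < d \<Longrightarrow> \<bar>p 0 - p h\<bar> \<le> C * norm h"
        "\<And>h. norm h < d \<Longrightarrow> \<bar>p 0 - p h + l h + \<beta> h h / 2\<bar> \<le> e * (norm h)\<^sup>2"
      using chart[OF e] by blast
    let ?B = "ball (0::real^'k) d"
    have lpB: "local_parametrization M ?B \<phi>"
      using lp d(2) by (intro local_parametrization_restrict[OF lp]) auto
    have cont: "continuous_on ?B (\<lambda>h. (norm (\<phi> h - \<phi> 0))\<^sup>2)" "continuous_on ?B (volume_density \<phi>)"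
      "continuous_on ?B (\<lambda>h. p 0 - p h)"
      using continuous_on_subset[OF c\<phi>, of ?B] d(2) volume_density_continuous_on[OF lpB]
        continuous_on_subset[OF Ck_on_imp_continuous_on[OF C2] d(2)]
      by (auto simp: S_def intro!: continuous_intros)
    obtain C2' where C2': "\<And>t. 0 < t \<Longrightarrow> \<bar>(\<integral>h. indicator ?B h *
      (1 / (4 * pi * t) powr (real DIM(real^'k) / 2) * exp (- ((norm (\<phi> h - \<phi> 0))\<^sup>2 / (4 * t))) * (p 0 - p h) * volume_density \<phi> h) \<partial>lborel)
      + t * (\<Sum>b\<in>Basis. \<beta> b b)\<bar> \<le> e * C1 * t + C2' * t\<^sup>2"
      using heat_kernel_perturbation[OF d(1) less_imp_le[OF e(1)] C l \<beta> cont q \<rho>(1,2) p] unfolding C1_def by blast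
    let ?N = "\<phi> ` ?B"
    have NV: "?N \<in> sets V"
      by (rule riemannian_volume_restrict_eq_distr(2)[OF V(1) lpB])
    obtain T0 where T0: "open T0" "?N = M \<inter> T0"
      using lpB by (auto simp: local_parametrization_def openin_open)
    have "x \<in> ?N"
      using d(1) \<phi>0 by (intro image_eqI[of _ _ 0]) auto
    \<comment> \<open>The chart image is relatively open, so every point of \<open>M\<close> outside
      it has distance at least \<open>r\<close> from \<open>x\<close>.\<close>
    then obtain r where r: "0 < r" "ball x r \<subseteq> T0"
      using T0 open_contains_ball by blast
    have main: "\<bar>(\<integral>y. J t y \<partial>V) - t * \<Delta>\<bar> \<le> e * C1 * t + C2' * t\<^sup>2 + T r t * measure V M" if t: "0 < t" for t
    proof -
      have NC: "M - ?N \<in> sets V"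
        using sets.compl_sets[OF NV] by (simp add: spV)
      have "(\<integral>y. J t y \<partial>V) = (\<integral>y. indicator ?N y * J t y + indicator (M - ?N) y * J t y \<partial>V)"
        by (intro Bochner_Integration.integral_cong) (auto simp: spV indicator_def)
      also have "\<dots> = (\<integral>y. indicator ?N y * J t y \<partial>V) + (\<integral>y. indicator (M - ?N) y * J t y \<partial>V)"
        using integrable_real_mult_indicator[OF NV Ji[OF t]] integrable_real_mult_indicator[OF NC Ji[OF t]]
        by (intro Bochner_Integration.integral_add) (simp_all add: mult.commute)
      finally have split: "(\<integral>y. J t y \<partial>V) = (\<integral>y. indicator ?N y * J t y \<partial>V) + (\<integral>y. indicator (M - ?N) y * J t y \<partial>V)" .
      have "(\<integral>y. indicator ?N y * J t y \<partial>V) = (\<integral>u. indicator ?B u * (J t (\<phi> u) * volume_density \<phi> u) \<partial>lborel)"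
        using \<rho>(3) by (intro integral_riemannian_volume_param[OF V(1) lpB _ Jm]) simp
      also have "\<dots> = (\<integral>h. indicator ?B h *
        (1 / (4 * pi * t) powr (real DIM(real^'k) / 2) * exp (- ((norm (\<phi> h - \<phi> 0))\<^sup>2 / (4 * t))) * (p 0 - p h) * volume_density \<phi> h) \<partial>lborel)"
      proof (intro Bochner_Integration.integral_cong refl)
        fix h :: "real^'k"
        have "norm (x - \<phi> h) < \<epsilon>" if "h \<in> ?B"
          using that SW(2) d(2) by (auto simp: dist_norm subset_iff)
        then show "indicator ?B h * (J t (\<phi> h) * volume_density \<phi> h) = indicator ?B h *
          (1 / (4 * pi * t) powr (real DIM(real^'k) / 2) * exp (- ((norm (\<phi> h - \<phi> 0))\<^sup>2 / (4 * t))) * (p 0 - p h) * volume_density \<phi> h)"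
          by (auto simp: indicator_def J_def gauss_kernel_def \<phi>0 p_def norm_minus_commute)
      qed
      finally have 1: "\<bar>(\<integral>y. indicator ?N y * J t y \<partial>V) - t * \<Delta>\<bar> \<le> e * C1 * t + C2' * t\<^sup>2"
        using C2'[OF t] by (simp add: \<Delta>_def)
      have "\<bar>\<integral>y. indicator (M - ?N) y * J t y \<partial>V\<bar> \<le> (\<integral>y. T r t \<partial>V)"
      proof (rule order_trans[OF integral_abs_bound Bochner_Integration.integral_mono])
        show "integrable V (\<lambda>y. \<bar>indicator (M - ?N) y * J t y\<bar>)"
          using integrable_real_mult_indicator[OF NC Ji[OF t]] by (intro integrable_abs) (simp add: mult.commute)
        fix y assume "y \<in> space V"
        then have y: "y \<in> M" by (simp add: spV)
        have "0 \<le> T r t"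
          using B0 by (simp add: T_def)
        moreover have "r \<le> norm (x - y)" if "y \<notin> ?N"
        proof -
          have "y \<notin> ball x r" using that y T0(2) r(2) by blast
          then show ?thesis by (simp add: dist_norm)
        qed
        ultimately show "\<bar>indicator (M - ?N) y * J t y\<bar> \<le> T r t"
          using JT[OF t less_imp_le[OF r(1)] _ y] by (auto simp: indicator_def)
      qed simp
      also have "\<dots> = T r t * measure V M"
        by (simp add: spV)
      finally show ?thesis
        using 1 unfolding split by linarith
    qed
    have "((\<lambda>t. C2' * t) \<longlongrightarrow> C2' * 0) (at_right 0)"
      by (intro tendsto_intros)
    then have ev1: "eventually (\<lambda>t. C2' * t < e' / 4) (at_right 0)"
      using e' by (intro order_tendstoD(2)[of _ 0]) auto
    have "((\<lambda>t. 1 / (4 * pi * t) powr (real CARD('k) / 2) * exp (- (r\<^sup>2 / (4 * t))) / t * (B * measure V M)) \<longlongrightarrow> 0 * (B * measure V M)) (at_right 0)"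
      by (intro tendsto_mult gauss_tail_tendsto r tendsto_const)
    then have ev2: "eventually (\<lambda>t. 1 / (4 * pi * t) powr (real CARD('k) / 2) * exp (- (r\<^sup>2 / (4 * t))) / t * (B * measure V M) < e' / 4) (at_right 0)"
      using e' by (intro order_tendstoD(2)[of _ 0]) auto
    have ev3: "eventually (\<lambda>t::real. 0 < t) (at_right 0)"
      by (rule eventually_at_right_less)
    show "\<forall>\<^sub>F t in at_right 0. \<bar>1 / t * (\<integral>y. J t y \<partial>V) - \<Delta>\<bar> < e'"
      using ev1 ev2 ev3
    proof eventually_elim
      case (elim t)
      have "1 / t * (\<integral>y. J t y \<partial>V) - \<Delta> = ((\<integral>y. J t y \<partial>V) - t * \<Delta>) / t"
        using elim(3) by (simp add: field_simps)
      also have "\<bar>\<dots>\<bar> \<le> (e * C1 * t + C2' * t\<^sup>2 + T r t * measure V M) / t"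
        using main[OF elim(3)] elim(3) by (simp add: divide_right_mono)
      also have "\<dots> = e * C1 + C2' * t + 1 / (4 * pi * t) powr (real CARD('k) / 2) * exp (- (r\<^sup>2 / (4 * t))) / t * (B * measure V M)"
        using elim(3) by (simp add: T_def power2_eq_square add_divide_distrib)
      also have "\<dots> < e'"
        using eC1 elim(1,2) e' by linarith
      finally show ?case .
    qed
  qed
  then show ?thesis
    by (simp only: J_def \<Delta>)
qed

section \<open>Concentration around the expectation\<close>

text \<open>The choice of \<open>t\<close> is exactly what makes Hoeffding's inequality effective for summands of
  size \<open>O(1 / (n * t powr (k / 2 + 1)))\<close>.\<close>

lemma bandwidth_limits:
  fixes \<alpha> :: real and k :: nat
  assumes \<alpha>: "0 < \<alpha>"
  defines "t \<equiv> \<lambda>n::nat. real n powr (- 1 / (real k + 2 + \<alpha>))"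
  shows "filterlim t (at_right 0) sequentially"
    and "filterlim (\<lambda>n. real n * (t n)\<^sup>2 * (4 * pi * t n) powr real k) at_top sequentially"
proof -
  define a where "a = 1 / (real k + 2 + \<alpha>)"
  have a: "0 < a" using \<alpha> by (simp add: a_def add_pos_nonneg)
  have t: "t n = real n powr - a" for n
    by (simp add: t_def a_def)
  show "filterlim t (at_right 0) sequentially"
    unfolding t[abs_def] using a by real_asymp
  \<comment> \<open>Squaring \<open>1 / t\<close> and the kernel height costs \<open>t\<close> to
    the power \<open>k + 2\<close>; \<open>b\<close> is the exponent of \<open>n\<close> that
    survives thanks to \<alpha>.\<close>
  define b where "b = \<alpha> / (real k + 2 + \<alpha>)"
  have b: "0 < b" using \<alpha> by (simp add: b_def add_pos_nonneg)
  have "filterlim (\<lambda>n. (4 * pi) powr real k * real n powr b) at_top sequentially"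
    using b by (intro filterlim_tendsto_pos_mult_at_top[OF tendsto_const]) (simp, real_asymp)
  moreover have "real n * (t n)\<^sup>2 * (4 * pi * t n) powr real k = (4 * pi) powr real k * real n powr b"
    if "0 < n" for n
  proof -
    define s where "s = real k + 2 + \<alpha>"
    have s: "s \<noteq> 0" "\<alpha> = s - (2 + real k)"
      using \<alpha> by (simp_all add: s_def add_pos_nonneg)
    have "1 + (- a * 2 + - a * real k) = b"
      unfolding a_def b_def s_def[symmetric] using s(1)
      by (subst s(2)) (simp add: diff_divide_distrib add_divide_distrib)
    then have "real n powr b = real n powr 1 * (real n powr (- a * 2) * real n powr (- a * real k))"
      unfolding powr_add[symmetric] by (simp only:)
    also have "\<dots> = real n * ((t n)\<^sup>2 * t n powr real k)"
      using that by (simp add: t powr_powr power2_eq_square mult.commute flip: powr_add)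
    finally show ?thesis
      using that by (simp add: powr_mult t)
  qed
  then have "eventually (\<lambda>n. (4 * pi) powr real k * real n powr b = real n * (t n)\<^sup>2 * (4 * pi * t n) powr real k) sequentially"
    by (intro eventually_mono[OF eventually_gt_at_top[of 0]]) simp
  ultimately show "filterlim (\<lambda>n. real n * (t n)\<^sup>2 * (4 * pi * t n) powr real k) at_top sequentially"
    by (simp add: filterlim_cong[OF refl refl])
qed

theorem theorem3p1:
  fixes M :: "(real^'m) set"
    and V :: "(real^'m) measure"
    and P f :: "real^'m \<Rightarrow> real"
    and \<Omega> :: "'w measure"
    and X :: "nat \<Rightarrow> 'w \<Rightarrow> real^'m"
    and x :: "real^'m"
    and \<alpha> \<epsilon> :: real
  assumes "compact M"
    and "smooth_submanifold TYPE('k::finite) M"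
    and "riemannian_volume TYPE('k) M V"
    and "smooth_on_submanifold M P"
    and "\<forall>y\<in>M. 0 \<le> P y"
    and "(\<integral>y. P y \<partial>V) = 1"
    and "0 < (INF y\<in>M. P y)"
    and "prob_space \<Omega>"
    and "prob_space.indep_vars \<Omega> (\<lambda>_. V) X {1..}"
    and "\<forall>j\<ge>1. distributed \<Omega> V (X j) (\<lambda>y. ennreal (P y))"
    and "smooth_on_submanifold M f"
    and "x \<in> M"
    and "0 < \<alpha>"
    and "0 < \<epsilon>"
  shows "converges_in_probability \<Omega>
    (\<lambda>n \<omega>. let t = real n powr (- 1 / (real CARD('k) + 2 + \<alpha>))
      in 1 / (real n * t) * graph_laplacian CARD('k) \<epsilon> P (\<lambda>j. X j \<omega>) n t f x)
    (laplace_beltrami M f x)"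
proof -
  interpret \<Omega>: prob_space \<Omega> by fact
  define c where "c = (INF y\<in>M. P y)"
  have c: "0 < c" using assms(7) by (simp add: c_def)
  \<comment> \<open>An infimum of reals is a lower bound only over a set bounded below, which
    nonnegativity of \<open>P\<close> provides.\<close>
  have Pc: "c \<le> P y" if "y \<in> M" for y
    unfolding c_def using assms(5) that by (intro cINF_lower bdd_belowI2[of _ 0]) auto
  have sV: "sets V = sets (restrict_space borel M)" and spV: "space V = M"
    using assms(3) sets_eq_imp_space_eq[of V "restrict_space borel M"]
    by (auto simp: riemannian_volume_def space_restrict_space)
  have mV: "g \<in> borel_measurable V" if "continuous_on M g" for g :: "real^'m \<Rightarrow> real"
    using borel_measurable_continuous_on_restrict[OF that] measurable_cong_sets[OF sV refl] by blast
  have contf: "continuous_on M f" and fm: "f \<in> borel_measurable V" and Pm: "P \<in> borel_measurable V"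
    using assms(4,11) by (auto intro!: mV smooth_on_submanifold_imp_continuous_on)
  have gm: "gauss_kernel k \<epsilon> t x \<in> borel_measurable V" for k t
    using measurable_restrict_space1[OF gauss_kernel_measurable, of k \<epsilon> t x M] measurable_cong_sets[OF sV refl] by blast
  have "finite_measure V"
  proof
    \<comment> \<open>The integral of a non-integrable function is 0 by convention, so the value 1
      forces integrability. \<open>P\<close> dominates the constant \<open>c\<close>, which is
      therefore integrable too, and the volume is finite.\<close>
    have "integrable V P"
      using assms(6) not_integrable_integral_eq[of V P] by fastforce
    then have "integrable V (\<lambda>_. c)"
    proof (rule Bochner_Integration.integrable_bound)
      show "AE y in V. norm c \<le> norm (P y)"
        using Pc c by (intro AE_I2) (force simp: spV)
    qed simp
    then have "ennreal c * emeasure V (space V) < \<infinity>"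
      using c by (simp add: integrable_iff_bounded)
    then show "emeasure V (space V) \<noteq> \<infinity>"
      using c by (metis ennreal_mult_top ennreal_eq_0_iff infinity_ennreal_def less_irrefl not_le)
  qed
  obtain B where B: "0 < B" "\<And>y. y \<in> M \<Longrightarrow> \<bar>f x - f y\<bar> \<le> B"
  proof -
    have "bounded ((\<lambda>y. f x - f y) ` M)"
      using contf assms(1) by (intro compact_imp_bounded compact_continuous_image continuous_intros)
    then show thesis
      using that unfolding bounded_pos by auto
  qed
  define t where "t n = real n powr (- 1 / (real CARD('k) + 2 + \<alpha>))" for n :: nat
  have tpos: "0 < t n" if "0 < n" for n
    using that by (simp add: t_def)
  define h where "h n y = 1 / (real n * t n) * (weight CARD('k) \<epsilon> P (t n) x y * (f x - f y))" for n y
  have hm: "h n \<in> borel_measurable V" for n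
    unfolding h_def[abs_def] weight_def using fm Pm gm by measurable
  define Z where "Z n \<omega> = (\<Sum>j=1..n. h n (X j \<omega>))" for n \<omega>
  have Z: "(\<lambda>n \<omega>. let t = real n powr (- 1 / (real CARD('k) + 2 + \<alpha>))
      in 1 / (real n * t) * graph_laplacian CARD('k) \<epsilon> P (\<lambda>j. X j \<omega>) n t f x) = Z"
    by (intro ext) (simp add: Z_def h_def t_def Let_def graph_laplacian_def sum_distrib_left)
  have Xm: "X j \<in> measurable \<Omega> V" if "1 \<le> j" for j
    using assms(10) that by (blast intro: distributed_measurable)
  have Zm: "Z n \<in> borel_measurable \<Omega>" for n
    unfolding Z_def[abs_def] using measurable_compose[OF Xm hm] by (intro borel_measurable_sum) auto
  define b where "b n = 1 / (real n * t n) * (1 / c * (1 / (4 * pi * t n) powr (real CARD('k) / 2)) * B)" for n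
  have hb: "\<bar>h n y\<bar> \<le> b n" if "0 < n" "y \<in> M" for n y
  proof -
    have "\<bar>weight CARD('k) \<epsilon> P (t n) x y\<bar> \<le> 1 / c * (1 / (4 * pi * t n) powr (real CARD('k) / 2))"
      unfolding weight_def abs_mult using Pc[OF that(2)] c gauss_kernel_le[OF tpos[OF that(1)], of 0 x y]
      by (intro mult_mono) (auto simp: gauss_kernel_nonneg frac_le)
    then show ?thesis
      unfolding h_def b_def abs_mult using B(2)[OF that(2)] tpos[OF that(1)] c
      by (intro mult_mono) auto
  qed
  have bpos: "0 < b n" if "0 < n" for n
    using tpos[OF that] that c B(1) by (simp add: b_def)
  define I where "I s = 1 / s * (\<integral>y. gauss_kernel CARD('k) \<epsilon> s x y * (f x - f y) \<partial>V)" for s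
  have I: "(I \<longlongrightarrow> laplace_beltrami M f x) (at_right 0)"
    unfolding I_def[abs_def]
    by (rule gauss_kernel_average_tendsto[OF assms(1-3) \<open>finite_measure V\<close> assms(11,12,14)])
  have Eh: "\<Omega>.expectation (\<lambda>\<omega>. h n (X j \<omega>)) = I (t n) / real n" if "1 \<le> j" for n j
  proof -
    have "\<Omega>.expectation (\<lambda>\<omega>. h n (X j \<omega>)) = (\<integral>y. P y * h n y \<partial>V)"
      using assms(5,10) that hm by (intro distributed_integral[symmetric]) (auto simp: spV)
    also have "\<dots> = (\<integral>y. 1 / (real n * t n) * (gauss_kernel CARD('k) \<epsilon> (t n) x y * (f x - f y)) \<partial>V)"
    proof (rule Bochner_Integration.integral_cong[OF refl])
      fix y assume "y \<in> space V"
      then have "P y \<noteq> 0" using Pc[of y] c by (auto simp: spV)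
      then show "P y * h n y = 1 / (real n * t n) * (gauss_kernel CARD('k) \<epsilon> (t n) x y * (f x - f y))"
        by (simp add: h_def weight_def)
    qed
    also have "\<dots> = I (t n) / real n"
      by (simp add: I_def)
    finally show ?thesis .
  qed
  have hoeff: "measure \<Omega> {\<omega>\<in>space \<Omega>. \<bar>Z n \<omega> - I (t n)\<bar> \<ge> \<delta>} \<le> 2 * exp (- 2 * \<delta>\<^sup>2 / (\<Sum>j=1..n. (b n - - b n)\<^sup>2))"
    if n: "0 < n" and \<delta>: "0 \<le> \<delta>" for n \<delta>
  proof -
    have iv: "\<Omega>.indep_vars (\<lambda>_. borel) (\<lambda>j \<omega>. h n (X j \<omega>)) {1..n}"
      using hm by (intro \<Omega>.indep_vars_compose2[OF \<Omega>.indep_vars_subset[OF assms(9)]]) auto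
    interpret H: Hoeffding_ineq \<Omega> "{1..n}" "\<lambda>j \<omega>. h n (X j \<omega>)" "\<lambda>_. - b n" "\<lambda>_. b n" "I (t n)"
    proof unfold_locales
      show "finite {1..n}" by simp
      show "\<Omega>.indep_vars (\<lambda>_. borel) (\<lambda>j \<omega>. h n (X j \<omega>)) {1..n}" by (rule iv)
      show "AE \<omega> in \<Omega>. h n (X j \<omega>) \<in> {- b n..b n}" if "j \<in> {1..n}" for j
      proof (rule AE_I2)
        fix \<omega> assume "\<omega> \<in> space \<Omega>"
        then have "X j \<omega> \<in> M"
          using measurable_space[OF Xm[of j]] that by (simp add: spV)
        from hb[OF n this] show "h n (X j \<omega>) \<in> {- b n..b n}" by auto
      qed
      show "I (t n) \<equiv> \<Sum>j\<in>{1..n}. \<Omega>.expectation (\<lambda>\<omega>. h n (X j \<omega>))"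
        using n by (intro eq_reflection) (simp add: Eh)
    qed
    have "0 < (\<Sum>j=1..n. (b n - - b n)\<^sup>2)"
      using n bpos[OF n] by simp
    from H.Hoeffding_ineq_abs_ge[OF \<delta> this] show ?thesis
      by (simp add: Z_def)
  qed
  \<comment> \<open>There are \<open>n\<close> summands with values in an interval of length
    \<open>2 * b n\<close>: the 4 is the square of that 2, and \<open>B / c\<close> is what remains
    of \<open>b n\<close> without kernel height and scaling.\<close>
  define K where "K = 4 * (B / c)\<^sup>2"
  have K: "0 < K" using B c by (simp add: K_def)
  have sq: "(\<Sum>j=1..n. (b n - - b n)\<^sup>2) = K / (real n * (t n)\<^sup>2 * (4 * pi * t n) powr real CARD('k))" if n: "0 < n" for n
  proof -
    have "((4 * pi * t n) powr (real CARD('k) / 2))\<^sup>2 = (4 * pi * t n) powr real CARD('k)"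
      by (simp add: power2_eq_square flip: powr_add)
    then show ?thesis
      using n tpos[OF n] c by (simp add: b_def K_def power_mult_distrib power_divide power2_eq_square field_simps)
  qed
  note lim = bandwidth_limits[OF assms(13), of "CARD('k)", folded t_def]
  show ?thesis
    unfolding Z converges_in_probability_def
  proof (intro conjI allI impI Zm)
    fix \<delta> :: real assume \<delta>: "0 < \<delta>"
    have "((\<lambda>n. I (t n)) \<longlongrightarrow> laplace_beltrami M f x) sequentially"
      by (rule filterlim_compose[OF I lim(1)])
    from tendstoD[OF this half_gt_zero[OF \<delta>]]
    have ev: "eventually (\<lambda>n. \<bar>I (t n) - laplace_beltrami M f x\<bar> < \<delta> / 2) sequentially"
      by (simp only: dist_real_def)
    define r where "r n = real n * (t n)\<^sup>2 * (4 * pi * t n) powr real CARD('k)" for n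
    have "filterlim (\<lambda>n. \<delta>\<^sup>2 / (2 * K) * r n) at_top sequentially"
      using \<delta> K lim(2) unfolding r_def by (intro filterlim_tendsto_pos_mult_at_top[OF tendsto_const]) auto
    then have "filterlim (\<lambda>n. - (\<delta>\<^sup>2 / (2 * K) * r n)) at_bot sequentially"
      by (simp add: filterlim_uminus_at_bot)
    from tendsto_mult[OF tendsto_const[of 2] filterlim_compose[OF exp_at_bot this]]
    have up: "(\<lambda>n. 2 * exp (- (\<delta>\<^sup>2 / (2 * K) * r n))) \<longlonglongrightarrow> 0"
      by simp
    show "(\<lambda>n. measure \<Omega> {\<omega> \<in> space \<Omega>. \<bar>Z n \<omega> - laplace_beltrami M f x\<bar> > \<delta>}) \<longlonglongrightarrow> 0"
    proof (rule tendsto_sandwich[OF _ _ tendsto_const up])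
      show "eventually (\<lambda>n. measure \<Omega> {\<omega> \<in> space \<Omega>. \<bar>Z n \<omega> - laplace_beltrami M f x\<bar> > \<delta>}
        \<le> 2 * exp (- (\<delta>\<^sup>2 / (2 * K) * r n))) sequentially"
        using ev eventually_gt_at_top[of 0]
      proof eventually_elim
        case (elim n)
        \<comment> \<open>The bias is below \<open>\<delta> / 2\<close>, so a deviation beyond
          \<open>\<delta>\<close> must contain a fluctuation of at least \<open>\<delta> / 2\<close>
          around the expectation \<open>I (t n)\<close>.\<close>
        have "measure \<Omega> {\<omega> \<in> space \<Omega>. \<bar>Z n \<omega> - laplace_beltrami M f x\<bar> > \<delta>}
          \<le> measure \<Omega> {\<omega>\<in>space \<Omega>. \<bar>Z n \<omega> - I (t n)\<bar> \<ge> \<delta> / 2}"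
        proof (rule \<Omega>.finite_measure_mono)
          show "{\<omega> \<in> space \<Omega>. \<bar>Z n \<omega> - laplace_beltrami M f x\<bar> > \<delta>} \<subseteq> {\<omega>\<in>space \<Omega>. \<bar>Z n \<omega> - I (t n)\<bar> \<ge> \<delta> / 2}"
          proof (intro Collect_mono impI conjI; elim conjE)
            fix \<omega> assume "\<bar>Z n \<omega> - laplace_beltrami M f x\<bar> > \<delta>"
            then show "\<bar>Z n \<omega> - I (t n)\<bar> \<ge> \<delta> / 2"
              using elim(1) by linarith
          qed
          show "{\<omega>\<in>space \<Omega>. \<bar>Z n \<omega> - I (t n)\<bar> \<ge> \<delta> / 2} \<in> sets \<Omega>"
            using Zm[of n] by measurable
        qed
        also have "\<dots> \<le> 2 * exp (- 2 * (\<delta> / 2)\<^sup>2 / (\<Sum>j=1..n. (b n - - b n)\<^sup>2))"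
          using \<delta> by (intro hoeff elim(2)) simp
        also have "- 2 * (\<delta> / 2)\<^sup>2 / (\<Sum>j=1..n. (b n - - b n)\<^sup>2) = - (\<delta>\<^sup>2 / (2 * K) * r n)"
          unfolding sq[OF elim(2)] r_def by (simp add: power_divide)
        finally show ?case .
      qed
    qed simp
  qed
qed

end
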